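(* Let $s\in(0,1]$ and $p\in[1,+\infty)$ be such that $sp=N$ and $s\neq p$. Let $\Omega\subset\mathbb{R}^N$ be an open and bounded domain with Lipschitz boundary. Let $\widetilde s,\widetilde p$ satisfy $$\text{either}\quad\begin{cases}0<\widetilde s<s,\\ 1\le\widetilde p\le\dfrac{N}{\widetilde s},\end{cases}\qquad\text{or}\qquad\begin{cases}\widetilde s=0,\\ 1\le\widetilde p<+\infty.\end{cases}$$ Then there exists a positive constant $C=C(N,s,p,\widetilde s,\widetilde p,\Omega)$ such that, for any $u\in W^{s,p}(\Omega)$, $$\|u\|_{W^{\widetilde s,\widetilde p}(\Omega)}\le C\,\|u\|_{W^{s,p}(\Omega)},$$ namely, the space $W^{s,p}(\Omega)$ is continuously embedded in $W^{\widetilde s,\widetilde p}(\Omega)$. Moreover, the curve $\gamma:[0,1]\to\mathbb{R}^2$ defined as $$\gamma(\theta):=(s_\theta,p_\theta)=\left(\theta\widetilde s+(1-\theta)s,\ \frac{p\,\widetilde p}{\widetilde p+\theta(p-\widetilde p)}\right)$$ is such that, if $0\le\theta_1\le\theta_2\le1$, then the space $W^{s_{\theta_1},p_{\theta_1}}(\Omega)$ is continuously embedded in $W^{s_{\theta_2},p_{\theta_2}}(\Omega)$. In addition, if $N=1$, then the space $W^{1,1}(\Omega)$ is also continuously embedded in $L^\infty(\Omega)$.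
   Context: $N\ge1$ is an integer and functions are real-valued and measurable. For $s\in[0,1]$ and $p\in[1,+\infty)$ define $[u]_{W^{0,p}(\Omega)}:=\|u\|_{L^p(\Omega)}$, $[u]_{W^{1,p}(\Omega)}:=\|\nabla u\|_{L^p(\Omega)}$ (weak gradient) and, for $s\in(0,1)$, $$[u]_{W^{s,p}(\Omega)}:=\left(c_{N,s,p}\iint_{\Omega\times\Omega}\frac{|u(x)-u(y)|^p}{|x-y|^{N+sp}}\,dx\,dy\right)^{1/p},\qquad c_{N,s,p}:=\frac{s\,2^{2s-1}\,\Gamma\left(\frac{ps+p+N-2}{2}\right)}{\pi^{N/2}\,\Gamma(1-s)}.$$ Set $W^{s,p}(\Omega):=\{u\in L^p(\Omega):[u]_{W^{s,p}(\Omega)}<+\infty\}$, with norm $\|u\|_{W^{0,p}(\Omega)}:=\|u\|_{L^p(\Omega)}$ if $s=0$ and $\|u\|_{W^{s,p}(\Omega)}:=\big([u]^p_{W^{s,p}(\Omega)}+\|u\|^p_{L^p(\Omega)}\big)^{1/p}$ if $s\in(0,1]$. *)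

theory Defs
  imports "HOL-Analysis.Analysis" "HOL-Probability.Essential_Supremum"
begin

section \<open>Open sets with Lipschitz boundary\<close>

text \<open>Near every boundary point, \<open>\<Omega>\<close> is the strict epigraph, in the direction of some unit vector
  \<open>e\<close>, of a Lipschitz function of the hyperplane orthogonal to \<open>e\<close>. The vector
  \<open>x - (x \<bullet> e) *\<^sub>R e\<close> is the projection of \<open>x\<close> to that hyperplane (which is \<open>{0}\<close> in dimension one).
  Connectedness is not part of the definition.\<close>

definition lipschitz_boundary :: "'a::euclidean_space set \<Rightarrow> bool" where
  "lipschitz_boundary \<Omega> \<longleftrightarrow>
    (\<forall>z\<in>frontier \<Omega>. \<exists>e r L (\<phi> :: 'a \<Rightarrow> real).
        norm e = 1 \<and> 0 < r \<and> L-lipschitz_on {y. y \<bullet> e = 0} \<phi> \<and>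
        \<Omega> \<inter> ball z r = {x \<in> ball z r. \<phi> (x - (x \<bullet> e) *\<^sub>R e) < x \<bullet> e})"


section \<open>Weak gradients\<close>

primrec C_k :: "nat \<Rightarrow> ('a::euclidean_space \<Rightarrow> real) \<Rightarrow> bool" where
  "C_k 0 f \<longleftrightarrow> continuous_on UNIV f"
| "C_k (Suc k) f \<longleftrightarrow> (\<forall>x. f differentiable (at x)) \<and>
     (\<forall>e\<in>Basis. C_k k (\<lambda>x. frechet_derivative f (at x) e))"

definition test_function :: "'a::euclidean_space set \<Rightarrow> ('a \<Rightarrow> real) \<Rightarrow> bool" where
  "test_function \<Omega> \<phi> \<longleftrightarrow>
     (\<forall>k. C_k k \<phi>) \<and> compact (closure {x. \<phi> x \<noteq> 0}) \<and> closure {x. \<phi> x \<noteq> 0} \<subseteq> \<Omega>"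

definition locally_integrable ::
    "'a::euclidean_space set \<Rightarrow> ('a \<Rightarrow> 'b::euclidean_space) \<Rightarrow> bool" where
  "locally_integrable \<Omega> f \<longleftrightarrow> (\<forall>K. compact K \<and> K \<subseteq> \<Omega> \<longrightarrow> integrable (lebesgue_on K) f)"

definition is_weak_gradient ::
    "'a::euclidean_space set \<Rightarrow> ('a \<Rightarrow> real) \<Rightarrow> ('a \<Rightarrow> 'a) \<Rightarrow> bool" where
  "is_weak_gradient \<Omega> u g \<longleftrightarrow>
     locally_integrable \<Omega> u \<and> g \<in> borel_measurable (lebesgue_on \<Omega>) \<and> locally_integrable \<Omega> g \<and>
     (\<forall>\<phi>. test_function \<Omega> \<phi> \<longrightarrow> (\<forall>e\<in>Basis.
        (LINT x|lebesgue_on \<Omega>. u x * frechet_derivative \<phi> (at x) e)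
          = - (LINT x|lebesgue_on \<Omega>. (g x \<bullet> e) * \<phi> x)))"

text \<open>A weak gradient is unique only up to null sets; the choice does not affect its norms.\<close>

definition weak_gradient :: "'a::euclidean_space set \<Rightarrow> ('a \<Rightarrow> real) \<Rightarrow> 'a \<Rightarrow> 'a" where
  "weak_gradient \<Omega> u = (SOME g. is_weak_gradient \<Omega> u g)"


section \<open>Lebesgue norms\<close>

text \<open>Norms and seminorms take values in \<open>[0,\<infinity>]\<close>. The power is only used with a positive exponent.\<close>

definition ennreal_powr :: "ennreal \<Rightarrow> real \<Rightarrow> ennreal" where
  "ennreal_powr x a = (if x = \<infinity> then \<infinity> else ennreal (enn2real x powr a))"

definition Lp_norm ::
    "'a::euclidean_space set \<Rightarrow> real \<Rightarrow> ('a \<Rightarrow> 'b::euclidean_space) \<Rightarrow> ennreal" where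
  "Lp_norm \<Omega> p f = ennreal_powr (\<integral>\<^sup>+x. ennreal (norm (f x) powr p) \<partial>lebesgue_on \<Omega>) (1 / p)"

definition Lp_space :: "'a::euclidean_space set \<Rightarrow> real \<Rightarrow> ('a \<Rightarrow> real) set" where
  "Lp_space \<Omega> p = {u \<in> borel_measurable (lebesgue_on \<Omega>). Lp_norm \<Omega> p u < \<infinity>}"

definition Linfinity_norm :: "'a::euclidean_space set \<Rightarrow> ('a \<Rightarrow> real) \<Rightarrow> ennreal" where
  "Linfinity_norm \<Omega> u = esssup (lebesgue_on \<Omega>) (\<lambda>x. ennreal \<bar>u x\<bar>)"

definition Linfinity_space :: "'a::euclidean_space set \<Rightarrow> ('a \<Rightarrow> real) set" where
  "Linfinity_space \<Omega> = {u \<in> borel_measurable (lebesgue_on \<Omega>). Linfinity_norm \<Omega> u < \<infinity>}"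


section \<open>Fractional Sobolev spaces\<close>

definition gagliardo_const :: "real \<Rightarrow> real \<Rightarrow> real \<Rightarrow> real" where
  "gagliardo_const N s p =
     s * 2 powr (2 * s - 1) * Gamma ((p * s + p + N - 2) / 2) / (pi powr (N / 2) * Gamma (1 - s))"

text \<open>On the (null) diagonal \<open>x = y\<close> the integrand below is \<open>0 / 0 = 0\<close>.\<close>

definition gagliardo_seminorm ::
    "'a::euclidean_space set \<Rightarrow> real \<Rightarrow> real \<Rightarrow> ('a \<Rightarrow> real) \<Rightarrow> ennreal" where
  "gagliardo_seminorm \<Omega> s p u =
     ennreal_powr
       (ennreal (gagliardo_const (real DIM('a)) s p) *
         (\<integral>\<^sup>+(x, y). ennreal (\<bar>u x - u y\<bar> powr p / norm (x - y) powr (real DIM('a) + s * p))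
            \<partial>(lebesgue_on \<Omega> \<Otimes>\<^sub>M lebesgue_on \<Omega>)))
       (1 / p)"

text \<open>For \<open>s = 1\<close> the seminorm is infinite if there is no weak gradient.\<close>

definition W_seminorm ::
    "'a::euclidean_space set \<Rightarrow> real \<Rightarrow> real \<Rightarrow> ('a \<Rightarrow> real) \<Rightarrow> ennreal" where
  "W_seminorm \<Omega> s p u =
     (if s = 0 then Lp_norm \<Omega> p u
      else if s = 1 then
        (if \<exists>g. is_weak_gradient \<Omega> u g then Lp_norm \<Omega> p (weak_gradient \<Omega> u) else \<infinity>)
      else gagliardo_seminorm \<Omega> s p u)"

definition W_space :: "'a::euclidean_space set \<Rightarrow> real \<Rightarrow> real \<Rightarrow> ('a \<Rightarrow> real) set" where
  "W_space \<Omega> s p = {u \<in> Lp_space \<Omega> p. W_seminorm \<Omega> s p u < \<infinity>}"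

definition W_norm ::
    "'a::euclidean_space set \<Rightarrow> real \<Rightarrow> real \<Rightarrow> ('a \<Rightarrow> real) \<Rightarrow> ennreal" where
  "W_norm \<Omega> s p u =
     (if s = 0 then Lp_norm \<Omega> p u
      else ennreal_powr
        (ennreal_powr (W_seminorm \<Omega> s p u) p + ennreal_powr (Lp_norm \<Omega> p u) p) (1 / p))"


section \<open>Continuous embeddings\<close>

definition continuously_embedded ::
    "'f set \<Rightarrow> ('f \<Rightarrow> ennreal) \<Rightarrow> 'f set \<Rightarrow> ('f \<Rightarrow> ennreal) \<Rightarrow> bool" where
  "continuously_embedded X normX Y normY \<longleftrightarrow>
     X \<subseteq> Y \<and> (\<exists>C::real. 0 < C \<and> (\<forall>u\<in>X. normY u \<le> ennreal C * normX u))"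

definition W_embedded ::
    "'a::euclidean_space set \<Rightarrow> real \<times> real \<Rightarrow> real \<times> real \<Rightarrow> bool" where
  "W_embedded \<Omega> = (\<lambda>(s, p) (s', p').
     continuously_embedded (W_space \<Omega> s p) (W_norm \<Omega> s p) (W_space \<Omega> s' p') (W_norm \<Omega> s' p'))"

definition exponent_curve :: "real \<Rightarrow> real \<Rightarrow> real \<Rightarrow> real \<Rightarrow> real \<Rightarrow> real \<times> real" where
  "exponent_curve s p s' p' \<theta> =
     (\<theta> * s' + (1 - \<theta>) * s, p * p' / (p' + \<theta> * (p - p')))"

end

theory Submission
  imports Defs
begin

text \<open>The index \<open>s - N / p\<close> does not increase along the curve and starts at \<open>0\<close>, so everything follows
  from the embedding of \<open>W\<^sup>a\<^sup>,\<^sup>q\<close> into \<open>W\<^sup>b\<^sup>,\<^sup>r\<close> for \<open>b < a\<close> and \<open>b - N / r \<le> a - N / q\<close>, where \<open>a = 1\<close> occurs only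
  with \<open>q = N\<close>.

  For \<open>a < 1\<close>, averages of \<open>u\<close> over dyadic balls are telescoped: \<open>\<bar>u x - u y\<bar>\<close> is at most a sum of mean
  oscillations \<open>A\<^sub>j x + A\<^sub>j y\<close> over the scales \<open>t\<^sub>j\<close> below \<open>\<bar>x - y\<bar>\<close>. In \<open>A\<^sub>j\<^sup>r = A\<^sub>j\<^sup>q A\<^sub>j\<^sup>r\<^sup>-\<^sup>q\<close> the second factor is
  bounded pointwise by the Gagliardo energy, and summing the first one over the scales gives the
  energy back. Of the domain this uses only that balls centred in it fill a fixed proportion of it.

  For \<open>a = 1\<close> the averages are taken over balls \<open>B(x + t e, \<kappa> t)\<close> inside a cone of the domain with vertex
  \<open>x\<close>. Testing the weak gradient with the field that transports one averaging kernel to the next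
  bounds the oscillation by \<open>t\<^sup>1\<^sup>-\<^sup>N\<close> times the integral of \<open>\<bar>\<nabla>u\<bar>\<close> over a ball of radius comparable to \<open>t\<close>.
  A level set argument sums these potentials in \<open>L\<^sup>r\<close> and yields \<open>W\<^sup>c\<^sup>,\<^sup>N\<^sup>/\<^sup>c\<close> for \<open>c < 1\<close>, from where the fractional
  embedding continues. In dimension one the potentials are bounded by the \<open>L\<^sup>1\<close> norm of \<open>u'\<close>.\<close>


section \<open>Powers and series in the extended nonnegative reals\<close>

text \<open>The obstacle is the limiting case of equal indices. There each dyadic scale may
  contribute equally, so a bound for every single scale does not sum; part of the power of an
  oscillation has to stay under the sum.

  Nothing is extended across the boundary and no density of smooth functions is used, only averages
  taken inside the domain. For a = 1 a ball around a boundary-near point cannot serve, since the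
  path between two kernels must not leave the domain; hence the detour through cones. The averages
  are then off-centre, and they converge to u only almost everywhere and along a subsequence, which
  telescoping tolerates.

  The condition that s and p differ excludes exactly s = p = N = 1, because s \<le> 1 \<le> p. The
  exclusion is essential: in the level set argument the sum over the large scales is geometric with
  ratio \<open>2 powr - (N - 1)\<close>, which degenerates for N = 1. Correspondingly, smoothed
  steps are bounded in \<open>W\<^sup>1\<^sup>,\<^sup>1\<close> of an interval, while their energies
  of order c and exponent 1 / c blow up.\<close>

notation ennreal_powr (infixr "\<up>" 80)

lemma epowr_ennreal: "0 \<le> x \<Longrightarrow> ennreal x \<up> a = ennreal (x powr a)"
  by (simp add: ennreal_powr_def)

lemma epowr_0 [simp]: "0 \<up> a = 0"
  by (simp add: ennreal_powr_def)

lemma epowr_top [simp]: "top \<up> a = top"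
  by (simp add: ennreal_powr_def)

lemma epowr_one [simp]: "x \<up> 1 = x"
  by (cases x) (auto simp: epowr_ennreal)

lemma epowr_eq_top_iff [simp]: "x \<up> a = top \<longleftrightarrow> x = top"
  by (cases x) (auto simp: epowr_ennreal)

lemma epowr_less_top_iff [simp]: "x \<up> a < top \<longleftrightarrow> x < top"
  by (simp add: less_top[symmetric])

lemma epowr_eq_0_iff [simp]: "x \<up> a = 0 \<longleftrightarrow> x = 0"
  by (cases x) (auto simp: epowr_ennreal)

lemma epowr_mono: "x \<le> y \<Longrightarrow> 0 \<le> a \<Longrightarrow> x \<up> a \<le> y \<up> a"
  by (cases x; cases y) (auto simp: epowr_ennreal top_unique intro!: ennreal_leI powr_mono2)

text \<open>There are no side conditions because 0 and \<open>top\<close> are fixed by every power,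
  including the power 0 and negative ones; so the convention \<open>0 * top = 0\<close> is respected
  on both sides.\<close>

lemma epowr_mult: "(x * y) \<up> a = x \<up> a * y \<up> a"
proof (cases "x = top \<or> y = top")
  case True
  then show ?thesis
    by (cases "x = 0"; cases "y = 0") (auto simp: ennreal_mult_top ennreal_top_mult)
next
  case False
  then obtain c d where "x = ennreal c" "y = ennreal d" "0 \<le> c" "0 \<le> d"
    by (metis ennreal_cases)
  then show ?thesis
    by (simp add: epowr_ennreal powr_mult flip: ennreal_mult)
qed

lemma epowr_add: "x \<up> (a + b) = x \<up> a * x \<up> b"
  by (cases x) (auto simp: epowr_ennreal powr_add ennreal_mult)

lemma epowr_epowr: "(x \<up> a) \<up> b = x \<up> (a * b)"
  by (cases x) (auto simp: epowr_ennreal powr_powr)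

lemma epowr_inverse_cancel [simp]: "a \<noteq> 0 \<Longrightarrow> (x \<up> (1 / a)) \<up> a = x"
  by (simp add: epowr_epowr)

lemma epowr_cancel_inverse [simp]: "a \<noteq> 0 \<Longrightarrow> (x \<up> a) \<up> (1 / a) = x"
  by (simp add: epowr_epowr)

lemma epowr_le_iff: "0 < a \<Longrightarrow> x \<up> a \<le> y \<longleftrightarrow> x \<le> y \<up> (1 / a)"
  using epowr_mono[of "x \<up> a" y "1/a"] epowr_mono[of x "y \<up> (1/a)" a] by auto

lemma epowr_add_le:
  assumes "0 \<le> a"
  shows "(x + y) \<up> a \<le> ennreal (2 powr a) * (x \<up> a + y \<up> a)"
proof -
  have "x + y \<le> 2 * max x y"
    by (metis add_mono max.cobounded1 max.cobounded2 mult_2)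
  then have "(x + y) \<up> a \<le> (ennreal 2 * max x y) \<up> a"
    using assms by (intro epowr_mono) auto
  also have "\<dots> = ennreal (2 powr a) * (max x y) \<up> a"
    by (simp add: epowr_mult epowr_ennreal del: ennreal_numeral)
  also have "(max x y) \<up> a \<le> x \<up> a + y \<up> a"
    by (auto simp: max_def)
  finally show ?thesis by (simp add: mult_left_mono)
qed

lemma measurable_epowr [measurable]:
  assumes [measurable]: "f \<in> borel_measurable M"
  shows "(\<lambda>x. f x \<up> a) \<in> borel_measurable M"
  unfolding ennreal_powr_def by measurable

lemma ennreal_sum_geometric:
  assumes "0 < \<alpha>"
  shows "(\<Sum>j. ennreal (2 powr - (\<alpha> * real j))) = ennreal (1 / (1 - 2 powr - \<alpha>))"
proof -
  have "2 powr - \<alpha> < (1::real)"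
    using assms by (simp add: powr_less_one)
  then have "(\<lambda>j. (2 powr - \<alpha>) ^ j) sums (1 / (1 - 2 powr - \<alpha>))"
    by (intro geometric_sums) simp
  moreover have "(2 powr - \<alpha>) ^ j = 2 powr - (\<alpha> * real j)" for j
    by (simp add: powr_powr flip: powr_realpow)
  ultimately show ?thesis
    by (intro suminf_ennreal_eq) auto
qed

text \<open>This replaces a weighted Hoelder inequality: each term is at most \<open>2\<^sup>-\<^sup>\<alpha>\<^sup>j\<close> times
  the \<open>r\<close>-th root of the sum on the right.\<close>

lemma suminf_epowr_le:
  fixes f :: "nat \<Rightarrow> ennreal"
  assumes "0 < \<alpha>" "0 < r"
  shows "(\<Sum>j. f j) \<up> r \<le> ennreal ((1 / (1 - 2 powr - \<alpha>)) powr r) *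
    (\<Sum>j. ennreal (2 powr (\<alpha> * r * real j)) * f j \<up> r)"
proof -
  define Q where "Q = (\<Sum>j. ennreal (2 powr (\<alpha> * r * real j)) * f j \<up> r)"
  have w: "0 < 1 / (1 - 2 powr - \<alpha>)"
    using assms by (simp add: powr_less_one)
  have le: "f j \<le> ennreal (2 powr - (\<alpha> * real j)) * Q \<up> (1 / r)" for j
  proof -
    have "ennreal (2 powr (\<alpha> * r * real j)) * f j \<up> r \<le> Q"
      unfolding Q_def using sum_le_suminf[of "\<lambda>j. ennreal (2 powr (\<alpha> * r * real j)) * f j \<up> r" "{j}"] by simp
    moreover have "ennreal (2 powr (\<alpha> * r * real j)) * f j \<up> r = (ennreal (2 powr (\<alpha> * real j)) * f j) \<up> r"
      by (simp add: epowr_mult epowr_ennreal powr_powr mult_ac)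
    ultimately have "ennreal (2 powr (\<alpha> * real j)) * f j \<le> Q \<up> (1 / r)"
      using assms by (simp add: epowr_le_iff)
    then have "ennreal (2 powr - (\<alpha> * real j)) * (ennreal (2 powr (\<alpha> * real j)) * f j) \<le> ennreal (2 powr - (\<alpha> * real j)) * Q \<up> (1 / r)"
      by (rule mult_left_mono) simp
    then show ?thesis
      by (simp add: mult.assoc[symmetric] flip: ennreal_mult powr_add)
  qed
  have "(\<Sum>j. f j) \<le> (\<Sum>j. ennreal (2 powr - (\<alpha> * real j)) * Q \<up> (1 / r))"
    by (intro suminf_le le) auto
  also have "\<dots> = ennreal (1 / (1 - 2 powr - \<alpha>)) * Q \<up> (1 / r)"
    by (simp only: ennreal_suminf_multc ennreal_sum_geometric[OF \<open>0 < \<alpha>\<close>])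
  finally have "(\<Sum>j. f j) \<up> r \<le> (ennreal (1 / (1 - 2 powr - \<alpha>)) * Q \<up> (1 / r)) \<up> r"
    using assms by (intro epowr_mono) auto
  also have "\<dots> = ennreal ((1 / (1 - 2 powr - \<alpha>)) powr r) * Q"
    using assms w by (simp add: epowr_mult epowr_ennreal)
  finally show ?thesis unfolding Q_def .
qed

text \<open>Jensen's inequality up to the factor \<open>2 powr q\<close>. For every l > 0 one has
  \<open>f \<le> l + l powr (1 - q) * f powr q\<close> pointwise, since the second summand dominates
  where f exceeds l. Integrating this and choosing l such that both contributions agree gives the
  bound.\<close>

lemma nn_integral_epowr_le:
  assumes [measurable]: "f \<in> borel_measurable N" and m: "emeasure N (space N) \<le> ennreal m"
    and q: "1 \<le> q" and "0 \<le> m"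
  shows "(\<integral>\<^sup>+x. f x \<partial>N) \<up> q \<le> ennreal (2 powr q * m powr (q - 1)) * (\<integral>\<^sup>+x. f x \<up> q \<partial>N)"
proof -
  define P where "P = (\<integral>\<^sup>+x. f x \<up> q \<partial>N)"
  \<comment> \<open>The threshold \<open>l\<close> chosen below is positive and finite only if both
    \<open>m\<close> and \<open>P\<close> are.\<close>
  consider "m = 0 \<or> P = 0" | "m > 0" "P = top" | p where "m > 0" "P = ennreal p" "p > 0"
    using \<open>0 \<le> m\<close> by (cases P) (auto simp: order_le_less)
  then show ?thesis
  proof cases
    case 1
    have "AE x in N. f x = 0"
    proof (cases "m = 0")
      case True
      then have "space N \<in> null_sets N"
        using m by (auto simp: null_sets_def)
      then show ?thesis
        by (rule AE_I') auto
    next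
      case False
      then have "AE x in N. f x \<up> q = 0"
        using 1 unfolding P_def by (subst (asm) nn_integral_0_iff_AE) auto
      then show ?thesis by simp
    qed
    then have "(\<integral>\<^sup>+x. f x \<partial>N) = 0"
      by (subst nn_integral_0_iff_AE) auto
    then show ?thesis by simp
  next
    case 2
    then show ?thesis
      by (simp add: P_def[symmetric] ennreal_mult_top)
  next
    case 3
    define l where "l = (p / m) powr (1 / q)"
    have l: "l > 0" "l powr q = p / m"
      using 3 q by (auto simp: l_def powr_powr)
    have pt: "f x \<le> ennreal l + ennreal (l powr (1 - q)) * f x \<up> q" for x
    proof (cases "f x")
      case (real y)
      have "y \<le> l + l powr (1 - q) * y powr q"
      proof (cases "y \<le> l")
        case False
        then have "1 \<le> (y / l) powr (q - 1)"
          using l q by (intro ge_one_powr_ge_zero) auto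
        then have "y * 1 \<le> y * (y / l) powr (q - 1)"
          using False l by (intro mult_left_mono) auto
        also have "\<dots> = l powr (1 - q) * y powr q"
          using False l by (simp add: powr_divide powr_diff field_simps)
        finally show ?thesis using l by simp
      qed (use l in \<open>auto intro: add_increasing2\<close>)
      then show ?thesis
        using real l by (simp add: epowr_ennreal flip: ennreal_mult ennreal_plus)
    next
      case top
      then show ?thesis using l by (simp add: ennreal_mult_top)
    qed
    have "(\<integral>\<^sup>+x. f x \<partial>N) \<le> (\<integral>\<^sup>+x. ennreal l + ennreal (l powr (1 - q)) * f x \<up> q \<partial>N)"
      by (intro nn_integral_mono pt)
    also have "\<dots> = ennreal l * emeasure N (space N) + ennreal (l powr (1 - q)) * P"
      by (simp add: nn_integral_add nn_integral_cmult P_def)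
    also have "\<dots> \<le> ennreal l * ennreal m + ennreal (l powr (1 - q)) * ennreal p"
      using m 3 by (auto intro: add_mono mult_left_mono)
    also have "\<dots> = ennreal (l * m + l powr (1 - q) * p)"
      using l 3 by (simp flip: ennreal_mult ennreal_plus)
    also have "l * m + l powr (1 - q) * p = 2 * l * m"
    proof -
      have "p = l powr q * m" unfolding l(2) using \<open>m > 0\<close> by simp
      then have "l powr (1 - q) * p = l * m"
        using l(1) by (metis add.commute diff_add_cancel less_imp_le mult.assoc powr_add powr_one)
      then show ?thesis by simp
    qed
    finally have "(\<integral>\<^sup>+x. f x \<partial>N) \<up> q \<le> ennreal (2 * l * m) \<up> q"
      using q by (intro epowr_mono) auto
    also have "\<dots> = ennreal (2 powr q * m powr (q - 1) * p)"
      using l(1) \<open>m > 0\<close> by (simp add: epowr_ennreal powr_mult l(2)) (simp add: powr_diff mult_ac)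
    also have "\<dots> = ennreal (2 powr q * m powr (q - 1)) * P"
      using 3 by (simp add: ennreal_mult)
    finally show ?thesis unfolding P_def .
  qed
qed

lemma nn_integral_set_epowr_le:
  assumes [measurable]: "f \<in> borel_measurable N" "S \<in> sets N" and m: "emeasure N S \<le> ennreal m"
    and q: "1 \<le> q" and "0 \<le> m"
  shows "(\<integral>\<^sup>+x. f x * indicator S x \<partial>N) \<up> q \<le>
    ennreal (2 powr q * m powr (q - 1)) * (\<integral>\<^sup>+x. f x \<up> q * indicator S x \<partial>N)"
proof -
  have "emeasure (density N (indicator S)) (space N) \<le> ennreal m"
    using m sets.sets_into_space[OF assms(2)]
    by (simp add: emeasure_density Int_absorb2 flip: indicator_inter_arith)
  then show ?thesis
    using nn_integral_epowr_le[of f "density N (indicator S)" m q] assms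
    by (simp add: nn_integral_density mult.commute)
qed

text \<open>Convergence is assumed along a subsequence only, because that is what is known of
  averages inside a cone. The series bounds every difference \<open>v (k + m) - v k\<close>, and the
  limit is taken in these bounds.\<close>

lemma suminf_tendsto_dist_le:
  fixes v :: "nat \<Rightarrow> real"
  assumes r: "strict_mono r" and lim: "(\<lambda>i. v (r i)) \<longlonglongrightarrow> l"
  shows "ennreal \<bar>l - v k\<bar> \<le> (\<Sum>j. ennreal \<bar>v (k + j) - v (Suc (k + j))\<bar>)"
proof -
  have fin: "ennreal \<bar>v (k + m) - v k\<bar> \<le> (\<Sum>j. ennreal \<bar>v (k + j) - v (Suc (k + j))\<bar>)" for m
  proof -
    have "\<bar>v (k + m) - v k\<bar> \<le> (\<Sum>j<m. \<bar>v (k + j) - v (Suc (k + j))\<bar>)"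
      by (induction m) auto
    then have "ennreal \<bar>v (k + m) - v k\<bar> \<le> ennreal (\<Sum>j<m. \<bar>v (k + j) - v (Suc (k + j))\<bar>)"
      by (rule ennreal_leI)
    also have "\<dots> = (\<Sum>j<m. ennreal \<bar>v (k + j) - v (Suc (k + j))\<bar>)"
      by simp
    also have "\<dots> \<le> (\<Sum>j. ennreal \<bar>v (k + j) - v (Suc (k + j))\<bar>)"
      by (intro sum_le_suminf) auto
    finally show ?thesis .
  qed
  have lim': "(\<lambda>i. ennreal \<bar>v (r i) - v k\<bar>) \<longlonglongrightarrow> ennreal \<bar>l - v k\<bar>"
    by (intro tendsto_intros lim)
  have "ennreal \<bar>v (r i) - v k\<bar> \<le> (\<Sum>j. ennreal \<bar>v (k + j) - v (Suc (k + j))\<bar>)" if "k \<le> i" for i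
    using fin[of "r i - k"] seq_suble[OF r, of i] that by simp
  then show ?thesis
    by (intro LIMSEQ_le_const2[OF lim']) auto
qed

lemma suminf_swap_ennreal:
  fixes f :: "nat \<Rightarrow> nat \<Rightarrow> ennreal"
  shows "(\<Sum>i. \<Sum>j. f i j) = (\<Sum>j. \<Sum>i. f i j)"
  using nn_integral_suminf[of "\<lambda>i j. f i j" "count_space UNIV"]
  by (simp add: nn_integral_count_space_nat)

lemma term_le_suminf_ennreal: "f k \<le> (\<Sum>k. f k :: ennreal)"
  using sum_le_suminf[of f "{k}"] by simp

lemma suminf_shift_le_ennreal:
  fixes f :: "nat \<Rightarrow> ennreal"
  shows "(\<Sum>i. f (i + k)) \<le> (\<Sum>i. f i)"
proof -
  have "(\<Sum>i. f i) = (\<Sum>i. f (i + k)) + (\<Sum>i<k. f i)"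
    by (rule suminf_offset) auto
  then show ?thesis by simp
qed

section \<open>Geometric sums over the dyadic scales above or below a threshold\<close>

lemma halve_powr: "0 < d \<Longrightarrow> (d / 2 ^ (k + j)) powr a = (d / 2 ^ k) powr a * 2 powr - (a * real j)"
  by (simp add: powr_divide power_add powr_mult powr_minus powr_powr field_simps flip: powr_realpow)

text \<open>The terms grow as the scale decreases to d, so the last one dominates. In the induction
  the bound \<open>(K - 1) * t m powr - \<beta>\<close> reproduces itself: adding one term makes it
  \<open>K * t m powr - \<beta>\<close>, and \<open>K = 2 powr \<beta> * (K - 1)\<close> is the
  effect of halving the scale.\<close>

lemma sum_dyadic_ge:
  fixes D d \<beta> :: real
  assumes "0 < D" "0 < d" "0 < \<beta>"
  shows "(\<Sum>j. ennreal (if d < D / 2 ^ j then (D / 2 ^ j) powr - \<beta> else 0)) \<le> ennreal (1 / (1 - 2 powr - \<beta>) * d powr - \<beta>)"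
proof -
  define t where "t j = D / 2 ^ j" for j :: nat
  define K where "K = 1 / (1 - 2 powr - \<beta>)"
  have t: "t j > 0" for j using assms by (simp add: t_def)
  have tS: "t (Suc j) powr - \<beta> = t j powr - \<beta> * 2 powr \<beta>" for j
    using halve_powr[of D j 1 "-\<beta>"] assms by (simp add: t_def)
  have b: "1 < 2 powr \<beta>" "2 powr - \<beta> < 1"
    using assms by (auto simp: powr_less_one)
  have K1: "K * (1 - 2 powr - \<beta>) = 1"
    using b assms by (simp add: K_def)
  moreover have "2 powr \<beta> * 2 powr - \<beta> = 1"
    by (simp flip: powr_add)
  ultimately have K: "K = 2 powr \<beta> * (K - 1)"
    by algebra
  have "K > 1"
    using b by (simp add: K_def)
  note K = K this
  have 1: "(\<Sum>j<m. t j powr - \<beta>) \<le> (K - 1) * t m powr - \<beta>" for m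
  proof (induction m)
    case 0 show ?case using K by simp
  next
    case (Suc m)
    then have "(\<Sum>j<Suc m. t j powr - \<beta>) \<le> K * t m powr - \<beta>"
      by (simp add: algebra_simps)
    also have "\<dots> = (2 powr \<beta> * (K - 1)) * t m powr - \<beta>"
      using K by metis
    also have "\<dots> = (K - 1) * t (Suc m) powr - \<beta>"
      by (simp add: tS)
    finally show ?case .
  qed
  have 2: "(\<Sum>j<m. if d < t j then t j powr - \<beta> else 0) \<le> K * d powr - \<beta>" for m
  proof (induction m)
    case 0 show ?case using K by simp
  next
    case (Suc m)
    show ?case
    proof (cases "d < t m")
      case True
      have "(\<Sum>j<m. if d < t j then t j powr - \<beta> else 0) \<le> (\<Sum>j<m. t j powr - \<beta>)"
        by (intro sum_mono) auto
      then have "(\<Sum>j<Suc m. if d < t j then t j powr - \<beta> else 0) \<le> K * t m powr - \<beta>"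
        using 1[of m] True by (simp add: algebra_simps)
      also have "\<dots> \<le> K * d powr - \<beta>"
        using True K assms t by (intro mult_left_mono powr_mono2') auto
      finally show ?thesis .
    qed (use Suc in simp)
  qed
  have "(\<Sum>j<m. ennreal (if d < t j then t j powr - \<beta> else 0)) \<le> ennreal (K * d powr - \<beta>)" for m
    using 2[of m] by (subst sum_ennreal) (auto intro: ennreal_leI)
  then show ?thesis
    unfolding t_def K_def by (intro suminf_le_const) auto
qed

text \<open>Here the largest scale not above d dominates. The invariant carries the rest of the
  series along: \<open>K * t m powr \<beta>\<close> is exactly the geometric sum of all terms from m
  on.\<close>

lemma sum_dyadic_le:
  fixes D d \<beta> :: real
  assumes "0 < D" "0 < d" "0 < \<beta>"
  shows "(\<Sum>j. ennreal (if D / 2 ^ j \<le> d then (D / 2 ^ j) powr \<beta> else 0)) \<le> ennreal (1 / (1 - 2 powr - \<beta>) * d powr \<beta>)"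
proof -
  define t where "t j = D / 2 ^ j" for j :: nat
  define K where "K = 1 / (1 - 2 powr - \<beta>)"
  define S where "S m = (\<Sum>j<m. if t j \<le> d then t j powr \<beta> else 0)" for m
  have t: "t j > 0" for j using assms by (simp add: t_def)
  have tS: "t (Suc j) powr \<beta> = t j powr \<beta> * 2 powr - \<beta>" for j
    using halve_powr[of D j 1 "\<beta>"] assms by (simp add: t_def)
  have tSS: "t (Suc j) \<le> t j" for j
    using assms by (simp add: t_def field_simps)
  have b: "2 powr - \<beta> < 1"
    using assms by (auto simp: powr_less_one)
  have "K * (1 - 2 powr - \<beta>) = 1"  "K > 1"
    using b by (auto simp: K_def)
  then have K: "1 + K * 2 powr - \<beta> = K"  "K > 1"
    by (auto simp: algebra_simps)
  have "(t m \<le> d \<longrightarrow> S m + K * t m powr \<beta> \<le> K * d powr \<beta>) \<and> (d < t m \<longrightarrow> S m = 0)" for m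
  proof (induction m)
    case 0
    show ?case using K assms t[of 0] by (auto simp: S_def intro!: mult_left_mono powr_mono2)
  next
    case (Suc m)
    show ?case
    proof (cases "t m \<le> d")
      case True
      have "S (Suc m) + K * t (Suc m) powr \<beta> = S m + (1 + K * 2 powr - \<beta>) * t m powr \<beta>"
        using True by (simp add: S_def tS algebra_simps)
      then show ?thesis
        using True Suc tSS[of m] by (simp add: K)
    next
      case False
      then have "S (Suc m) = 0" using Suc by (simp add: S_def)
      moreover have "t (Suc m) \<le> d \<Longrightarrow> K * t (Suc m) powr \<beta> \<le> K * d powr \<beta>"
        using K assms t[of "Suc m"] by (auto intro!: mult_left_mono powr_mono2)
      ultimately show ?thesis by simp
    qed
  qed
  moreover have "0 \<le> K * t m powr \<beta>" "0 \<le> K * d powr \<beta>" for m using K by auto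
  ultimately have 2: "S m \<le> K * d powr \<beta>" for m
    by (metis add_le_cancel_left add.right_neutral le_less_linear order_trans)
  have "(\<Sum>j<m. ennreal (if t j \<le> d then t j powr \<beta> else 0)) \<le> ennreal (K * d powr \<beta>)" for m
    using 2[of m] by (subst sum_ennreal) (auto intro: ennreal_leI simp: S_def)
  then show ?thesis
    unfolding t_def K_def by (intro suminf_le_const) auto
qed

section \<open>Dyadic telescoping on regular measures\<close>

text \<open>The sigma-algebra is meant to be the one of Lebesgue measurable sets, which is finer
  than the Borel one; \<open>borel_id\<close> is what makes distances measurable on the space and on
  products. \<open>D\<close> bounds all distances, so that the scale of index 0 covers every pair of
  points.\<close>

locale regular_measure = finite_measure M for M :: "'a::euclidean_space measure" +
  fixes n D c0 c1 :: real
  assumes borel_id: "(\<lambda>x. x) \<in> borel_measurable M"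
    and n_pos: "0 < n" and D_pos: "0 < D" and c0_pos: "0 < c0" and c1_pos: "0 < c1"
    and dist_le_D: "x \<in> space M \<Longrightarrow> y \<in> space M \<Longrightarrow> dist x y \<le> D"
    and ball_lower: "x \<in> space M \<Longrightarrow> 0 < t \<Longrightarrow> t \<le> D \<Longrightarrow>
      c0 * t powr n \<le> measure M {y \<in> space M. dist x y < t}"
    and ball_upper: "0 < t \<Longrightarrow> measure M {y \<in> space M. dist x y < t} \<le> c1 * t powr n"
begin

definition scale :: "nat \<Rightarrow> real" where
  "scale j = D / 2 ^ j"

definition energy :: "real \<Rightarrow> real \<Rightarrow> ('a \<Rightarrow> real) \<Rightarrow> ennreal" where
  "energy s p u = (\<integral>\<^sup>+(x, y). ennreal (\<bar>u x - u y\<bar> powr p / norm (x - y) powr (n + s * p)) \<partial>(M \<Otimes>\<^sub>M M))"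

text \<open>One exceptional null set serves all scales, and the series may start at any scale not
  below the distance of the points; the energy estimate picks the comparable one.\<close>

definition telescopes :: "('a \<Rightarrow> real) \<Rightarrow> (nat \<Rightarrow> 'a \<Rightarrow> ennreal) \<Rightarrow> bool" where
  "telescopes u A \<longleftrightarrow> (\<exists>P. (AE x in M. P x) \<and>
    (\<forall>k. \<forall>x\<in>space M. \<forall>y\<in>space M. P x \<longrightarrow> P y \<longrightarrow> dist x y \<le> scale k \<longrightarrow>
      ennreal \<bar>u x - u y\<bar> \<le> (\<Sum>j. A (k + j) x) + (\<Sum>j. A (k + j) y)))"

sublocale MM: pair_sigma_finite M M ..

lemma scale_pos [simp]: "0 < scale j"
  using D_pos by (simp add: scale_def)

lemma scale_nonneg [simp]: "0 \<le> scale j"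
  using scale_pos[of j] by linarith

lemma scale_neq_0 [simp]: "scale j \<noteq> 0"
  using scale_pos[of j] by linarith

lemma scale_le_D: "scale j \<le> D"
  using D_pos by (simp add: scale_def field_simps)

lemma scale_Suc: "scale j = 2 * scale (Suc j)"
  by (simp add: scale_def)

lemma scale_add_powr: "scale (k + j) powr a = scale k powr a * 2 powr - (a * real j)"
  unfolding scale_def by (rule halve_powr[OF D_pos])

lemma borel_fst [measurable]: "f \<in> M' \<rightarrow>\<^sub>M M \<Longrightarrow> f \<in> borel_measurable M'"
  using measurable_compose[of f M' M "\<lambda>x. x", OF _ borel_id] by simp

lemma borel_dist_right [measurable]: "(\<lambda>y. dist x y) \<in> borel_measurable M"
  using borel_id by measurable

lemma ball_upper_le:
  assumes "0 < t"
  shows "(\<integral>\<^sup>+y. indicator {y \<in> space M. dist x y \<le> t} y \<partial>M) \<le> ennreal (c1 * 2 powr n * t powr n)"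
proof -
  have "(\<integral>\<^sup>+y. indicator {y \<in> space M. dist x y \<le> t} y \<partial>M) = emeasure M {y \<in> space M. dist x y \<le> t}"
    by (subst nn_integral_indicator) (use borel_id in measurable)
  also have "\<dots> \<le> emeasure M {y \<in> space M. dist x y < 2 * t}"
    using assms by (intro emeasure_mono) (use borel_id in \<open>auto, measurable\<close>)
  also have "\<dots> \<le> ennreal (c1 * (2 * t) powr n)"
    using ball_upper[of "2 * t" x] assms by (simp add: emeasure_eq_measure ennreal_leI)
  finally show ?thesis
    using assms by (simp add: powr_mult mult.assoc)
qed

lemma exists_scale:
  assumes "0 < d" "d \<le> D"
  obtains k where "d \<le> scale k" "scale k < 2 * d"
proof -
  have "(\<lambda>j. D / 2 ^ j) \<longlonglongrightarrow> 0"
    by real_asymp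
  then have ex: "\<exists>k. scale k < 2 * d"
    unfolding scale_def using assms
    by (metis (mono_tags, lifting) eventually_sequentially order_tendstoD(2) mult_pos_pos zero_less_numeral order_refl)
  define k where "k = (LEAST k. scale k < 2 * d)"
  have k: "scale k < 2 * d" unfolding k_def using ex by (rule LeastI_ex)
  have "d \<le> scale k"
  proof (cases k)
    case 0
    then show ?thesis using assms by (simp add: scale_def)
  next
    case (Suc m)
    then have "\<not> scale m < 2 * d"
      unfolding k_def by (metis not_less_Least lessI)
    then show ?thesis using scale_Suc[of m] Suc by simp
  qed
  with k show ?thesis using that by blast
qed

text \<open>The tail of the series at scale \<open>k\<close> is compared with the distance by a discrete Hardy inequality.\<close>

lemma energy_le_of_telescope:
  assumes b: "0 < b" and r: "0 < r"
  shows "\<exists>C\<ge>0. \<forall>u A. u \<in> borel_measurable M \<longrightarrow> (\<forall>j. A j \<in> borel_measurable M) \<longrightarrow> telescopes u A \<longrightarrow>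
    energy b r u \<le> ennreal C * (\<Sum>j. ennreal (scale j powr - (b * r)) * (\<integral>\<^sup>+x. A j x \<up> r \<partial>M))"
proof -
  define W where "W = (1 / (1 - 2 powr - (b / 2))) powr r"
  define C where "C = 2 powr r * W * 2 powr (n + b * r)"
  define C' where "C' = C * (2 * (c1 * 2 powr n * (1 / (1 - 2 powr - (b * r / 2)))))"
  have W: "W \<ge> 0" by (simp add: W_def)
  have C: "C \<ge> 0" using W by (simp add: C_def)
  have main: "energy b r u \<le> ennreal C' * (\<Sum>j. ennreal (scale j powr - (b * r)) * (\<integral>\<^sup>+x. A j x \<up> r \<partial>M))"
    if [measurable]: "u \<in> borel_measurable M" "\<And>j. A j \<in> borel_measurable M" and P: "AE x in M. P x"
      and tel: "\<And>k x y. x \<in> space M \<Longrightarrow> y \<in> space M \<Longrightarrow> P x \<Longrightarrow> P y \<Longrightarrow> dist x y \<le> scale k \<Longrightarrow>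
        ennreal \<bar>u x - u y\<bar> \<le> (\<Sum>j. A (k + j) x) + (\<Sum>j. A (k + j) y)"
    for u and A :: "nat \<Rightarrow> 'a \<Rightarrow> ennreal" and P
  proof -
    \<comment> \<open>Half of the decay exponent \<open>b * r\<close> is spent on this weight, which
      comes from \<open>suminf_epowr_le\<close> with exponent \<open>b / 2\<close>; the other half
      makes the sum over the relative depth j converge at the end.\<close>
    define Q where "Q k x = (\<Sum>j. ennreal (2 powr (b * r / 2 * real j)) * A (k + j) x \<up> r)" for k x
    define I where "I k x y = ennreal (scale k powr - (n + b * r)) * indicator {y \<in> space M. dist x y \<le> scale k} y" for k x y
    have Q [measurable]: "Q k \<in> borel_measurable M" for k
      unfolding Q_def by measurable
    have I [measurable]: "(\<lambda>p. I k (fst p) (snd p)) \<in> borel_measurable (M \<Otimes>\<^sub>M M)" for k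
      unfolding I_def by measurable
    have I' [measurable]: "I k x \<in> borel_measurable M" for k x
      unfolding I_def by measurable
    have symI: "x \<in> space M \<Longrightarrow> y \<in> space M \<Longrightarrow> I k x y = I k y x" for k x y
      by (auto simp: I_def indicator_def dist_commute)
    have pt: "ennreal (\<bar>u x - u y\<bar> powr r / norm (x - y) powr (n + b * r)) \<le>
        ennreal C * (\<Sum>k. I k x y * (Q k x + Q k y))"
      if xy: "x \<in> space M" "y \<in> space M" "P x" "P y" for x y
    proof (cases "x = y")
      case False
      define d where "d = dist x y"
      have d: "0 < d" "d \<le> D"
        using False dist_le_D xy by (auto simp: d_def)
      obtain k where k: "d \<le> scale k" "scale k < 2 * d"
        using exists_scale d by blast
      have "ennreal (\<bar>u x - u y\<bar> powr r) = ennreal \<bar>u x - u y\<bar> \<up> r"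
        by (simp add: epowr_ennreal)
      also have "\<dots> \<le> ((\<Sum>j. A (k + j) x) + (\<Sum>j. A (k + j) y)) \<up> r"
        using tel[of x y k] xy k r by (intro epowr_mono) (auto simp: d_def)
      also have "\<dots> \<le> ennreal (2 powr r) * ((\<Sum>j. A (k + j) x) \<up> r + (\<Sum>j. A (k + j) y) \<up> r)"
        using r by (intro epowr_add_le) simp
      also have "\<dots> \<le> ennreal (2 powr r) * (ennreal W * Q k x + ennreal W * Q k y)"
        using suminf_epowr_le[of "b / 2" r] b r unfolding W_def Q_def
        by (intro mult_left_mono add_mono) auto
      finally have 1: "ennreal (\<bar>u x - u y\<bar> powr r) \<le> ennreal (2 powr r * W) * (Q k x + Q k y)"
        using W by (simp add: ennreal_mult distrib_left mult.assoc)
      have "1 / d powr (n + b * r) \<le> 2 powr (n + b * r) * scale k powr - (n + b * r)"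
      proof -
        have "(scale k / 2) powr (n + b * r) \<le> d powr (n + b * r)"
          using k b r n_pos by (intro powr_mono2) auto
        then have "1 / d powr (n + b * r) \<le> 1 / (scale k / 2) powr (n + b * r)"
          by (intro divide_left_mono mult_pos_pos) (use d scale_pos[of k] in auto)
        also have "\<dots> = 2 powr (n + b * r) * scale k powr - (n + b * r)"
          by (simp add: powr_divide powr_minus field_simps del: minus_add_distrib)
        finally show ?thesis .
      qed
      then have 2: "ennreal (1 / d powr (n + b * r)) \<le> ennreal (2 powr (n + b * r)) * I k x y"
        using xy k by (simp add: I_def d_def flip: ennreal_mult)
      have "ennreal (\<bar>u x - u y\<bar> powr r / norm (x - y) powr (n + b * r)) =
          ennreal (\<bar>u x - u y\<bar> powr r) * ennreal (1 / d powr (n + b * r))"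
        by (simp add: d_def dist_norm flip: ennreal_mult)
      also have "\<dots> \<le> (ennreal (2 powr r * W) * (Q k x + Q k y)) * (ennreal (2 powr (n + b * r)) * I k x y)"
        using 1 2 by (intro mult_mono) auto
      also have "\<dots> = ennreal C * (I k x y * (Q k x + Q k y))"
        using W by (simp add: C_def ennreal_mult mult_ac)
      also have "I k x y * (Q k x + Q k y) \<le> (\<Sum>k. I k x y * (Q k x + Q k y))"
        using sum_le_suminf[of "\<lambda>k. I k x y * (Q k x + Q k y)" "{k}"] by simp
      finally show ?thesis by (simp add: mult_left_mono)
    qed simp
    define R where "R = (\<integral>\<^sup>+x. \<integral>\<^sup>+y. (\<Sum>k. I k x y * Q k x) \<partial>M \<partial>M)"
    \<comment> \<open>Nothing is known about the measurability of \<open>P\<close>, so a measurable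
      null set \<open>Z\<close> around its exceptional points is removed from both
      coordinates.\<close>
    have AEP: "AE p in M \<Otimes>\<^sub>M M. P (fst p) \<and> P (snd p)"
    proof -
      obtain Z where Z: "Z \<in> null_sets M" "{x \<in> space M. \<not> P x} \<subseteq> Z"
        using P by (auto elim!: AE_E simp: null_sets_def)
      have "AE p in M \<Otimes>\<^sub>M M. fst p \<notin> Z \<and> snd p \<notin> Z"
      proof (rule MM.AE_pair_measure)
        have [measurable]: "Z \<in> sets M" using Z(1) by auto
        show "{p \<in> space (M \<Otimes>\<^sub>M M). fst p \<notin> Z \<and> snd p \<notin> Z} \<in> sets (M \<Otimes>\<^sub>M M)"
          by measurable
        show "AE x in M. AE y in M. fst (x, y) \<notin> Z \<and> snd (x, y) \<notin> Z"
          using AE_not_in[OF Z(1)] by auto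
      qed
      then show ?thesis
        by (rule AE_mp) (use Z(2) in \<open>auto simp: space_pair_measure intro!: AE_I2\<close>)
    qed
    have "energy b r u \<le> (\<integral>\<^sup>+p. ennreal C * ((\<Sum>k. I k (fst p) (snd p) * Q k (fst p)) +
        (\<Sum>k. I k (fst p) (snd p) * Q k (snd p))) \<partial>(M \<Otimes>\<^sub>M M))"
      unfolding energy_def
    proof (rule nn_integral_mono_AE, rule AE_mp[OF AEP], rule AE_I2, clarsimp simp: space_pair_measure)
      fix x y assume "x \<in> space M" "y \<in> space M" "P x" "P y"
      from pt[OF this] show "ennreal (\<bar>u x - u y\<bar> powr r / norm (x - y) powr (n + b * r)) \<le>
        ennreal C * ((\<Sum>k. I k x y * Q k x) + (\<Sum>k. I k x y * Q k y))"
        by (simp add: suminf_add distrib_left)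
    qed
    also have "\<dots> = ennreal C * ((\<integral>\<^sup>+p. (\<Sum>k. I k (fst p) (snd p) * Q k (fst p)) \<partial>(M \<Otimes>\<^sub>M M)) +
        (\<integral>\<^sup>+p. (\<Sum>k. I k (fst p) (snd p) * Q k (snd p)) \<partial>(M \<Otimes>\<^sub>M M)))"
      by (subst nn_integral_cmult, measurable, subst nn_integral_add, measurable)
    also have "(\<integral>\<^sup>+p. (\<Sum>k. I k (fst p) (snd p) * Q k (fst p)) \<partial>(M \<Otimes>\<^sub>M M)) = R"
      unfolding R_def by (subst nn_integral_fst[symmetric], measurable)
    \<comment> \<open>The weight \<open>I\<close> is symmetric on the space, so exchanging the
      variables turns this half into the previous one.\<close>
    also have "(\<integral>\<^sup>+p. (\<Sum>k. I k (fst p) (snd p) * Q k (snd p)) \<partial>(M \<Otimes>\<^sub>M M)) = R"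
      unfolding R_def
      by (subst MM.nn_integral_snd[symmetric], measurable)
        (auto intro!: nn_integral_cong suminf_cong simp: symI)
    finally have "energy b r u \<le> ennreal C * (2 * R)"
      by (simp add: mult_2)
    have "R = (\<integral>\<^sup>+x. (\<Sum>k. Q k x * (\<integral>\<^sup>+y. I k x y \<partial>M)) \<partial>M)"
      unfolding R_def
    proof (intro nn_integral_cong)
      fix x
      have "(\<integral>\<^sup>+y. (\<Sum>k. I k x y * Q k x) \<partial>M) = (\<Sum>k. \<integral>\<^sup>+y. I k x y * Q k x \<partial>M)"
        by (intro nn_integral_suminf) measurable
      also have "\<dots> = (\<Sum>k. (\<integral>\<^sup>+y. I k x y \<partial>M) * Q k x)"
        by (intro suminf_cong nn_integral_multc) measurable
      finally show "(\<integral>\<^sup>+y. (\<Sum>k. I k x y * Q k x) \<partial>M) = (\<Sum>k. Q k x * (\<integral>\<^sup>+y. I k x y \<partial>M))"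
        by (simp add: mult.commute)
    qed
    \<comment> \<open>Integrating over y gives the measure of a ball, of order
      \<open>scale k powr n\<close>, which cancels the n in the exponent.\<close>
    also have "\<dots> \<le> (\<integral>\<^sup>+x. (\<Sum>k. Q k x * ennreal (c1 * 2 powr n * scale k powr - (b * r))) \<partial>M)"
    proof (intro nn_integral_mono suminf_le mult_left_mono)
      fix x k
      have "(\<integral>\<^sup>+y. I k x y \<partial>M) \<le> ennreal (scale k powr - (n + b * r)) * ennreal (c1 * 2 powr n * scale k powr n)"
        unfolding I_def using ball_upper_le[of "scale k" x]
        by (subst nn_integral_cmult) (auto intro!: mult_left_mono)
      also have "\<dots> = ennreal (c1 * 2 powr n * scale k powr - (b * r))"
        using c1_pos by (simp add: ennreal_mult[symmetric] powr_diff powr_minus powr_add field_simps)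
      finally show "(\<integral>\<^sup>+y. I k x y \<partial>M) \<le> ennreal (c1 * 2 powr n * scale k powr - (b * r))" .
    qed auto
    also have "\<dots> = (\<Sum>k. ennreal (c1 * 2 powr n * scale k powr - (b * r)) * (\<integral>\<^sup>+x. Q k x \<partial>M))"
      by (simp add: nn_integral_suminf nn_integral_multc mult.commute)
    also have "\<dots> = (\<Sum>k. \<Sum>j. ennreal (c1 * 2 powr n * 2 powr - (b * r / 2 * real j)) *
        (ennreal (scale (j + k) powr - (b * r)) * (\<integral>\<^sup>+x. A (j + k) x \<up> r \<partial>M)))"
    proof (intro suminf_cong)
      fix k
      have "ennreal (c1 * 2 powr n * scale k powr - (b * r)) * (\<integral>\<^sup>+x. Q k x \<partial>M) =
        (\<Sum>j. ennreal (c1 * 2 powr n * scale k powr - (b * r)) * (ennreal (2 powr (b * r / 2 * real j)) * (\<integral>\<^sup>+x. A (k + j) x \<up> r \<partial>M)))"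
        unfolding Q_def by (simp add: nn_integral_suminf nn_integral_cmult)
      also have "\<dots> = (\<Sum>j. ennreal (c1 * 2 powr n * 2 powr - (b * r / 2 * real j)) *
        (ennreal (scale (k + j) powr - (b * r)) * (\<integral>\<^sup>+x. A (k + j) x \<up> r \<partial>M)))"
      proof (intro suminf_cong)
        fix j
        have "2 powr - (b * r / 2 * real j) * 2 powr (b * r * real j) = 2 powr (b * r / 2 * real j)"
          by (simp add: field_simps flip: powr_add)
        then have "c1 * 2 powr n * scale k powr - (b * r) * 2 powr (b * r / 2 * real j) =
          c1 * 2 powr n * 2 powr - (b * r / 2 * real j) * scale (k + j) powr - (b * r)"
          by (simp add: scale_add_powr)
        then show "ennreal (c1 * 2 powr n * scale k powr - (b * r)) * (ennreal (2 powr (b * r / 2 * real j)) * (\<integral>\<^sup>+x. A (k + j) x \<up> r \<partial>M)) =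
          ennreal (c1 * 2 powr n * 2 powr - (b * r / 2 * real j)) * (ennreal (scale (k + j) powr - (b * r)) * (\<integral>\<^sup>+x. A (k + j) x \<up> r \<partial>M))"
          using c1_pos by (simp only: mult.assoc[symmetric] ennreal_mult[symmetric] c1_pos less_imp_le powr_ge_zero mult_nonneg_nonneg)
      qed
      finally show "ennreal (c1 * 2 powr n * scale k powr - (b * r)) * (\<integral>\<^sup>+x. Q k x \<partial>M) = (\<Sum>j. ennreal (c1 * 2 powr n * 2 powr - (b * r / 2 * real j)) *
        (ennreal (scale (j + k) powr - (b * r)) * (\<integral>\<^sup>+x. A (j + k) x \<up> r \<partial>M)))"
        by (simp add: add.commute)
    qed
    \<comment> \<open>The relative depth j becomes the outer index: for fixed j the inner sum is a
      shift of the series wanted, multiplied by a factor that is summable in j.\<close>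
    also have "\<dots> = (\<Sum>j. \<Sum>k. ennreal (c1 * 2 powr n * 2 powr - (b * r / 2 * real j)) *
        (ennreal (scale (j + k) powr - (b * r)) * (\<integral>\<^sup>+x. A (j + k) x \<up> r \<partial>M)))"
      by (rule suminf_swap_ennreal)
    also have "\<dots> \<le> (\<Sum>j. ennreal (c1 * 2 powr n * 2 powr - (b * r / 2 * real j)) *
        (\<Sum>k. ennreal (scale k powr - (b * r)) * (\<integral>\<^sup>+x. A k x \<up> r \<partial>M)))"
    proof (intro suminf_le)
      fix j
      show "(\<Sum>k. ennreal (c1 * 2 powr n * 2 powr - (b * r / 2 * real j)) *
        (ennreal (scale (j + k) powr - (b * r)) * (\<integral>\<^sup>+x. A (j + k) x \<up> r \<partial>M))) \<le> ennreal (c1 * 2 powr n * 2 powr - (b * r / 2 * real j)) *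
        (\<Sum>k. ennreal (scale k powr - (b * r)) * (\<integral>\<^sup>+x. A k x \<up> r \<partial>M))"
        using suminf_shift_le_ennreal[of "\<lambda>k. ennreal (scale k powr - (b * r)) * (\<integral>\<^sup>+x. A k x \<up> r \<partial>M)" j]
        by (simp add: add.commute mult_left_mono)
    qed auto
    also have "\<dots> = ennreal (c1 * 2 powr n * (1 / (1 - 2 powr - (b * r / 2)))) *
        (\<Sum>k. ennreal (scale k powr - (b * r)) * (\<integral>\<^sup>+x. A k x \<up> r \<partial>M))"
    proof -
      have g: "(\<Sum>j. ennreal (2 powr - (b * r / 2 * real j))) = ennreal (1 / (1 - 2 powr - (b * r / 2)))"
        by (rule ennreal_sum_geometric) (use b r in simp)
      have "ennreal (c1 * 2 powr n * 2 powr - (b * r / 2 * real j)) = ennreal (c1 * 2 powr n) * ennreal (2 powr - (b * r / 2 * real j))" for j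
        using c1_pos by (intro ennreal_mult) auto
      then have "(\<Sum>j. ennreal (c1 * 2 powr n * 2 powr - (b * r / 2 * real j))) = ennreal (c1 * 2 powr n) * ennreal (1 / (1 - 2 powr - (b * r / 2)))"
        by (simp only: ennreal_suminf_cmult g)
      also have "\<dots> = ennreal (c1 * 2 powr n * (1 / (1 - 2 powr - (b * r / 2))))"
        using c1_pos b r by (intro ennreal_mult[symmetric]) (auto simp: powr_less_one less_imp_le)
      finally show ?thesis
        by (simp only: ennreal_suminf_multc)
    qed
    finally have "R \<le> ennreal (c1 * 2 powr n * (1 / (1 - 2 powr - (b * r / 2)))) *
        (\<Sum>k. ennreal (scale k powr - (b * r)) * (\<integral>\<^sup>+x. A k x \<up> r \<partial>M))" .
    then have "ennreal C * (2 * R) \<le> ennreal C * (2 * (ennreal (c1 * 2 powr n * (1 / (1 - 2 powr - (b * r / 2)))) *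
        (\<Sum>k. ennreal (scale k powr - (b * r)) * (\<integral>\<^sup>+x. A k x \<up> r \<partial>M))))"
      by (intro mult_left_mono) auto
    also have "\<dots> = ennreal C' * (\<Sum>j. ennreal (scale j powr - (b * r)) * (\<integral>\<^sup>+x. A j x \<up> r \<partial>M))"
    proof -
      have "0 \<le> c1 * 2 powr n * (1 / (1 - 2 powr - (b * r / 2)))"
        using c1_pos b r by (simp add: powr_less_one less_imp_le)
      moreover have "ennreal C * (2 * (ennreal Z * S)) = ennreal (C * (2 * Z)) * S" if "0 \<le> Z" for Z S
        using C that by (simp add: ennreal_mult mult.assoc)
      ultimately show ?thesis
        unfolding C'_def by blast
    qed
    finally show ?thesis
      using \<open>energy b r u \<le> ennreal C * (2 * R)\<close> by (rule order_trans[rotated])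
  qed
  have "0 \<le> C'"
    using C c1_pos b r by (simp add: C'_def powr_less_one less_imp_le)
  then show ?thesis
  proof (intro exI[of _ C'] conjI allI impI)
    fix u and A :: "nat \<Rightarrow> 'a \<Rightarrow> ennreal"
    assume "u \<in> borel_measurable M" "\<forall>j. A j \<in> borel_measurable M" "telescopes u A"
    moreover then obtain P where "AE x in M. P x" and "\<forall>k. \<forall>x\<in>space M. \<forall>y\<in>space M. P x \<longrightarrow> P y \<longrightarrow> dist x y \<le> scale k \<longrightarrow>
        ennreal \<bar>u x - u y\<bar> \<le> (\<Sum>j. A (k + j) x) + (\<Sum>j. A (k + j) y)"
      unfolding telescopes_def by blast
    ultimately show "energy b r u \<le> ennreal C' * (\<Sum>j. ennreal (scale j powr - (b * r)) * (\<integral>\<^sup>+x. A j x \<up> r \<partial>M))"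
      by (intro main[of u A P]) simp_all
  qed
qed

section \<open>Averages over balls and mean oscillations\<close>

definition ballM :: "'a \<Rightarrow> real \<Rightarrow> 'a set" where
  "ballM x t = {y \<in> space M. dist x y < t}"

definition avg :: "('a \<Rightarrow> real) \<Rightarrow> 'a set \<Rightarrow> real" where
  "avg u S = (LINT y|M. indicator S y * u y) / measure M S"

text \<open>An integral over pairs of points, rather than a deviation from an average, compares
  directly with the integrand of the energy. Up to constants the prefactor divides by the squared
  measure of a ball of radius \<open>2 * scale j\<close>.\<close>

definition osc :: "('a \<Rightarrow> real) \<Rightarrow> nat \<Rightarrow> 'a \<Rightarrow> ennreal" where
  "osc u j x = ennreal (scale j powr - (2 * n)) *
    (\<integral>\<^sup>+p. (if dist x (fst p) < 2 * scale j \<and> dist x (snd p) < 2 * scale j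
      then ennreal \<bar>u (fst p) - u (snd p)\<bar> else 0) \<partial>(M \<Otimes>\<^sub>M M))"

lemma sets_ballM [measurable]: "ballM x t \<in> sets M"
  unfolding ballM_def by measurable

lemma avg_dist_le:
  assumes u: "integrable M u" and S: "S \<in> sets M" "0 < measure M S"
  shows "ennreal \<bar>avg u S - c\<bar> \<le> ennreal (1 / measure M S) * (\<integral>\<^sup>+y. ennreal \<bar>u y - c\<bar> * indicator S y \<partial>M)"
proof -
  have int: "integrable M (\<lambda>y. indicator S y * (u y - c))"
    using u S by (intro integrable_mult_indicator[where 'b=real, simplified] Bochner_Integration.integrable_diff) auto
  have "avg u S - c = (LINT y|M. indicator S y * (u y - c)) / measure M S"
  proof -
    have "(LINT y|M. indicator S y * (u y - c)) = (LINT y|M. indicator S y * u y - indicator S y * c)"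
      by (simp add: algebra_simps)
    also have "\<dots> = (LINT y|M. indicator S y * u y) - measure M S * c"
    proof (subst Bochner_Integration.integral_diff)
      show "integrable M (\<lambda>y. indicator S y * u y)"
        using u S by (intro integrable_mult_indicator[where 'b=real, simplified])
      show "integrable M (\<lambda>y. indicator S y * c)"
        using S by (intro integrable_mult_left integrable_real_indicator) (auto simp: less_top[symmetric])
    qed (use S in simp)
    finally show ?thesis using S by (simp add: avg_def field_simps)
  qed
  then have "\<bar>avg u S - c\<bar> = 1 / measure M S * \<bar>LINT y|M. indicator S y * (u y - c)\<bar>"
    using S by simp
  also have "\<dots> \<le> 1 / measure M S * (LINT y|M. \<bar>indicator S y * (u y - c)\<bar>)"
    by (intro mult_left_mono integral_abs_bound) auto
  finally have "ennreal \<bar>avg u S - c\<bar> \<le> ennreal (1 / measure M S * (LINT y|M. \<bar>indicator S y * (u y - c)\<bar>))"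
    by (rule ennreal_leI)
  also have "\<dots> = ennreal (1 / measure M S) * (\<integral>\<^sup>+y. ennreal \<bar>indicator S y * (u y - c)\<bar> \<partial>M)"
    by (subst nn_integral_eq_integral, use int in simp, simp, rule ennreal_mult) auto
  also have "(\<integral>\<^sup>+y. ennreal \<bar>indicator S y * (u y - c)\<bar> \<partial>M) = (\<integral>\<^sup>+y. ennreal \<bar>u y - c\<bar> * indicator S y \<partial>M)"
    by (intro nn_integral_cong) (auto simp: indicator_def)
  finally show ?thesis .
qed

lemma avg_avg_le:
  assumes u: "integrable M u" and S: "S \<in> sets M" "0 < measure M S" and T: "T \<in> sets M" "0 < measure M T"
  shows "ennreal \<bar>avg u S - avg u T\<bar> \<le> ennreal (1 / (measure M S * measure M T)) *
    (\<integral>\<^sup>+p. ennreal \<bar>u (fst p) - u (snd p)\<bar> * indicator (S \<times> T) p \<partial>(M \<Otimes>\<^sub>M M))"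
proof -
  have [measurable]: "u \<in> borel_measurable M" "S \<in> sets M" "T \<in> sets M"
    using u S T by auto
  have "ennreal \<bar>avg u S - avg u T\<bar> \<le> ennreal (1 / measure M S) * (\<integral>\<^sup>+y. ennreal \<bar>avg u T - u y\<bar> * indicator S y \<partial>M)"
    using avg_dist_le[OF u S, of "avg u T"] by (simp add: abs_minus_commute)
  also have "\<dots> \<le> ennreal (1 / measure M S) * (\<integral>\<^sup>+y. (ennreal (1 / measure M T) *
      (\<integral>\<^sup>+z. ennreal \<bar>u z - u y\<bar> * indicator T z \<partial>M)) * indicator S y \<partial>M)"
    by (intro mult_left_mono nn_integral_mono mult_right_mono avg_dist_le u T) auto
  also have "\<dots> = ennreal (1 / measure M S) * (\<integral>\<^sup>+y. ennreal (1 / measure M T) *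
      (\<integral>\<^sup>+z. ennreal \<bar>u y - u z\<bar> * indicator (S \<times> T) (y, z) \<partial>M) \<partial>M)"
  proof (rule arg_cong[where f="\<lambda>X. ennreal (1 / measure M S) * X"], rule nn_integral_cong)
    fix y
    show "ennreal (1 / measure M T) * (\<integral>\<^sup>+z. ennreal \<bar>u z - u y\<bar> * indicator T z \<partial>M) * indicator S y =
      ennreal (1 / measure M T) * (\<integral>\<^sup>+z. ennreal \<bar>u y - u z\<bar> * indicator (S \<times> T) (y, z) \<partial>M)"
      by (cases "y \<in> S") (simp_all add: indicator_times abs_minus_commute)
  qed
  also have "\<dots> = ennreal (1 / measure M S) * (ennreal (1 / measure M T) *
      (\<integral>\<^sup>+y. (\<integral>\<^sup>+z. ennreal \<bar>u y - u z\<bar> * indicator (S \<times> T) (y, z) \<partial>M) \<partial>M))"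
    by (subst nn_integral_cmult) (auto intro!: borel_measurable_nn_integral)
  also have "(\<integral>\<^sup>+y. (\<integral>\<^sup>+z. ennreal \<bar>u y - u z\<bar> * indicator (S \<times> T) (y, z) \<partial>M) \<partial>M) =
      (\<integral>\<^sup>+p. ennreal \<bar>u (fst p) - u (snd p)\<bar> * indicator (S \<times> T) p \<partial>(M \<Otimes>\<^sub>M M))"
    by (subst nn_integral_fst[symmetric]) auto
  finally show ?thesis
    using S T by (simp add: ennreal_mult[symmetric] mult.assoc[symmetric])
qed

text \<open>The form of the hypotheses covers both the step from one scale to the next and the
  change of the centre: each time two balls of radius at least \<open>scale j / 2\<close> lie in one
  ball of radius \<open>2 * scale j\<close>.\<close>

lemma avg_avg_le_osc:
  assumes u: "integrable M u" and S: "S \<in> sets M" "S \<subseteq> ballM x (2 * scale j)" "c0 * (scale j / 2) powr n \<le> measure M S"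
    and T: "T \<in> sets M" "T \<subseteq> ballM x (2 * scale j)" "c0 * (scale j / 2) powr n \<le> measure M T"
  shows "ennreal \<bar>avg u S - avg u T\<bar> \<le> ennreal (4 powr n / c0\<^sup>2) * osc u j x"
proof -
  define m where "m = c0 * (scale j / 2) powr n"
  have m: "0 < m" using c0_pos by (simp add: m_def)
  have mm: "1 / (m * m) = 4 powr n / c0\<^sup>2 * scale j powr - (2 * n)"
  proof -
    have "(4::real) powr n = 2 powr n * 2 powr n"
      by (simp flip: powr_mult)
    moreover have "scale j powr - (2 * n) = 1 / (scale j powr n * scale j powr n)"
      by (simp add: powr_minus divide_inverse flip: powr_add)
    ultimately show ?thesis
      by (simp add: m_def powr_divide power2_eq_square)
  qed
  have "ennreal \<bar>avg u S - avg u T\<bar> \<le> ennreal (1 / (measure M S * measure M T)) *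
    (\<integral>\<^sup>+p. ennreal \<bar>u (fst p) - u (snd p)\<bar> * indicator (S \<times> T) p \<partial>(M \<Otimes>\<^sub>M M))"
    using S T m unfolding m_def by (intro avg_avg_le u) auto
  also have "\<dots> \<le> ennreal (1 / (m * m)) *
    (\<integral>\<^sup>+p. (if dist x (fst p) < 2 * scale j \<and> dist x (snd p) < 2 * scale j
      then ennreal \<bar>u (fst p) - u (snd p)\<bar> else 0) \<partial>(M \<Otimes>\<^sub>M M))"
  proof (intro mult_mono nn_integral_mono ennreal_leI)
    show "1 / (measure M S * measure M T) \<le> 1 / (m * m)"
      using S T m unfolding m_def[symmetric]
      by (intro divide_left_mono mult_mono mult_pos_pos) auto
  qed (use S T in \<open>auto simp: indicator_def ballM_def\<close>)
  also have "\<dots> = ennreal (4 powr n / c0\<^sup>2) * osc u j x"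
    unfolding mm osc_def by (subst ennreal_mult) (auto simp: mult.assoc)
  finally show ?thesis .
qed

lemma measurable_osc [measurable]:
  assumes [measurable]: "u \<in> borel_measurable M"
  shows "osc u j \<in> borel_measurable M"
  unfolding osc_def by measurable

text \<open>A substitute for Lebesgue differentiation. On a ball of radius t the kernel of the
  energy is at least \<open>t powr - (n + a * q)\<close>, so a finite inner integral at x forces the
  average to differ from \<open>u x\<close> by at most a constant times
  \<open>t powr a\<close>.\<close>

lemma avg_tendsto:
  assumes u: "integrable M u" and x: "x \<in> space M" and q: "1 \<le> q" and a: "0 < a"
    and fin: "(\<integral>\<^sup>+y. ennreal (\<bar>u x - u y\<bar> powr q / norm (x - y) powr (n + a * q)) \<partial>M) < top"
  shows "(\<lambda>j. avg u (ballM x (scale j))) \<longlonglongrightarrow> u x"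
proof -
  have [measurable]: "u \<in> borel_measurable M" using u by auto
  obtain F where F: "0 \<le> F" "(\<integral>\<^sup>+y. ennreal (\<bar>u x - u y\<bar> powr q / norm (x - y) powr (n + a * q)) \<partial>M) = ennreal F"
    using fin by (cases "\<integral>\<^sup>+y. ennreal (\<bar>u x - u y\<bar> powr q / norm (x - y) powr (n + a * q)) \<partial>M") auto
  define K where "K = (1 / c0) powr q * (2 powr q * c1 powr (q - 1)) * F"
  have K: "K \<ge> 0" using F by (simp add: K_def)
  have le: "\<bar>avg u (ballM x (scale j)) - u x\<bar> \<le> (K * scale j powr (a * q)) powr (1 / q)" for j
  proof -
    define s where "s = scale j"
    define B where "B = ballM x s"
    have s: "0 < s" "s \<le> D" by (auto simp: s_def scale_le_D)
    have mB: "c0 * s powr n \<le> measure M B" "measure M B \<le> c1 * s powr n"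
      using ball_lower[OF x s] ball_upper[of s x] s by (auto simp: B_def ballM_def)
    have [measurable]: "B \<in> sets M" by (simp add: B_def)
    have pos: "0 < c0 * s powr n" using c0_pos s by simp
    have "(\<integral>\<^sup>+y. ennreal \<bar>u y - u x\<bar> \<up> q * indicator B y \<partial>M) \<le>
      (\<integral>\<^sup>+y. ennreal (s powr (n + a * q)) * ennreal (\<bar>u x - u y\<bar> powr q / norm (x - y) powr (n + a * q)) \<partial>M)"
    proof (intro nn_integral_mono)
      fix y
      show "ennreal \<bar>u y - u x\<bar> \<up> q * indicator B y \<le>
        ennreal (s powr (n + a * q)) * ennreal (\<bar>u x - u y\<bar> powr q / norm (x - y) powr (n + a * q))"
      proof (cases "y \<in> B \<and> y \<noteq> x")
        case True
        then have d: "0 < norm (x - y)" "norm (x - y) \<le> s"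
          by (auto simp: B_def ballM_def dist_norm)
        then have "norm (x - y) powr (n + a * q) \<le> s powr (n + a * q)"
          using n_pos a q by (intro powr_mono2) auto
        then have "\<bar>u x - u y\<bar> powr q * 1 \<le> \<bar>u x - u y\<bar> powr q * (s powr (n + a * q) / norm (x - y) powr (n + a * q))"
          using d by (intro mult_left_mono) auto
        then show ?thesis
          using True by (auto simp: epowr_ennreal abs_minus_commute mult.commute simp flip: ennreal_mult intro!: ennreal_leI)
      qed (auto simp: epowr_ennreal)
    qed
    also have "\<dots> = ennreal (s powr (n + a * q) * F)"
      using F by (subst nn_integral_cmult) (auto simp: ennreal_mult)
    finally have 1: "(\<integral>\<^sup>+y. ennreal \<bar>u y - u x\<bar> \<up> q * indicator B y \<partial>M) \<le> ennreal (s powr (n + a * q) * F)" .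
    have "(\<integral>\<^sup>+y. ennreal \<bar>u y - u x\<bar> * indicator B y \<partial>M) \<up> q \<le>
      ennreal (2 powr q * (c1 * s powr n) powr (q - 1)) * (\<integral>\<^sup>+y. ennreal \<bar>u y - u x\<bar> \<up> q * indicator B y \<partial>M)"
      using mB c1_pos q by (intro nn_integral_set_epowr_le) (auto simp: emeasure_eq_measure intro: ennreal_leI)
    also have "\<dots> \<le> ennreal (2 powr q * (c1 * s powr n) powr (q - 1)) * ennreal (s powr (n + a * q) * F)"
      using 1 by (intro mult_left_mono) auto
    finally have 2: "(\<integral>\<^sup>+y. ennreal \<bar>u y - u x\<bar> * indicator B y \<partial>M) \<up> q \<le>
      ennreal (2 powr q * (c1 * s powr n) powr (q - 1) * (s powr (n + a * q) * F))"
      by (simp add: ennreal_mult F)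
    have "ennreal \<bar>avg u B - u x\<bar> \<le> ennreal (1 / measure M B) * (\<integral>\<^sup>+y. ennreal \<bar>u y - u x\<bar> * indicator B y \<partial>M)"
      using mB pos by (intro avg_dist_le u) auto
    also have "\<dots> \<le> ennreal (1 / (c0 * s powr n)) * (\<integral>\<^sup>+y. ennreal \<bar>u y - u x\<bar> * indicator B y \<partial>M)"
      using mB pos by (intro mult_right_mono ennreal_leI divide_left_mono) (auto intro: mult_pos_pos less_le_trans)
    finally have "ennreal \<bar>avg u B - u x\<bar> \<up> q \<le> (ennreal (1 / (c0 * s powr n)) * (\<integral>\<^sup>+y. ennreal \<bar>u y - u x\<bar> * indicator B y \<partial>M)) \<up> q"
      using q by (intro epowr_mono) auto
    also have "\<dots> \<le> ennreal ((1 / (c0 * s powr n)) powr q) * ennreal (2 powr q * (c1 * s powr n) powr (q - 1) * (s powr (n + a * q) * F))"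
      using 2 c0_pos by (auto simp: epowr_mult epowr_ennreal intro!: mult_left_mono)
    also have "\<dots> = ennreal (K * s powr (a * q))"
    proof -
      have "s powr (n * q) = s powr (n * (q - 1)) * s powr n"
        by (simp add: algebra_simps flip: powr_add)
      then show ?thesis
        using s c0_pos c1_pos F
        by (simp add: K_def powr_divide powr_mult powr_powr powr_add field_simps flip: ennreal_mult)
    qed
    finally have "ennreal \<bar>avg u B - u x\<bar> \<le> ennreal (K * s powr (a * q)) \<up> (1 / q)"
      using q by (simp add: epowr_le_iff)
    then show ?thesis
      using K by (simp add: epowr_ennreal B_def s_def)
  qed
  have "(\<lambda>j. scale j) \<longlonglongrightarrow> 0"
    unfolding scale_def by real_asymp
  then have "(\<lambda>j. K * scale j powr (a * q)) \<longlonglongrightarrow> K * 0 powr (a * q)"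
    using a q by (intro tendsto_mult tendsto_const tendsto_powr') auto
  then have "(\<lambda>j. (K * scale j powr (a * q)) powr (1 / q)) \<longlonglongrightarrow> (K * 0 powr (a * q)) powr (1 / q)"
    using a q K by (intro tendsto_powr') auto
  then have "(\<lambda>j. (K * scale j powr (a * q)) powr (1 / q)) \<longlonglongrightarrow> 0" by simp
  then have "(\<lambda>j. avg u (ballM x (scale j)) - u x) \<longlonglongrightarrow> 0"
    by (rule tendsto_0_le[where K=1]) (use le in auto)
  then show ?thesis
    by (simp add: LIM_zero_iff)
qed

lemma telescope_osc:
  assumes u: "integrable M u" and xy: "x \<in> space M" "y \<in> space M" "dist x y \<le> scale k"
    and lim: "(\<lambda>j. avg u (ballM x (scale j))) \<longlonglongrightarrow> u x" "(\<lambda>j. avg u (ballM y (scale j))) \<longlonglongrightarrow> u y"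
  shows "ennreal \<bar>u x - u y\<bar> \<le> (\<Sum>j. ennreal (2 * (4 powr n / c0\<^sup>2)) * osc u (k + j) x) +
    (\<Sum>j. ennreal (2 * (4 powr n / c0\<^sup>2)) * osc u (k + j) y)"
proof -
  define K where "K = 4 powr n / c0\<^sup>2"
  define v where "v z j = avg u (ballM z (scale j))" for z j
  have low: "c0 * (scale j / 2) powr n \<le> measure M (ballM z t)" if "z \<in> space M" "scale j / 2 \<le> t" for z j t
  proof -
    have "c0 * (scale j / 2) powr n \<le> measure M (ballM z (scale j / 2))"
      using ball_lower[of z "scale j / 2"] that scale_le_D[of j] D_pos scale_pos[of j]
      by (auto simp: ballM_def simp del: scale_pos)
    also have "\<dots> \<le> measure M (ballM z t)"
      using that by (intro finite_measure_mono) (auto simp: ballM_def)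
    finally show ?thesis .
  qed
  have step: "ennreal \<bar>v z j - v z (Suc j)\<bar> \<le> ennreal K * osc u j z" if "z \<in> space M" for z j
    unfolding v_def K_def using that scale_Suc[of j]
    using scale_pos[of "Suc j"]
    by (intro avg_avg_le_osc u low) (auto simp: ballM_def simp del: scale_pos)
  \<comment> \<open>The ball around y lies in the doubled ball around x, so one oscillation at x
    compares the two averages. It is again the first term of the series at x, which is why the
    constant in the statement carries a factor 2.\<close>
  have cross: "ennreal \<bar>v x k - v y k\<bar> \<le> ennreal K * osc u k x"
    unfolding v_def K_def
  proof (intro avg_avg_le_osc u low xy)
    show "ballM y (scale k) \<subseteq> ballM x (2 * scale k)"
      using xy(3) by (auto simp: ballM_def) (smt (verit) dist_triangle)
  qed (auto simp: ballM_def intro: less_trans)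
  have tail: "ennreal \<bar>u z - v z k\<bar> \<le> (\<Sum>j. ennreal K * osc u (k + j) z)"
    if "z \<in> space M" "(\<lambda>j. v z j) \<longlonglongrightarrow> u z" for z
  proof -
    have "ennreal \<bar>u z - v z k\<bar> \<le> (\<Sum>j. ennreal \<bar>v z (k + j) - v z (Suc (k + j))\<bar>)"
      using that(2) by (intro suminf_tendsto_dist_le[of "\<lambda>i. i"]) (auto simp: strict_mono_def)
    also have "\<dots> \<le> (\<Sum>j. ennreal K * osc u (k + j) z)"
      by (intro suminf_le step that) auto
    finally show ?thesis .
  qed
  have "\<bar>u x - u y\<bar> \<le> \<bar>u x - v x k\<bar> + \<bar>v x k - v y k\<bar> + \<bar>u y - v y k\<bar>"
    by linarith
  then have "ennreal \<bar>u x - u y\<bar> \<le> ennreal \<bar>u x - v x k\<bar> + ennreal \<bar>v x k - v y k\<bar> + ennreal \<bar>u y - v y k\<bar>"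
    by (simp flip: ennreal_plus)
  also have "\<dots> \<le> (\<Sum>j. ennreal K * osc u (k + j) x) + (\<Sum>j. ennreal K * osc u (k + j) x) + (\<Sum>j. ennreal K * osc u (k + j) y)"
  proof (intro add_mono tail xy)
    have "ennreal K * osc u k x \<le> (\<Sum>j. ennreal K * osc u (k + j) x)"
      using sum_le_suminf[of "\<lambda>j. ennreal K * osc u (k + j) x" "{0}"] by simp
    with cross show "ennreal \<bar>v x k - v y k\<bar> \<le> (\<Sum>j. ennreal K * osc u (k + j) x)"
      by (rule order_trans)
  qed (use lim in \<open>simp_all add: v_def\<close>)
  also have "\<dots> \<le> 2 * (\<Sum>j. ennreal K * osc u (k + j) x) + 2 * (\<Sum>j. ennreal K * osc u (k + j) y)"
    by (intro add_mono) (auto simp: mult_2)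
  also have "\<dots> = (\<Sum>j. ennreal (2 * K) * osc u (k + j) x) + (\<Sum>j. ennreal (2 * K) * osc u (k + j) y)"
  proof -
    have "ennreal (2 * K) = 2 * ennreal K"
      using ennreal_mult[of 2 K] by (simp add: K_def)
    then show ?thesis by (simp add: mult.assoc)
  qed
  finally show ?thesis unfolding K_def .
qed

section \<open>From oscillations back to energies\<close>

lemma osc_powr_le:
  assumes [measurable]: "u \<in> borel_measurable M" and q: "1 \<le> q"
  shows "osc u j x \<up> q \<le> ennreal (2 powr q * (c1\<^sup>2 * 4 powr n) powr (q - 1) * scale j powr - (2 * n)) *
    (\<integral>\<^sup>+p. (if dist x (fst p) < 2 * scale j \<and> dist x (snd p) < 2 * scale j
      then ennreal (\<bar>u (fst p) - u (snd p)\<bar> powr q) else 0) \<partial>(M \<Otimes>\<^sub>M M))"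
proof -
  define s where "s = scale j"
  define B where "B = ballM x (2 * s)"
  define m where "m = c1 * (2 * s) powr n"
  have s: "s > 0" by (simp add: s_def)
  have m: "m > 0" using c1_pos s by (simp add: m_def)
  have [measurable]: "B \<in> sets M" by (simp add: B_def)
  have "emeasure M B \<le> ennreal m"
    using ball_upper[of "2 * s" x] s by (simp add: B_def ballM_def m_def emeasure_eq_measure ennreal_leI)
  then have "emeasure (M \<Otimes>\<^sub>M M) (B \<times> B) \<le> ennreal m * ennreal m"
    by (subst emeasure_pair_measure_Times) (auto intro: mult_mono)
  then have mB: "emeasure (M \<Otimes>\<^sub>M M) (B \<times> B) \<le> ennreal (m * m)"
    using m by (simp add: ennreal_mult)
  have ind: "(\<integral>\<^sup>+p. (if dist x (fst p) < 2 * s \<and> dist x (snd p) < 2 * s then f p else 0) \<partial>(M \<Otimes>\<^sub>M M)) =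
    (\<integral>\<^sup>+p. f p * indicator (B \<times> B) p \<partial>(M \<Otimes>\<^sub>M M))" for f :: "'a \<times> 'a \<Rightarrow> ennreal"
    by (intro nn_integral_cong) (auto simp: indicator_def B_def ballM_def space_pair_measure)
  have "osc u j x \<up> q = ennreal ((s powr - (2 * n)) powr q) *
    (\<integral>\<^sup>+p. ennreal \<bar>u (fst p) - u (snd p)\<bar> * indicator (B \<times> B) p \<partial>(M \<Otimes>\<^sub>M M)) \<up> q"
    unfolding osc_def s_def[symmetric] ind by (simp add: epowr_mult epowr_ennreal)
  also have "\<dots> \<le> ennreal ((s powr - (2 * n)) powr q) * (ennreal (2 powr q * (m * m) powr (q - 1)) *
    (\<integral>\<^sup>+p. ennreal \<bar>u (fst p) - u (snd p)\<bar> \<up> q * indicator (B \<times> B) p \<partial>(M \<Otimes>\<^sub>M M)))"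
    using mB q m by (intro mult_left_mono nn_integral_set_epowr_le) auto
  also have "\<dots> = ennreal ((s powr - (2 * n)) powr q * (2 powr q * (m * m) powr (q - 1))) *
    (\<integral>\<^sup>+p. ennreal (\<bar>u (fst p) - u (snd p)\<bar> powr q) * indicator (B \<times> B) p \<partial>(M \<Otimes>\<^sub>M M))"
    by (simp add: epowr_ennreal ennreal_mult mult.assoc)
  also have "(s powr - (2 * n)) powr q * (2 powr q * (m * m) powr (q - 1)) = 2 powr q * (c1\<^sup>2 * 4 powr n) powr (q - 1) * s powr - (2 * n)"
  proof -
    have "m * m = c1\<^sup>2 * 4 powr n * s powr (2 * n)"
    proof -
      have "(4::real) powr n = 2 powr n * 2 powr n"
        by (simp flip: powr_mult)
      moreover have "s powr (2 * n) = s powr n * s powr n"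
        by (simp flip: powr_add)
      ultimately show ?thesis
        by (simp only: m_def powr_mult power2_eq_square mult_ac)
    qed
    then have 1: "(m * m) powr (q - 1) = (c1\<^sup>2 * 4 powr n) powr (q - 1) * s powr (2 * n * (q - 1))"
      by (simp only: powr_mult[of "c1\<^sup>2 * 4 powr n" "s powr (2 * n)"] powr_powr)
    have 2: "(s powr - (2 * n)) powr q * s powr (2 * n * (q - 1)) = s powr - (2 * n)"
      by (simp add: powr_powr algebra_simps flip: powr_add)
    have "(s powr - (2 * n)) powr q * (2 powr q * ((c1\<^sup>2 * 4 powr n) powr (q - 1) * s powr (2 * n * (q - 1)))) =
      2 powr q * (c1\<^sup>2 * 4 powr n) powr (q - 1) * ((s powr - (2 * n)) powr q * s powr (2 * n * (q - 1)))"
      by (simp only: mult_ac)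
    then show ?thesis
      unfolding 1 2 .
  qed
  finally show ?thesis
    unfolding s_def[symmetric] ind .
qed

text \<open>The exponents of s add up to \<open>d - (n + a * q)\<close>, where d is r times the gap
  between the indices \<open>a - n / q\<close> and \<open>b - n / r\<close>. The index condition
  says that d is nonnegative, and this is the one place where the energy embedding uses it. At equal
  indices no power of s is left over; otherwise the surplus is absorbed by the diameter.\<close>

lemma fractional_embedding_coefficient:
  assumes s: "0 < s" "s \<le> D" and q: "1 \<le> q" "q \<le> r" and ab: "b - n / r \<le> a - n / q" and c: "0 \<le> c"
  shows "s powr - (b * r) * (c * s powr - (2 * n)) * (c * s powr - (2 * n) * (4 * s) powr (n + a * q)) powr ((r - q) / q) *
      (c1 * 2 powr n * (2 * s) powr n) \<le>
    c * (c * 4 powr (n + a * q)) powr ((r - q) / q) * (c1 * 2 powr n * 2 powr n) * D powr (r * (a - n / q - (b - n / r))) * s powr - (n + a * q)"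
proof -
  define d where "d = r * (a - n / q - (b - n / r))"
  have "(c * s powr - (2 * n) * (4 * s) powr (n + a * q)) powr ((r - q) / q) =
    (c * 4 powr (n + a * q)) powr ((r - q) / q) * s powr ((a * q - n) * ((r - q) / q))"
  proof -
    have "c * s powr - (2 * n) * (4 * s) powr (n + a * q) = (c * 4 powr (n + a * q)) * s powr (a * q - n)"
      by (simp add: powr_mult mult_ac flip: powr_add)
    then show ?thesis
      by (simp only: powr_mult[of "c * 4 powr (n + a * q)" "s powr (a * q - n)"] powr_powr)
  qed
  note 1 = this
  have 2: "(2 * s) powr n = 2 powr n * s powr n"
    by (rule powr_mult)
  have "s powr - (b * r) * (c * s powr - (2 * n)) * (c * s powr - (2 * n) * (4 * s) powr (n + a * q)) powr ((r - q) / q) *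
      (c1 * 2 powr n * (2 * s) powr n) =
     c * (c * 4 powr (n + a * q)) powr ((r - q) / q) * (c1 * 2 powr n * 2 powr n) *
     (s powr - (b * r) * s powr - (2 * n) * s powr ((a * q - n) * ((r - q) / q)) * s powr n)"
    unfolding 1 2 by (simp only: mult_ac)
  also have "s powr - (b * r) * s powr - (2 * n) * s powr ((a * q - n) * ((r - q) / q)) * s powr n = s powr d * s powr - (n + a * q)"
  proof -
    have "- (b * r) + - (2 * n) + (a * q - n) * ((r - q) / q) + n = d + - (n + a * q)"
      using q by (simp add: d_def field_simps)
    then show ?thesis
      by (simp only: powr_add[symmetric])
  qed
  also have "c * (c * 4 powr (n + a * q)) powr ((r - q) / q) * (c1 * 2 powr n * 2 powr n) * (s powr d * s powr - (n + a * q)) \<le>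
    c * (c * 4 powr (n + a * q)) powr ((r - q) / q) * (c1 * 2 powr n * 2 powr n) * (D powr d * s powr - (n + a * q))"
    using s ab q c c1_pos by (intro mult_left_mono mult_right_mono powr_mono2) (auto simp: d_def)
  finally show ?thesis by (simp add: d_def mult.assoc)
qed

lemma nn_integral_osc_powr_le:
  assumes [measurable]: "u \<in> borel_measurable M" and q: "1 \<le> q" "q \<le> r" and a: "0 < a"
  defines "c \<equiv> 2 powr q * (c1\<^sup>2 * 4 powr n) powr (q - 1)"
  shows "(\<integral>\<^sup>+x. osc u j x \<up> r \<partial>M) \<le>
    ennreal ((c * scale j powr - (2 * n)) * (c * scale j powr - (2 * n) * (4 * scale j) powr (n + a * q)) powr ((r - q) / q) *
      (c1 * 2 powr n * (2 * scale j) powr n)) * energy a q u \<up> ((r - q) / q) *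
      (\<integral>\<^sup>+p. (if norm (fst p - snd p) < 4 * scale j then ennreal (\<bar>u (fst p) - u (snd p)\<bar> powr q) else 0) \<partial>(M \<Otimes>\<^sub>M M))"
proof -
  interpret M3: pair_sigma_finite M "M \<Otimes>\<^sub>M M"
    by (intro pair_sigma_finite.intro sigma_finite_measure_axioms MM.sigma_finite_measure_axioms)
  define s where "s = scale j"
  define w where "w = n + a * q"
  define E where "E = energy a q u"
  define f where "f p = ennreal (\<bar>u (fst p) - u (snd p)\<bar> powr q)" for p
  define V where "V x = (\<integral>\<^sup>+p. (if dist x (fst p) < 2 * s \<and> dist x (snd p) < 2 * s then f p else 0) \<partial>(M \<Otimes>\<^sub>M M))" for x
  have s: "0 < s" by (simp add: s_def)
  have w: "0 < w" using n_pos a q by (simp add: w_def add_pos_pos)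
  have c: "0 \<le> c" by (simp add: c_def)
  have [measurable]: "f \<in> borel_measurable (M \<Otimes>\<^sub>M M)" unfolding f_def by measurable
  have [measurable]: "V \<in> borel_measurable M" unfolding V_def by measurable
  have osc_q: "osc u j x \<up> q \<le> ennreal (c * s powr - (2 * n)) * V x" for x
    using osc_powr_le[of u q j x] q unfolding c_def V_def s_def f_def by simp
  have V_E: "V x \<le> ennreal ((4 * s) powr w) * E" for x
  proof -
    have "V x \<le> (\<integral>\<^sup>+p. ennreal ((4 * s) powr w) * (case p of (x, y) \<Rightarrow> ennreal (\<bar>u x - u y\<bar> powr q / norm (x - y) powr w)) \<partial>(M \<Otimes>\<^sub>M M))"
      unfolding V_def
    proof (intro nn_integral_mono)
      fix p :: "'a \<times> 'a"
      obtain y z where p: "p = (y, z)" by (cases p)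
      show "(if dist x (fst p) < 2 * s \<and> dist x (snd p) < 2 * s then f p else 0) \<le>
        ennreal ((4 * s) powr w) * (case p of (x, y) \<Rightarrow> ennreal (\<bar>u x - u y\<bar> powr q / norm (x - y) powr w))"
      proof (cases "dist x y < 2 * s \<and> dist x z < 2 * s \<and> y \<noteq> z")
        case True
        then have d: "0 < norm (y - z)" "norm (y - z) \<le> 4 * s"
          by (auto simp: dist_norm[symmetric]) (smt (verit) dist_commute dist_triangle)
        then have "norm (y - z) powr w \<le> (4 * s) powr w"
          using w by (intro powr_mono2) auto
        then have "\<bar>u y - u z\<bar> powr q * 1 \<le> \<bar>u y - u z\<bar> powr q * ((4 * s) powr w / norm (y - z) powr w)"
          using d by (intro mult_left_mono) auto
        then show ?thesis
          using True p by (auto simp: f_def mult.commute simp flip: ennreal_mult intro!: ennreal_leI)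
      qed (auto simp: p f_def)
    qed
    also have "\<dots> = ennreal ((4 * s) powr w) * E"
      unfolding E_def energy_def w_def by (intro nn_integral_cmult) measurable
    finally show ?thesis .
  qed
  have osc_r: "osc u j x \<up> r \<le> (ennreal ((c * s powr - (2 * n) * (4 * s) powr w) powr ((r - q) / q)) * E \<up> ((r - q) / q) *
      ennreal (c * s powr - (2 * n))) * V x" for x
  proof -
    have "osc u j x \<up> q \<le> ennreal (c * s powr - (2 * n)) * (ennreal ((4 * s) powr w) * E)"
      using osc_q V_E by (meson mult_left_mono order_trans zero_le)
    also have "\<dots> = ennreal (c * s powr - (2 * n) * (4 * s) powr w) * E"
      using c by (simp add: ennreal_mult mult.assoc)
    finally have "(osc u j x \<up> q) \<up> ((r - q) / q) \<le> (ennreal (c * s powr - (2 * n) * (4 * s) powr w) * E) \<up> ((r - q) / q)"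
      using q by (intro epowr_mono) auto
    then have 1: "osc u j x \<up> (r - q) \<le> ennreal ((c * s powr - (2 * n) * (4 * s) powr w) powr ((r - q) / q)) * E \<up> ((r - q) / q)"
      using q c by (simp add: epowr_epowr epowr_mult epowr_ennreal)
    have "osc u j x \<up> r = osc u j x \<up> (r - q) * osc u j x \<up> q"
      by (simp flip: epowr_add)
    also have "\<dots> \<le> (ennreal ((c * s powr - (2 * n) * (4 * s) powr w) powr ((r - q) / q)) * E \<up> ((r - q) / q)) *
      (ennreal (c * s powr - (2 * n)) * V x)"
      by (intro mult_mono 1 osc_q) auto
    finally show ?thesis by (simp add: mult.assoc)
  qed
  \<comment> \<open>The order of integration is exchanged. A pair of points counts for those x that
    are within \<open>2 * s\<close> of both: they lie in one ball around the first point, and there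
    are none unless the pair is closer than \<open>4 * s\<close>.\<close>
  have "(\<integral>\<^sup>+x. V x \<partial>M) = (\<integral>\<^sup>+p. (\<integral>\<^sup>+x. (if dist x (fst p) < 2 * s \<and> dist x (snd p) < 2 * s then f p else 0) \<partial>M) \<partial>(M \<Otimes>\<^sub>M M))"
    unfolding V_def by (rule M3.Fubini'[symmetric]) measurable
  also have "\<dots> \<le> (\<integral>\<^sup>+p. (if norm (fst p - snd p) < 4 * s then f p else 0) * ennreal (c1 * 2 powr n * (2 * s) powr n) \<partial>(M \<Otimes>\<^sub>M M))"
  proof (intro nn_integral_mono)
    fix p :: "'a \<times> 'a"
    have "(\<integral>\<^sup>+x. (if dist x (fst p) < 2 * s \<and> dist x (snd p) < 2 * s then f p else 0) \<partial>M) \<le>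
      (\<integral>\<^sup>+x. (if norm (fst p - snd p) < 4 * s then f p else 0) * indicator {y \<in> space M. dist (fst p) y \<le> 2 * s} x \<partial>M)"
    proof (intro nn_integral_mono)
      fix x assume x: "x \<in> space M"
      show "(if dist x (fst p) < 2 * s \<and> dist x (snd p) < 2 * s then f p else 0) \<le>
        (if norm (fst p - snd p) < 4 * s then f p else 0) * indicator {y \<in> space M. dist (fst p) y \<le> 2 * s} x"
      proof (cases "dist x (fst p) < 2 * s \<and> dist x (snd p) < 2 * s")
        case True
        then have "norm (fst p - snd p) < 4 * s"
          unfolding dist_norm[symmetric] by (smt (verit) dist_commute dist_triangle)
        with True x show ?thesis by (auto simp: dist_commute)
      next
        case False then show ?thesis by auto
      qed
    qed
    also have "\<dots> = (if norm (fst p - snd p) < 4 * s then f p else 0) * (\<integral>\<^sup>+x. indicator {y \<in> space M. dist (fst p) y \<le> 2 * s} x \<partial>M)"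
      by (intro nn_integral_cmult) measurable
    also have "\<dots> \<le> (if norm (fst p - snd p) < 4 * s then f p else 0) * ennreal (c1 * 2 powr n * (2 * s) powr n)"
      using s by (intro mult_left_mono ball_upper_le) auto
    finally show "(\<integral>\<^sup>+x. (if dist x (fst p) < 2 * s \<and> dist x (snd p) < 2 * s then f p else 0) \<partial>M) \<le>
      (if norm (fst p - snd p) < 4 * s then f p else 0) * ennreal (c1 * 2 powr n * (2 * s) powr n)" .
  qed
  also have "\<dots> = (\<integral>\<^sup>+p. (if norm (fst p - snd p) < 4 * s then f p else 0) \<partial>(M \<Otimes>\<^sub>M M)) * ennreal (c1 * 2 powr n * (2 * s) powr n)"
    by (intro nn_integral_multc) measurable
  finally have V_int: "(\<integral>\<^sup>+x. V x \<partial>M) \<le> (\<integral>\<^sup>+p. (if norm (fst p - snd p) < 4 * s then f p else 0) \<partial>(M \<Otimes>\<^sub>M M)) * ennreal (c1 * 2 powr n * (2 * s) powr n)" .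
  have "(\<integral>\<^sup>+x. osc u j x \<up> r \<partial>M) \<le> (\<integral>\<^sup>+x. (ennreal ((c * s powr - (2 * n) * (4 * s) powr w) powr ((r - q) / q)) * E \<up> ((r - q) / q) *
      ennreal (c * s powr - (2 * n))) * V x \<partial>M)"
    by (intro nn_integral_mono osc_r)
  also have "\<dots> = (ennreal ((c * s powr - (2 * n) * (4 * s) powr w) powr ((r - q) / q)) * E \<up> ((r - q) / q) *
      ennreal (c * s powr - (2 * n))) * (\<integral>\<^sup>+x. V x \<partial>M)"
    by (intro nn_integral_cmult) measurable
  also have "\<dots> \<le> (ennreal ((c * s powr - (2 * n) * (4 * s) powr w) powr ((r - q) / q)) * E \<up> ((r - q) / q) *
      ennreal (c * s powr - (2 * n))) * ((\<integral>\<^sup>+p. (if norm (fst p - snd p) < 4 * s then f p else 0) \<partial>(M \<Otimes>\<^sub>M M)) * ennreal (c1 * 2 powr n * (2 * s) powr n))"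
    by (intro mult_left_mono V_int) auto
  also have "\<dots> = (ennreal (c * s powr - (2 * n)) * ennreal ((c * s powr - (2 * n) * (4 * s) powr w) powr ((r - q) / q)) *
      ennreal (c1 * 2 powr n * (2 * s) powr n)) * E \<up> ((r - q) / q) * (\<integral>\<^sup>+p. (if norm (fst p - snd p) < 4 * s then f p else 0) \<partial>(M \<Otimes>\<^sub>M M))"
    by (simp only: mult_ac)
  also have "ennreal (c * s powr - (2 * n)) * ennreal ((c * s powr - (2 * n) * (4 * s) powr w) powr ((r - q) / q)) *
      ennreal (c1 * 2 powr n * (2 * s) powr n) = ennreal ((c * s powr - (2 * n)) * (c * s powr - (2 * n) * (4 * s) powr w) powr ((r - q) / q) *
      (c1 * 2 powr n * (2 * s) powr n))"
    using c c1_pos by (subst ennreal_mult[symmetric], simp, simp, subst ennreal_mult[symmetric]) auto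
  finally show ?thesis
    unfolding s_def w_def E_def f_def .
qed

theorem energy_embedding:
  assumes b: "0 < b" and a: "0 < a" and q: "1 \<le> q" "q \<le> r" and ab: "b - n / r \<le> a - n / q"
  shows "\<exists>C. \<forall>u. integrable M u \<longrightarrow> energy b r u \<le> ennreal C * energy a q u \<up> (r / q)"
proof -
  define L where "L = 2 * (4 powr n / c0\<^sup>2)"
  have r: "0 < r" using q by simp
  obtain C where C0: "0 \<le> C" and C: "\<And>u A. u \<in> borel_measurable M \<Longrightarrow> (\<And>j. A j \<in> borel_measurable M) \<Longrightarrow> telescopes u A \<Longrightarrow>
    energy b r u \<le> ennreal C * (\<Sum>j. ennreal (scale j powr - (b * r)) * (\<integral>\<^sup>+x. A j x \<up> r \<partial>M))"
    using energy_le_of_telescope[OF b r] by blast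
  define w where "w = n + a * q"
  have w: "0 < w" using n_pos a q by (simp add: w_def add_pos_pos)
  define c where "c = 2 powr q * (c1\<^sup>2 * 4 powr n) powr (q - 1)"
  have c: "0 \<le> c" by (simp add: c_def)
  define K where "K = c * (c * 4 powr w) powr ((r - q) / q) * (c1 * 2 powr n * 2 powr n) * D powr (r * (a - n / q - (b - n / r)))"
  have K: "0 \<le> K" using c c1_pos by (simp add: K_def)
  define G where "G = 1 / (1 - 2 powr - w) * 4 powr w"
  have G: "0 \<le> G" using w by (simp add: G_def powr_less_one less_imp_le)
  have L: "0 \<le> L" by (simp add: L_def)
  \<comment> \<open>The summand 1 keeps the constant positive, so that the right side is
    \<open>top\<close> whenever the energy of order a is.\<close>
  define C' where "C' = C * (L powr r * (K * G)) + 1"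
  have "energy b r u \<le> ennreal C' * energy a q u \<up> (r / q)" if u: "integrable M u" for u
  proof (cases "energy a q u = top")
    case True
    have "0 < C'" using C0 K G by (auto simp: C'_def intro!: add_nonneg_pos)
    then show ?thesis
      using True by (simp add: ennreal_mult_top)
  next
    case False
    have [measurable]: "u \<in> borel_measurable M" using u by auto
    define E where "E = energy a q u"
    define f where "f p = ennreal (\<bar>u (fst p) - u (snd p)\<bar> powr q)" for p
    have [measurable]: "f \<in> borel_measurable (M \<Otimes>\<^sub>M M)" unfolding f_def by measurable
    have E_iter: "E = (\<integral>\<^sup>+x. \<integral>\<^sup>+y. ennreal (\<bar>u x - u y\<bar> powr q / norm (x - y) powr w) \<partial>M \<partial>M)"
      unfolding E_def energy_def w_def by (subst nn_integral_fst[symmetric]) auto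
    \<comment> \<open>Finite energy makes its inner integral finite at almost every x, and there the
      averages converge.\<close>
    have AEP: "AE x in M. (\<lambda>j. avg u (ballM x (scale j))) \<longlonglongrightarrow> u x"
    proof -
      have "AE x in M. (\<integral>\<^sup>+y. ennreal (\<bar>u x - u y\<bar> powr q / norm (x - y) powr w) \<partial>M) \<noteq> \<infinity>"
        using False unfolding E_def[symmetric] E_iter by (intro nn_integral_PInf_AE) auto
      then show ?thesis
        by (rule AE_mp, intro AE_I2 impI avg_tendsto[OF u _ q(1) a]) (auto simp: w_def less_top)
    qed
    have "energy b r u \<le> ennreal C * (\<Sum>j. ennreal (scale j powr - (b * r)) * (\<integral>\<^sup>+x. (ennreal L * osc u j x) \<up> r \<partial>M))"
    proof (rule C)
      show "telescopes u (\<lambda>j x. ennreal L * osc u j x)"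
        unfolding telescopes_def L_def
        by (intro exI[of _ "\<lambda>x. (\<lambda>j. avg u (ballM x (scale j))) \<longlonglongrightarrow> u x"] conjI AEP allI ballI impI telescope_osc u)
    qed auto
    also have "(\<Sum>j. ennreal (scale j powr - (b * r)) * (\<integral>\<^sup>+x. (ennreal L * osc u j x) \<up> r \<partial>M)) =
      ennreal (L powr r) * (\<Sum>j. ennreal (scale j powr - (b * r)) * (\<integral>\<^sup>+x. osc u j x \<up> r \<partial>M))"
      using L by (simp add: epowr_mult epowr_ennreal nn_integral_cmult mult.left_commute)
    also have "(\<Sum>j. ennreal (scale j powr - (b * r)) * (\<integral>\<^sup>+x. osc u j x \<up> r \<partial>M)) \<le>
      (\<Sum>j. ennreal K * E \<up> ((r - q) / q) * (\<integral>\<^sup>+p. (if norm (fst p - snd p) < 4 * scale j then ennreal (scale j powr - w) * f p else 0) \<partial>(M \<Otimes>\<^sub>M M)))"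
    proof (intro suminf_le)
      fix j
      define s where "s = scale j"
      define I where "I = (\<integral>\<^sup>+p. (if norm (fst p - snd p) < 4 * s then f p else 0) \<partial>(M \<Otimes>\<^sub>M M))"
      define X where "X = (c * s powr - (2 * n)) * (c * s powr - (2 * n) * (4 * s) powr w) powr ((r - q) / q) * (c1 * 2 powr n * (2 * s) powr n)"
      have X: "0 \<le> X" using c c1_pos by (simp add: X_def)
      have "ennreal (s powr - (b * r)) * (\<integral>\<^sup>+x. osc u j x \<up> r \<partial>M) \<le> ennreal (s powr - (b * r)) * (ennreal X * E \<up> ((r - q) / q) * I)"
        using nn_integral_osc_powr_le[of u q r a j] q a
        unfolding c_def s_def X_def I_def f_def E_def w_def by (intro mult_left_mono) auto
      also have "\<dots> = ennreal (s powr - (b * r) * X) * E \<up> ((r - q) / q) * I"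
        using X by (simp add: ennreal_mult mult.assoc)
      also have "\<dots> \<le> ennreal (K * s powr - w) * E \<up> ((r - q) / q) * I"
      proof (intro mult_right_mono ennreal_leI)
        show "s powr - (b * r) * X \<le> K * s powr - w"
          using fractional_embedding_coefficient[of s q r b a c] q ab c scale_le_D[of j]
          unfolding X_def K_def s_def w_def by (simp only: mult.assoc[symmetric]) simp
      qed auto
      also have "\<dots> = ennreal K * E \<up> ((r - q) / q) * (ennreal (s powr - w) * I)"
        using K by (simp add: ennreal_mult mult_ac)
      also have "ennreal (s powr - w) * I = (\<integral>\<^sup>+p. ennreal (s powr - w) * (if norm (fst p - snd p) < 4 * s then f p else 0) \<partial>(M \<Otimes>\<^sub>M M))"
        unfolding I_def by (intro nn_integral_cmult[symmetric]) measurable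
      also have "\<dots> = (\<integral>\<^sup>+p. (if norm (fst p - snd p) < 4 * s then ennreal (s powr - w) * f p else 0) \<partial>(M \<Otimes>\<^sub>M M))"
        by (intro nn_integral_cong) auto
      finally show "ennreal (scale j powr - (b * r)) * (\<integral>\<^sup>+x. osc u j x \<up> r \<partial>M) \<le>
        ennreal K * E \<up> ((r - q) / q) * (\<integral>\<^sup>+p. (if norm (fst p - snd p) < 4 * scale j then ennreal (scale j powr - w) * f p else 0) \<partial>(M \<Otimes>\<^sub>M M))"
        unfolding s_def .
    qed auto
    also have "\<dots> = ennreal K * E \<up> ((r - q) / q) * (\<Sum>j. (\<integral>\<^sup>+p. (if norm (fst p - snd p) < 4 * scale j then ennreal (scale j powr - w) * f p else 0) \<partial>(M \<Otimes>\<^sub>M M)))"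
      by (rule ennreal_suminf_cmult)
    also have "(\<Sum>j. (\<integral>\<^sup>+p. (if norm (fst p - snd p) < 4 * scale j then ennreal (scale j powr - w) * f p else 0) \<partial>(M \<Otimes>\<^sub>M M))) =
      (\<integral>\<^sup>+p. (\<Sum>j. if norm (fst p - snd p) < 4 * scale j then ennreal (scale j powr - w) * f p else 0) \<partial>(M \<Otimes>\<^sub>M M))"
      by (rule nn_integral_suminf[symmetric]) measurable
    \<comment> \<open>For a fixed pair only the scales above a quarter of its distance occur, and
      their powers \<open>- w\<close> sum to a multiple of \<open>norm (x - y) powr - w\<close>. The
      integrand of the energy has reappeared.\<close>
    also have "\<dots> \<le> (\<integral>\<^sup>+p. ennreal G * (case p of (x, y) \<Rightarrow> ennreal (\<bar>u x - u y\<bar> powr q / norm (x - y) powr w)) \<partial>(M \<Otimes>\<^sub>M M))"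
    proof (intro nn_integral_mono)
      fix p :: "'a \<times> 'a"
      obtain x y where p: "p = (x, y)" by (cases p)
      show "(\<Sum>j. if norm (fst p - snd p) < 4 * scale j then ennreal (scale j powr - w) * f p else 0) \<le>
        ennreal G * (case p of (x, y) \<Rightarrow> ennreal (\<bar>u x - u y\<bar> powr q / norm (x - y) powr w))"
      proof (cases "x = y")
        case True
        then show ?thesis by (simp add: p f_def)
      next
        case False
        define d where "d = norm (x - y) / 4"
        have d: "0 < d" using False by (simp add: d_def)
        have "(\<Sum>j. if norm (fst p - snd p) < 4 * scale j then ennreal (scale j powr - w) * f p else 0) =
          (\<Sum>j. ennreal (if d < D / 2 ^ j then (D / 2 ^ j) powr - w else 0) * f p)"
        proof (intro suminf_cong)
          fix j
          have "norm (x - y) < 4 * scale j \<longleftrightarrow> d < scale j"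
            by (auto simp: d_def)
          then show "(if norm (fst p - snd p) < 4 * scale j then ennreal (scale j powr - w) * f p else 0) =
            ennreal (if d < D / 2 ^ j then (D / 2 ^ j) powr - w else 0) * f p"
            by (simp add: p scale_def)
        qed
        also have "\<dots> \<le> ennreal (1 / (1 - 2 powr - w) * d powr - w) * f p"
          unfolding ennreal_suminf_multc using sum_dyadic_ge[OF D_pos d w] by (rule mult_right_mono) simp
        also have "1 / (1 - 2 powr - w) * d powr - w = G * norm (x - y) powr - w"
        proof -
          have "d powr - w = 4 powr w * norm (x - y) powr - w"
            by (simp only: d_def powr_divide powr_minus_divide) simp
          then show ?thesis by (simp add: G_def)
        qed
        also have "ennreal (G * norm (x - y) powr - w) * f p = ennreal G * ennreal (\<bar>u x - u y\<bar> powr q / norm (x - y) powr w)"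
          using G by (simp add: p f_def powr_minus_divide flip: ennreal_mult)
        finally show ?thesis by (simp add: p)
      qed
    qed
    also have "\<dots> = ennreal G * E"
      unfolding E_def energy_def w_def by (intro nn_integral_cmult) measurable
    finally have "energy b r u \<le> ennreal C * (ennreal (L powr r) * (ennreal K * E \<up> ((r - q) / q) * (ennreal G * E)))"
      by (simp add: mult_left_mono)
    also have "\<dots> = ennreal C * (ennreal (L powr r) * (ennreal K * ennreal G)) * (E \<up> ((r - q) / q) * E \<up> 1)"
      by (simp add: mult_ac)
    also have "E \<up> ((r - q) / q) * E \<up> 1 = E \<up> (r / q)"
      using q by (simp add: diff_divide_distrib flip: epowr_add del: epowr_one)
    also have "ennreal C * (ennreal (L powr r) * (ennreal K * ennreal G)) \<le> ennreal C'"
    proof -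
      have "ennreal C * (ennreal (L powr r) * (ennreal K * ennreal G)) = ennreal (C * (L powr r * (K * G)))"
        using K G C0 by (simp add: ennreal_mult)
      also have "\<dots> \<le> ennreal C'"
        by (intro ennreal_leI) (simp add: C'_def)
      finally show ?thesis .
    qed
    finally show ?thesis
      by (simp add: E_def mult_right_mono)
  qed
  then show ?thesis by blast
qed

section \<open>Decreasing the integrability exponent\<close>

lemma nn_integral_norm_powr_le:
  assumes "0 < \<sigma>"
  shows "\<exists>C\<ge>0. \<forall>x\<in>space M. (\<integral>\<^sup>+y. ennreal (norm (x - y) powr (\<sigma> - n)) \<partial>M) \<le> ennreal C"
proof -
  define C where "C = 2 powr n * (c1 * 2 powr n) * (1 / (1 - 2 powr - \<sigma>) * D powr \<sigma>)"
  have C: "0 \<le> C"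
    using assms c1_pos by (simp add: C_def powr_less_one less_imp_le)
  have "(\<integral>\<^sup>+y. ennreal (norm (x - y) powr (\<sigma> - n)) \<partial>M) \<le> ennreal C" if x: "x \<in> space M" for x
  proof -
    have "(\<integral>\<^sup>+y. ennreal (norm (x - y) powr (\<sigma> - n)) \<partial>M) \<le>
      (\<integral>\<^sup>+y. (\<Sum>k. ennreal (2 powr n * scale k powr (\<sigma> - n)) * indicator {y \<in> space M. dist x y \<le> scale k} y) \<partial>M)"
    proof (intro nn_integral_mono)
      fix y assume y: "y \<in> space M"
      show "ennreal (norm (x - y) powr (\<sigma> - n)) \<le>
        (\<Sum>k. ennreal (2 powr n * scale k powr (\<sigma> - n)) * indicator {y \<in> space M. dist x y \<le> scale k} y)"
      proof (cases "x = y")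
        case False
        then obtain k where k: "dist x y \<le> scale k" "scale k < 2 * dist x y"
          using exists_scale[of "dist x y"] dist_le_D x y by auto
        \<comment> \<open>The quotient of \<open>scale k\<close> and the distance is between 1 and
          2. According to the sign of the exponent the powers compare with the constant 1 or
          \<open>2 powr (n - \<sigma>)\<close>, and \<open>2 powr n\<close> covers both.\<close>
        have "dist x y powr (\<sigma> - n) \<le> 2 powr n * scale k powr (\<sigma> - n)"
        proof (cases "n \<le> \<sigma>")
          case True
          then have "dist x y powr (\<sigma> - n) \<le> 1 * scale k powr (\<sigma> - n)"
            using k by (simp add: powr_mono2)
          also have "\<dots> \<le> 2 powr n * scale k powr (\<sigma> - n)"
            using n_pos by (intro mult_right_mono ge_one_powr_ge_zero) auto
          finally show ?thesis .
        next
          case False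
          then have "dist x y powr (\<sigma> - n) \<le> (scale k / 2) powr (\<sigma> - n)"
            using k by (intro powr_mono2') auto
          also have "\<dots> = 2 powr (n - \<sigma>) * scale k powr (\<sigma> - n)"
            by (simp add: powr_divide powr_diff field_simps)
          also have "\<dots> \<le> 2 powr n * scale k powr (\<sigma> - n)"
            using assms by (intro mult_right_mono powr_mono) auto
          finally show ?thesis .
        qed
        then have "ennreal (norm (x - y) powr (\<sigma> - n)) \<le>
          ennreal (2 powr n * scale k powr (\<sigma> - n)) * indicator {y \<in> space M. dist x y \<le> scale k} y"
          using k y by (simp add: dist_norm ennreal_leI)
        also have "\<dots> \<le> (\<Sum>k. ennreal (2 powr n * scale k powr (\<sigma> - n)) * indicator {y \<in> space M. dist x y \<le> scale k} y)"
          by (rule term_le_suminf_ennreal)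
        finally show ?thesis .
      qed simp
    qed
    also have "\<dots> = (\<Sum>k. \<integral>\<^sup>+y. ennreal (2 powr n * scale k powr (\<sigma> - n)) * indicator {y \<in> space M. dist x y \<le> scale k} y \<partial>M)"
      by (intro nn_integral_suminf) measurable
    also have "\<dots> \<le> (\<Sum>k. ennreal (2 powr n * (c1 * 2 powr n)) * ennreal (if D / 2 ^ k \<le> D then (D / 2 ^ k) powr \<sigma> else 0))"
    proof (intro suminf_le)
      fix k
      have "(\<integral>\<^sup>+y. ennreal (2 powr n * scale k powr (\<sigma> - n)) * indicator {y \<in> space M. dist x y \<le> scale k} y \<partial>M) \<le>
        ennreal (2 powr n * scale k powr (\<sigma> - n)) * ennreal (c1 * 2 powr n * scale k powr n)"
        by (subst nn_integral_cmult, measurable) (intro mult_left_mono ball_upper_le; simp)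
      also have "\<dots> = ennreal (2 powr n * (c1 * 2 powr n)) * ennreal (scale k powr \<sigma>)"
      proof -
        have "scale k powr (\<sigma> - n) * scale k powr n = scale k powr \<sigma>"
          by (simp flip: powr_add)
        then have "2 powr n * scale k powr (\<sigma> - n) * (c1 * 2 powr n * scale k powr n) = 2 powr n * (c1 * 2 powr n) * scale k powr \<sigma>"
          by (metis (no_types, opaque_lifting) mult.assoc mult.left_commute)
        then show ?thesis
          using c1_pos by (simp flip: ennreal_mult)
      qed
      also have "ennreal (scale k powr \<sigma>) = ennreal (if D / 2 ^ k \<le> D then (D / 2 ^ k) powr \<sigma> else 0)"
        using scale_le_D[of k] by (simp add: scale_def)
      finally show "(\<integral>\<^sup>+y. ennreal (2 powr n * scale k powr (\<sigma> - n)) * indicator {y \<in> space M. dist x y \<le> scale k} y \<partial>M) \<le>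
        ennreal (2 powr n * (c1 * 2 powr n)) * ennreal (if D / 2 ^ k \<le> D then (D / 2 ^ k) powr \<sigma> else 0)" .
    qed auto
    also have "\<dots> = ennreal (2 powr n * (c1 * 2 powr n)) * (\<Sum>k. ennreal (if D / 2 ^ k \<le> D then (D / 2 ^ k) powr \<sigma> else 0))"
      by (rule ennreal_suminf_cmult)
    also have "\<dots> \<le> ennreal (2 powr n * (c1 * 2 powr n)) * ennreal (1 / (1 - 2 powr - \<sigma>) * D powr \<sigma>)"
      by (intro mult_left_mono sum_dyadic_le D_pos assms) auto
    also have "\<dots> = ennreal C"
      unfolding C_def using c1_pos assms by (intro ennreal_mult[symmetric]) (auto simp: powr_less_one less_imp_le)
    finally show ?thesis .
  qed
  with C show ?thesis by blast
qed

text \<open>Jensen's inequality is applied on the product space to the measure with density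
  \<open>norm (x - y) powr (\<sigma> - n)\<close>, which is finite because \<sigma> is positive. An
  order c strictly between b and a pays for this: the gap from b to c provides \<sigma>, and the gap
  from c to a leaves a nonnegative power of the distance, bounded through D.\<close>

theorem energy_embedding_smaller_exponent:
  assumes b: "0 < b" "b < a" and r: "1 \<le> r" "r < q"
  shows "\<exists>C. \<forall>u. u \<in> borel_measurable M \<longrightarrow> energy b r u \<le> ennreal C * energy a q u \<up> (r / q)"
proof -
  define c where "c = (a + b) / 2"
  define \<sigma> where "\<sigma> = (c - b) * r"
  have c: "b < c" "c < a" using b by (auto simp: c_def)
  have \<sigma>: "0 < \<sigma>" using c r by (simp add: \<sigma>_def)
  obtain C where C: "0 \<le> C" "\<And>x. x \<in> space M \<Longrightarrow> (\<integral>\<^sup>+y. ennreal (norm (x - y) powr (\<sigma> - n)) \<partial>M) \<le> ennreal C"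
    using nn_integral_norm_powr_le[OF \<sigma>] by auto
  define h where "h p = ennreal (norm (fst p - snd p) powr (\<sigma> - n))" for p :: "'a \<times> 'a"
  define m where "m = C * measure M (space M)"
  have m: "0 \<le> m" using C by (simp add: m_def)
  have [measurable]: "h \<in> borel_measurable (M \<Otimes>\<^sub>M M)" unfolding h_def by measurable
  define N where "N = density (M \<Otimes>\<^sub>M M) h"
  have N: "emeasure N (space N) \<le> ennreal m"
  proof -
    have "emeasure N (space N) = (\<integral>\<^sup>+p. h p \<partial>(M \<Otimes>\<^sub>M M))"
      unfolding N_def by (subst emeasure_density) (auto intro!: nn_integral_cong simp: indicator_def)
    also have "\<dots> = (\<integral>\<^sup>+x. \<integral>\<^sup>+y. h (x, y) \<partial>M \<partial>M)"
      by (rule nn_integral_fst[symmetric]) measurable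
    also have "\<dots> \<le> (\<integral>\<^sup>+x. ennreal C \<partial>M)"
      by (intro nn_integral_mono) (auto simp: h_def C)
    also have "\<dots> = ennreal m"
      using C by (simp add: m_def emeasure_eq_measure ennreal_mult)
    finally show ?thesis .
  qed
  define K where "K = 2 powr (q / r) * m powr (q / r - 1)"
  define L where "L = D powr ((a - c) * q + \<sigma>)"
  have "energy b r u \<le> ennreal ((K * L) powr (r / q)) * energy a q u \<up> (r / q)" if [measurable]: "u \<in> borel_measurable M" for u
  proof -
    define f where "f p = ennreal (\<bar>u (fst p) - u (snd p)\<bar> powr r / norm (fst p - snd p) powr (c * r))" for p
    have [measurable]: "f \<in> borel_measurable (M \<Otimes>\<^sub>M M)" unfolding f_def by measurable
    have "energy b r u = (\<integral>\<^sup>+p. h p * f p \<partial>(M \<Otimes>\<^sub>M M))"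
      unfolding energy_def
    proof (intro nn_integral_cong, clarify)
      fix x y :: 'a
      have "norm (x - y) powr (n + b * r) = norm (x - y) powr (c * r) / norm (x - y) powr (\<sigma> - n)"
        by (simp add: \<sigma>_def algebra_simps flip: powr_diff)
      then show "ennreal (\<bar>u x - u y\<bar> powr r / norm (x - y) powr (n + b * r)) = h (x, y) * f (x, y)"
        by (simp add: h_def f_def flip: ennreal_mult)
    qed
    also have "\<dots> = (\<integral>\<^sup>+p. f p \<partial>N)"
      unfolding N_def by (rule nn_integral_density[symmetric]) measurable
    finally have e: "energy b r u = (\<integral>\<^sup>+p. f p \<partial>N)" .
    have "energy b r u \<up> (q / r) \<le> ennreal K * (\<integral>\<^sup>+p. f p \<up> (q / r) \<partial>N)"
      unfolding e K_def by (intro nn_integral_epowr_le N m) (use r in \<open>auto simp: N_def\<close>)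
    also have "(\<integral>\<^sup>+p. f p \<up> (q / r) \<partial>N) = (\<integral>\<^sup>+p. h p * f p \<up> (q / r) \<partial>(M \<Otimes>\<^sub>M M))"
      unfolding N_def by (rule nn_integral_density) measurable
    also have "\<dots> \<le> (\<integral>\<^sup>+p. ennreal L * (case p of (x, y) \<Rightarrow> ennreal (\<bar>u x - u y\<bar> powr q / norm (x - y) powr (n + a * q))) \<partial>(M \<Otimes>\<^sub>M M))"
    proof (intro nn_integral_mono)
      fix p :: "'a \<times> 'a" assume p: "p \<in> space (M \<Otimes>\<^sub>M M)"
      obtain x y where xy: "p = (x, y)" by (cases p)
      show "h p * f p \<up> (q / r) \<le> ennreal L * (case p of (x, y) \<Rightarrow> ennreal (\<bar>u x - u y\<bar> powr q / norm (x - y) powr (n + a * q)))"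
      proof (cases "x = y")
        case True
        then show ?thesis by (simp add: xy h_def)
      next
        case False
        define d where "d = norm (x - y)"
        have d: "0 < d" "d \<le> D" using False dist_le_D[of x y] p by (auto simp: d_def xy space_pair_measure dist_norm)
        have "h p * f p \<up> (q / r) = ennreal (d powr (\<sigma> - n) * (\<bar>u x - u y\<bar> powr q / d powr (c * q)))"
          using r by (simp add: xy h_def f_def epowr_ennreal powr_divide powr_powr d_def flip: ennreal_mult)
        also have "d powr (\<sigma> - n) * (\<bar>u x - u y\<bar> powr q / d powr (c * q)) = d powr ((a - c) * q + \<sigma>) * (\<bar>u x - u y\<bar> powr q / d powr (n + a * q))"
        proof -
          have "d powr ((a - c) * q + \<sigma>) / d powr (n + a * q) = d powr (\<sigma> - n) / d powr (c * q)"
            by (simp add: algebra_simps flip: powr_diff)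
          then show ?thesis by (simp add: divide_inverse mult_ac)
        qed
        also have "\<dots> \<le> L * (\<bar>u x - u y\<bar> powr q / d powr (n + a * q))"
          using d c r \<sigma> unfolding L_def by (intro mult_right_mono powr_mono2) auto
        finally show ?thesis
          by (simp add: xy d_def L_def ennreal_leI flip: ennreal_mult)
      qed
    qed
    also have "\<dots> = ennreal L * energy a q u"
      unfolding energy_def by (intro nn_integral_cmult) measurable
    finally have "energy b r u \<up> (q / r) \<le> ennreal K * (ennreal L * energy a q u)"
      by (simp add: mult_left_mono)
    also have "\<dots> = ennreal (K * L) * energy a q u"
      by (simp add: K_def L_def ennreal_mult mult.assoc)
    finally have "energy b r u \<le> (ennreal (K * L) * energy a q u) \<up> (r / q)"
      using r by (simp add: epowr_le_iff)
    then show ?thesis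
      by (simp add: epowr_mult epowr_ennreal K_def L_def)
  qed
  then show ?thesis by blast
qed

text \<open>An inequality of Poincare type: \<open>u x\<close> is the mean over y of
  \<open>u x - u y\<close> plus the mean of u. Since all distances are at most D, the energy
  dominates the first part, and the second one is a constant controlled by the exponent q. Higher
  integrability of u is thus read off from its energy.\<close>

lemma nn_integral_powr_le_energy:
  assumes b: "0 \<le> b" and q: "1 \<le> q" and r: "1 \<le> r"
  shows "\<exists>C. \<forall>u. u \<in> borel_measurable M \<longrightarrow> (\<integral>\<^sup>+x. ennreal (\<bar>u x\<bar> powr r) \<partial>M) \<le>
    ennreal C * (energy b r u + (\<integral>\<^sup>+x. ennreal (\<bar>u x\<bar> powr q) \<partial>M) \<up> (r / q))"
proof -
  define m where "m = measure M (space M)"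
  define K where "K = 2 powr r * m powr (r - 1) * D powr (n + b * r)"
  define L where "L = (2 powr q * m powr (q - 1)) powr (r / q) * m"
  define d where "d = c0 * D powr n"
  have d: "0 < d" using c0_pos D_pos by (simp add: d_def)
  define C where "C = (1 / d) powr r * (2 powr r * max K L)"
  have m: "0 \<le> m" "emeasure M (space M) = ennreal m" by (auto simp: m_def emeasure_eq_measure)
  have L: "0 \<le> L" using m by (simp add: L_def)
  have "(\<integral>\<^sup>+x. ennreal (\<bar>u x\<bar> powr r) \<partial>M) \<le> ennreal C * (energy b r u + (\<integral>\<^sup>+x. ennreal (\<bar>u x\<bar> powr q) \<partial>M) \<up> (r / q))"
    if [measurable]: "u \<in> borel_measurable M" for u
  proof -
    define I where "I = (\<integral>\<^sup>+y. ennreal \<bar>u y\<bar> \<partial>M)"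
    have I: "I \<up> r \<le> ennreal ((2 powr q * m powr (q - 1)) powr (r / q)) * (\<integral>\<^sup>+x. ennreal (\<bar>u x\<bar> powr q) \<partial>M) \<up> (r / q)"
    proof -
      have "I \<up> q \<le> ennreal (2 powr q * m powr (q - 1)) * (\<integral>\<^sup>+x. ennreal \<bar>u x\<bar> \<up> q \<partial>M)"
        unfolding I_def using m q by (intro nn_integral_epowr_le) auto
      then have "(I \<up> q) \<up> (r / q) \<le> (ennreal (2 powr q * m powr (q - 1)) * (\<integral>\<^sup>+x. ennreal \<bar>u x\<bar> \<up> q \<partial>M)) \<up> (r / q)"
        using q r by (intro epowr_mono) auto
      then show ?thesis
        using q by (simp add: epowr_epowr epowr_mult epowr_ennreal)
    qed
    have pt: "ennreal (\<bar>u x\<bar> powr r) \<le> ennreal ((1 / d) powr r * 2 powr r) *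
        (ennreal K * (\<integral>\<^sup>+y. ennreal (\<bar>u x - u y\<bar> powr r / norm (x - y) powr (n + b * r)) \<partial>M) + I \<up> r)" if x: "x \<in> space M" for x
    proof -
      \<comment> \<open>The lower bound for the total mass is the measure of the ball of radius D
        around x. On an empty space no such x exists and both integrals vanish, so \<open>d\<close>
        rather than \<open>m\<close> is used in the constants.\<close>
      have dm: "d \<le> m"
        using ball_lower[OF x D_pos order_refl] finite_measure_mono[of "{y \<in> space M. dist x y < D}" "space M"]
        by (auto simp: d_def m_def)
      have "ennreal d * ennreal \<bar>u x\<bar> \<le> ennreal m * ennreal \<bar>u x\<bar>"
        using dm by (intro mult_right_mono ennreal_leI) auto
      also have "\<dots> = (\<integral>\<^sup>+y. ennreal \<bar>u x\<bar> \<partial>M)"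
        by (simp add: m mult.commute)
      also have "\<dots> \<le> (\<integral>\<^sup>+y. ennreal \<bar>u x - u y\<bar> + ennreal \<bar>u y\<bar> \<partial>M)"
        by (intro nn_integral_mono) (auto simp flip: ennreal_plus intro!: ennreal_leI)
      also have "\<dots> = (\<integral>\<^sup>+y. ennreal \<bar>u x - u y\<bar> \<partial>M) + I"
        unfolding I_def by (intro nn_integral_add) measurable
      finally have "(ennreal d * ennreal \<bar>u x\<bar>) \<up> r \<le> ((\<integral>\<^sup>+y. ennreal \<bar>u x - u y\<bar> \<partial>M) + I) \<up> r"
        using r by (intro epowr_mono) auto
      also have "\<dots> \<le> ennreal (2 powr r) * ((\<integral>\<^sup>+y. ennreal \<bar>u x - u y\<bar> \<partial>M) \<up> r + I \<up> r)"
        using r by (intro epowr_add_le) auto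
      also have "(\<integral>\<^sup>+y. ennreal \<bar>u x - u y\<bar> \<partial>M) \<up> r \<le> ennreal (2 powr r * m powr (r - 1)) * (\<integral>\<^sup>+y. ennreal \<bar>u x - u y\<bar> \<up> r \<partial>M)"
        using m r by (intro nn_integral_epowr_le) auto
      also have "(\<integral>\<^sup>+y. ennreal \<bar>u x - u y\<bar> \<up> r \<partial>M) \<le> (\<integral>\<^sup>+y. ennreal (D powr (n + b * r)) * ennreal (\<bar>u x - u y\<bar> powr r / norm (x - y) powr (n + b * r)) \<partial>M)"
      proof (intro nn_integral_mono)
        fix y assume y: "y \<in> space M"
        show "ennreal \<bar>u x - u y\<bar> \<up> r \<le> ennreal (D powr (n + b * r)) * ennreal (\<bar>u x - u y\<bar> powr r / norm (x - y) powr (n + b * r))"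
        proof (cases "x = y")
          case False
          have "norm (x - y) powr (n + b * r) \<le> D powr (n + b * r)"
            using dist_le_D[OF x y] n_pos b r by (intro powr_mono2) (auto simp: dist_norm)
          then have "\<bar>u x - u y\<bar> powr r * 1 \<le> \<bar>u x - u y\<bar> powr r * (D powr (n + b * r) / norm (x - y) powr (n + b * r))"
            using False by (intro mult_left_mono) auto
          then show ?thesis
            by (auto simp: epowr_ennreal mult.commute simp flip: ennreal_mult intro!: ennreal_leI)
        qed (simp add: epowr_ennreal)
      qed
      also have "\<dots> = ennreal (D powr (n + b * r)) * (\<integral>\<^sup>+y. ennreal (\<bar>u x - u y\<bar> powr r / norm (x - y) powr (n + b * r)) \<partial>M)"
        by (intro nn_integral_cmult) measurable
      finally have *: "ennreal (d powr r * \<bar>u x\<bar> powr r) \<le> ennreal (2 powr r) *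
          (ennreal K * (\<integral>\<^sup>+y. ennreal (\<bar>u x - u y\<bar> powr r / norm (x - y) powr (n + b * r)) \<partial>M) + I \<up> r)"
        using d by (simp add: K_def epowr_mult epowr_ennreal ennreal_mult mult.assoc add_mono mult_left_mono)
      have "ennreal (\<bar>u x\<bar> powr r) = ennreal ((1 / d) powr r) * ennreal (d powr r * \<bar>u x\<bar> powr r)"
        using d by (simp add: powr_divide flip: ennreal_mult)
      also have "\<dots> \<le> ennreal ((1 / d) powr r) * (ennreal (2 powr r) *
          (ennreal K * (\<integral>\<^sup>+y. ennreal (\<bar>u x - u y\<bar> powr r / norm (x - y) powr (n + b * r)) \<partial>M) + I \<up> r))"
        by (intro mult_left_mono *) auto
      finally show ?thesis by (simp add: ennreal_mult mult.assoc)
    qed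
    have "(\<integral>\<^sup>+x. ennreal (\<bar>u x\<bar> powr r) \<partial>M) \<le> (\<integral>\<^sup>+x. ennreal ((1 / d) powr r * 2 powr r) *
        (ennreal K * (\<integral>\<^sup>+y. ennreal (\<bar>u x - u y\<bar> powr r / norm (x - y) powr (n + b * r)) \<partial>M) + I \<up> r) \<partial>M)"
      by (intro nn_integral_mono pt)
    also have "\<dots> = ennreal ((1 / d) powr r * 2 powr r) * (ennreal K *
        (\<integral>\<^sup>+x. \<integral>\<^sup>+y. ennreal (\<bar>u x - u y\<bar> powr r / norm (x - y) powr (n + b * r)) \<partial>M \<partial>M) + I \<up> r * ennreal m)"
      by (subst nn_integral_cmult, measurable, subst nn_integral_add, measurable, subst nn_integral_cmult, measurable) (simp add: m)
    also have "(\<integral>\<^sup>+x. \<integral>\<^sup>+y. ennreal (\<bar>u x - u y\<bar> powr r / norm (x - y) powr (n + b * r)) \<partial>M \<partial>M) = energy b r u"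
      unfolding energy_def by (subst nn_integral_fst[symmetric]) auto
    also have "ennreal K * energy b r u + I \<up> r * ennreal m \<le>
      ennreal (max K L) * energy b r u + ennreal (max K L) * (\<integral>\<^sup>+x. ennreal (\<bar>u x\<bar> powr q) \<partial>M) \<up> (r / q)"
    proof (intro add_mono)
      show "ennreal K * energy b r u \<le> ennreal (max K L) * energy b r u"
        by (intro mult_right_mono ennreal_leI) auto
      have "I \<up> r * ennreal m \<le> ennreal ((2 powr q * m powr (q - 1)) powr (r / q)) * (\<integral>\<^sup>+x. ennreal (\<bar>u x\<bar> powr q) \<partial>M) \<up> (r / q) * ennreal m"
        by (intro mult_right_mono I) auto
      also have "\<dots> = ennreal L * (\<integral>\<^sup>+x. ennreal (\<bar>u x\<bar> powr q) \<partial>M) \<up> (r / q)"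
        using m by (simp add: L_def ennreal_mult mult_ac)
      also have "\<dots> \<le> ennreal (max K L) * (\<integral>\<^sup>+x. ennreal (\<bar>u x\<bar> powr q) \<partial>M) \<up> (r / q)"
        by (intro mult_right_mono ennreal_leI) auto
      finally show "I \<up> r * ennreal m \<le> ennreal (max K L) * (\<integral>\<^sup>+x. ennreal (\<bar>u x\<bar> powr q) \<partial>M) \<up> (r / q)" .
    qed
    finally have "(\<integral>\<^sup>+x. ennreal (\<bar>u x\<bar> powr r) \<partial>M) \<le> ennreal ((1 / d) powr r * 2 powr r) *
      (ennreal (max K L) * energy b r u + ennreal (max K L) * (\<integral>\<^sup>+x. ennreal (\<bar>u x\<bar> powr q) \<partial>M) \<up> (r / q))"
      by (simp add: mult_left_mono)
    also have "\<dots> = ennreal C * (energy b r u + (\<integral>\<^sup>+x. ennreal (\<bar>u x\<bar> powr q) \<partial>M) \<up> (r / q))"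
      using L by (simp add: C_def ennreal_mult max_def mult.assoc distrib_left)
    finally show ?thesis .
  qed
  then show ?thesis by blast
qed

section \<open>Potentials of order one and their sum over the scales\<close>

text \<open>The two arguments of the minimum balance, up to constants, at the scale G / g. Below it
  the first bound leaves the power \<open>r - n\<close> of the scale, above it the second one leaves
  \<open>- (n - 1)\<close>. Both sums are geometric, the second because of \<open>1 < n\<close>; in
  dimension one all large scales would contribute alike.\<close>

lemma sum_scale_min_le:
  assumes n: "1 < n" and r: "n < r" and ab: "0 \<le> \<alpha>" "0 \<le> \<beta>"
  shows "\<exists>C\<ge>0. \<forall>g>0. \<forall>G>0. (\<Sum>j. ennreal (scale j powr (r - n) * (min (\<alpha> * g) (\<beta> * G / scale j)) powr (r - 1))) \<le>
    ennreal (C * g powr (n - 1) * G powr (r - n))"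
proof -
  define K where "K = 1 / (1 - 2 powr - (r - n))"
  define L where "L = 1 / (1 - 2 powr - (n - 1))"
  have KL: "0 \<le> K" "0 \<le> L" using n r by (auto simp: K_def L_def powr_less_one less_imp_le)
  define C where "C = \<alpha> powr (r - 1) * K + \<beta> powr (r - 1) * L"
  have C: "0 \<le> C" using KL by (simp add: C_def)
  have "(\<Sum>j. ennreal (scale j powr (r - n) * (min (\<alpha> * g) (\<beta> * G / scale j)) powr (r - 1))) \<le>
    ennreal (C * g powr (n - 1) * G powr (r - n))" if gG: "0 < g" "0 < G" for g G
  proof -
    define d where "d = G / g"
    have d: "0 < d" using gG by (simp add: d_def)
    have le: "scale j powr (r - n) * (min (\<alpha> * g) (\<beta> * G / scale j)) powr (r - 1) \<le>
      (\<alpha> * g) powr (r - 1) * (if scale j \<le> d then scale j powr (r - n) else 0) +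
      (\<beta> * G) powr (r - 1) * (if d < scale j then scale j powr - (n - 1) else 0)" for j
    proof (cases "scale j \<le> d")
      case True
      have "(min (\<alpha> * g) (\<beta> * G / scale j)) powr (r - 1) \<le> (\<alpha> * g) powr (r - 1)"
        using n r ab gG by (intro powr_mono2) auto
      then show ?thesis using True by (simp add: mult.commute mult_left_mono)
    next
      case False
      have "(min (\<alpha> * g) (\<beta> * G / scale j)) powr (r - 1) \<le> (\<beta> * G / scale j) powr (r - 1)"
        using n r ab gG by (intro powr_mono2) auto
      then have "scale j powr (r - n) * (min (\<alpha> * g) (\<beta> * G / scale j)) powr (r - 1) \<le>
        scale j powr (r - n) * ((\<beta> * G) powr (r - 1) / scale j powr (r - 1))"
        by (intro mult_left_mono) (auto simp: powr_divide)
      also have "\<dots> = (\<beta> * G) powr (r - 1) * (scale j powr (r - n) / scale j powr (r - 1))"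
        by simp
      also have "scale j powr (r - n) / scale j powr (r - 1) = scale j powr - (n - 1)"
        by (simp flip: powr_diff)
      finally show ?thesis using False by simp
    qed
    have "(\<Sum>j. ennreal (scale j powr (r - n) * (min (\<alpha> * g) (\<beta> * G / scale j)) powr (r - 1))) \<le>
      (\<Sum>j. ennreal ((\<alpha> * g) powr (r - 1)) * ennreal (if D / 2 ^ j \<le> d then (D / 2 ^ j) powr (r - n) else 0) +
        ennreal ((\<beta> * G) powr (r - 1)) * ennreal (if d < D / 2 ^ j then (D / 2 ^ j) powr - (n - 1) else 0))"
    proof (intro suminf_le)
      fix j
      show "ennreal (scale j powr (r - n) * (min (\<alpha> * g) (\<beta> * G / scale j)) powr (r - 1)) \<le>
        ennreal ((\<alpha> * g) powr (r - 1)) * ennreal (if D / 2 ^ j \<le> d then (D / 2 ^ j) powr (r - n) else 0) +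
        ennreal ((\<beta> * G) powr (r - 1)) * ennreal (if d < D / 2 ^ j then (D / 2 ^ j) powr - (n - 1) else 0)"
        unfolding scale_def[symmetric] using ennreal_leI[OF le[of j]]
        by (subst (asm) ennreal_plus) (auto simp: ennreal_mult simp del: minus_diff_eq)
    qed auto
    also have "\<dots> = ennreal ((\<alpha> * g) powr (r - 1)) * (\<Sum>j. ennreal (if D / 2 ^ j \<le> d then (D / 2 ^ j) powr (r - n) else 0)) +
        ennreal ((\<beta> * G) powr (r - 1)) * (\<Sum>j. ennreal (if d < D / 2 ^ j then (D / 2 ^ j) powr - (n - 1) else 0))"
      by (subst suminf_add[symmetric]) (auto simp only: ennreal_suminf_cmult summableI)
    also have "\<dots> \<le> ennreal ((\<alpha> * g) powr (r - 1)) * ennreal (K * d powr (r - n)) +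
        ennreal ((\<beta> * G) powr (r - 1)) * ennreal (L * d powr - (n - 1))"
      unfolding K_def L_def using n r d D_pos
      by (intro add_mono mult_left_mono sum_dyadic_le sum_dyadic_ge) auto
    also have "\<dots> = ennreal ((\<alpha> * g) powr (r - 1) * (K * d powr (r - n)) + (\<beta> * G) powr (r - 1) * (L * d powr - (n - 1)))"
      using KL by (simp add: ennreal_mult del: minus_diff_eq)
    also have "(\<alpha> * g) powr (r - 1) * (K * d powr (r - n)) = \<alpha> powr (r - 1) * K * (g powr (n - 1) * G powr (r - n))"
    proof -
      have "g powr (r - 1) * d powr (r - n) = (g powr (r - 1) / g powr (r - n)) * G powr (r - n)"
        using gG by (simp add: d_def powr_divide)
      also have "g powr (r - 1) / g powr (r - n) = g powr (n - 1)"
        by (simp flip: powr_diff)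
      finally show ?thesis by (simp add: powr_mult mult_ac)
    qed
    also have "(\<beta> * G) powr (r - 1) * (L * d powr - (n - 1)) = \<beta> powr (r - 1) * L * (g powr (n - 1) * G powr (r - n))"
    proof -
      have "d powr - (n - 1) = g powr (n - 1) / G powr (n - 1)"
        using gG unfolding powr_minus_divide by (simp add: d_def powr_divide)
      have "(\<beta> * G) powr (r - 1) * (L * d powr - (n - 1)) = \<beta> powr (r - 1) * L * (G powr (r - 1) * d powr - (n - 1))"
        by (simp only: powr_mult mult_ac)
      also have "G powr (r - 1) * d powr - (n - 1) = g powr (n - 1) * (G powr (r - 1) / G powr (n - 1))"
        using \<open>d powr - (n - 1) = _\<close> by simp
      also have "G powr (r - 1) / G powr (n - 1) = G powr (r - n)"
        by (simp flip: powr_diff)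
      finally show ?thesis .
    qed
    finally show ?thesis
      by (simp add: C_def distrib_right mult.assoc)
  qed
  with C show ?thesis by blast
qed

text \<open>Half of the average of \<open>g\<close> over a ball comes from points where \<open>g\<close> is at least a multiple of
  that average. This takes the place of a maximal function estimate.\<close>

lemma potential_scale_le:
  fixes g :: "'a \<Rightarrow> real" and K G :: real
  assumes n: "1 < n" and r: "n < r" and K: "0 < K"
    and [measurable]: "g \<in> borel_measurable M" and g: "\<And>x. 0 \<le> g x"
    and G: "0 < G" "(\<integral>\<^sup>+x. ennreal (g x powr n) \<partial>M) \<le> ennreal (G powr n)"
  defines "v \<equiv> (\<lambda>j x. ennreal (scale j powr - n) * (\<integral>\<^sup>+y. (if dist x y < K * scale j then ennreal (g y) else 0) \<partial>M))"
  shows "v j x \<up> r \<le> 2 * ennreal (scale j powr - n) * (\<integral>\<^sup>+y. (if dist x y < K * scale j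
    then ennreal (g y * min (2 * c1 * K powr n * g y) (2 * c1 powr ((n - 1) / n) * K powr (n - 1) * G / scale j) powr (r - 1)) else 0) \<partial>M)"
proof -
  define s where "s = scale j"
  define B where "B = ballM x (K * s)"
  define m where "m = c1 * (K * s) powr n"
  \<comment> \<open>Points of the ball where \<open>\<alpha> * g y < t\<close> contribute at most
    \<open>s powr - n * (t / \<alpha>) * m\<close> to the average t, and this choice of \<alpha>
    makes that \<open>t / 2\<close>.\<close>
  define \<alpha> where "\<alpha> = 2 * c1 * K powr n"
  define \<beta> where "\<beta> = 2 * c1 powr ((n - 1) / n) * K powr (n - 1)"
  have s: "0 < s" by (simp add: s_def)
  have m: "0 < m" using c1_pos K s by (simp add: m_def)
  have \<alpha>: "0 < \<alpha>" using c1_pos K by (simp add: \<alpha>_def)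
  have [measurable]: "B \<in> sets M" by (simp add: B_def)
  have mB: "emeasure M B \<le> ennreal m"
    using ball_upper[of "K * s" x] K s by (simp add: B_def ballM_def m_def emeasure_eq_measure ennreal_leI)
  have ind: "(\<integral>\<^sup>+y. (if dist x y < K * s then f y else 0) \<partial>M) = (\<integral>\<^sup>+y. f y * indicator B y \<partial>M)" for f
    by (intro nn_integral_cong) (auto simp: B_def ballM_def indicator_def)
  have v: "v j x = ennreal (s powr - n) * (\<integral>\<^sup>+y. ennreal (g y) * indicator B y \<partial>M)"
    unfolding v_def s_def[symmetric] ind ..
  \<comment> \<open>Jensen's inequality over the ball bounds the average by a multiple of
    \<open>G / s\<close>. In particular it is finite, which is needed to absorb half of it on the
    left side.\<close>
  have v_le: "v j x \<le> ennreal (\<beta> * G / s)"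
  proof -
    have "(\<integral>\<^sup>+y. ennreal (g y) * indicator B y \<partial>M) \<up> n \<le> ennreal (2 powr n * m powr (n - 1)) * (\<integral>\<^sup>+y. ennreal (g y) \<up> n * indicator B y \<partial>M)"
      using n m mB by (intro nn_integral_set_epowr_le) auto
    also have "(\<integral>\<^sup>+y. ennreal (g y) \<up> n * indicator B y \<partial>M) \<le> (\<integral>\<^sup>+y. ennreal (g y powr n) \<partial>M)"
      using g by (intro nn_integral_mono) (auto simp: epowr_ennreal indicator_def)
    also have "\<dots> \<le> ennreal (G powr n)" by (rule G)
    finally have "(\<integral>\<^sup>+y. ennreal (g y) * indicator B y \<partial>M) \<up> n \<le> ennreal (2 powr n * m powr (n - 1) * G powr n)"
      by (simp add: ennreal_mult mult_left_mono)
    then have "(\<integral>\<^sup>+y. ennreal (g y) * indicator B y \<partial>M) \<le> ennreal (2 powr n * m powr (n - 1) * G powr n) \<up> (1 / n)"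
      using n by (simp add: epowr_le_iff)
    also have "\<dots> = ennreal (2 * m powr ((n - 1) / n) * G)"
      using n G by (simp add: epowr_ennreal powr_mult powr_powr)
    finally have "v j x \<le> ennreal (s powr - n * (2 * m powr ((n - 1) / n) * G))"
      unfolding v using G by (simp add: ennreal_mult mult_left_mono)
    also have "s powr - n * (2 * m powr ((n - 1) / n) * G) = \<beta> * G / s"
    proof -
      have "m powr ((n - 1) / n) = c1 powr ((n - 1) / n) * K powr (n - 1) * s powr (n - 1)"
        using n by (simp add: m_def powr_mult powr_powr)
      then have "s powr - n * (2 * m powr ((n - 1) / n) * G) = \<beta> * G * (s powr - n * s powr (n - 1))"
        by (simp only: \<beta>_def mult_ac)
      also have "s powr - n * s powr (n - 1) = 1 / s"
        using s by (simp add: powr_neg_one flip: powr_add)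
      finally show ?thesis by simp
    qed
    finally show ?thesis .
  qed
  then obtain t where t: "v j x = ennreal t" "0 \<le> t" "t \<le> \<beta> * G / s"
  proof (cases "v j x")
    case (real t)
    moreover have "0 \<le> \<beta> * G / s" using G s by (simp add: \<beta>_def)
    ultimately show ?thesis using v_le that[of t] by simp
  qed (simp add: top_unique)
  define I where "I = (\<integral>\<^sup>+y. (if t \<le> \<alpha> * g y then ennreal (g y) else 0) * indicator B y \<partial>M)"
  have half: "ennreal t \<le> 2 * ennreal (s powr - n) * I"
  proof -
    have "ennreal t \<le> ennreal (s powr - n) * (\<integral>\<^sup>+y. (if t \<le> \<alpha> * g y then ennreal (g y) else 0) * indicator B y + ennreal (t / \<alpha>) * indicator B y \<partial>M)"
      unfolding t(1)[symmetric] v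
      using \<alpha> by (intro mult_left_mono nn_integral_mono)
        (auto simp: indicator_def field_simps intro!: ennreal_leI)
    also have "\<dots> = ennreal (s powr - n) * I + ennreal (s powr - n) * (ennreal (t / \<alpha>) * emeasure M B)"
      using \<open>B \<in> sets M\<close> unfolding I_def
      by (subst nn_integral_add) (auto simp: distrib_left nn_integral_cmult_indicator)
    also have "\<dots> \<le> ennreal (s powr - n) * I + ennreal (s powr - n) * (ennreal (t / \<alpha>) * ennreal m)"
      by (intro add_left_mono mult_left_mono mB) auto
    also have "ennreal (s powr - n) * (ennreal (t / \<alpha>) * ennreal m) = ennreal (t / 2)"
    proof -
      have "s powr - n * (t / \<alpha> * m) = t / 2"
        using \<alpha> s K c1_pos by (simp add: m_def \<alpha>_def powr_mult powr_minus_divide)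
      then show ?thesis
        using t \<alpha> m by (simp flip: ennreal_mult)
    qed
    finally have le: "ennreal t \<le> ennreal (s powr - n) * I + ennreal (t / 2)" .
    show ?thesis
    proof (cases "ennreal (s powr - n) * I")
      case (real z)
      then have "t \<le> z + t / 2"
        using le t by (simp flip: ennreal_plus)
      then have "ennreal t \<le> ennreal (2 * z)" by (intro ennreal_leI) simp
      then show ?thesis using real by (simp add: ennreal_mult mult.assoc)
    next
      case top
      then show ?thesis by (simp add: mult.assoc ennreal_mult_top)
    qed
  qed
  \<comment> \<open>One of the r powers of t is replaced by the integral over the large values of g.
    In the remaining \<open>r - 1\<close> powers t is below \<open>\<alpha> * g y\<close> at the
    points kept and below \<open>\<beta> * G / s\<close> everywhere, hence below the
    minimum.\<close>
  have "v j x \<up> r = ennreal (t powr (r - 1)) * ennreal t"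
    using t n r by (cases "t = 0") (auto simp: epowr_ennreal powr_diff simp flip: ennreal_mult)
  also have "\<dots> \<le> ennreal (t powr (r - 1)) * (2 * ennreal (s powr - n) * I)"
    by (intro mult_left_mono half) auto
  also have "\<dots> = 2 * ennreal (s powr - n) * (ennreal (t powr (r - 1)) * I)"
    by (simp only: mult_ac)
  also have "ennreal (t powr (r - 1)) * I = (\<integral>\<^sup>+y. ennreal (t powr (r - 1)) * ((if t \<le> \<alpha> * g y then ennreal (g y) else 0) * indicator B y) \<partial>M)"
    unfolding I_def by (intro nn_integral_cmult[symmetric]) measurable
  also have "\<dots> \<le> (\<integral>\<^sup>+y. ennreal (g y * min (\<alpha> * g y) (\<beta> * G / s) powr (r - 1)) * indicator B y \<partial>M)"
  proof (intro nn_integral_mono)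
    fix y
    show "ennreal (t powr (r - 1)) * ((if t \<le> \<alpha> * g y then ennreal (g y) else 0) * indicator B y) \<le>
      ennreal (g y * min (\<alpha> * g y) (\<beta> * G / s) powr (r - 1)) * indicator B y"
    proof (cases "t \<le> \<alpha> * g y \<and> y \<in> B")
      case True
      then have "t powr (r - 1) \<le> min (\<alpha> * g y) (\<beta> * G / s) powr (r - 1)"
        using t n r by (intro powr_mono2) auto
      then have "t powr (r - 1) * g y \<le> g y * min (\<alpha> * g y) (\<beta> * G / s) powr (r - 1)"
        using g by (simp add: mult.commute mult_left_mono)
      then show ?thesis
        using True g by (simp add: ennreal_leI flip: ennreal_mult)
    qed auto
  qed
  finally show ?thesis
    unfolding s_def[symmetric] ind \<alpha>_def \<beta>_def by (simp add: mult_left_mono)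
qed

text \<open>The weights are those of \<open>energy_le_of_telescope\<close> for an order b with
  \<open>b * r = n\<close>, so this is the potential estimate behind the step from a gradient in
  \<open>L\<^sup>n\<close> to a fractional order. After the level set bound Fubini moves the sum
  over the scales to a fixed y, where it yields \<open>g y powr (n - 1)\<close> and, with the
  remaining factor \<open>g y\<close>, the integrand \<open>g y powr n\<close>.\<close>

theorem potential_embedding:
  assumes n: "1 < n" and r: "n < r" and K: "0 < K"
  shows "\<exists>C\<ge>0. \<forall>g :: 'a \<Rightarrow> real. g \<in> borel_measurable M \<longrightarrow> (\<forall>x. 0 \<le> g x) \<longrightarrow>
    (\<Sum>j. ennreal (scale j powr - n) * (\<integral>\<^sup>+x. (ennreal (scale j powr (1 - n)) *
      (\<integral>\<^sup>+y. (if dist x y < K * scale j then ennreal (g y) else 0) \<partial>M)) \<up> r \<partial>M)) \<le>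
    ennreal C * (\<integral>\<^sup>+x. ennreal (g x powr n) \<partial>M) \<up> (r / n)"
proof -
  define \<alpha> where "\<alpha> = 2 * c1 * K powr n"
  define \<beta> where "\<beta> = 2 * c1 powr ((n - 1) / n) * K powr (n - 1)"
  have "0 \<le> \<alpha>" "0 \<le> \<beta>" using c1_pos K by (auto simp: \<alpha>_def \<beta>_def)
  then obtain S where S: "0 \<le> S" "\<And>g G. 0 < g \<Longrightarrow> 0 < G \<Longrightarrow> (\<Sum>j. ennreal (scale j powr (r - n) * (min (\<alpha> * g) (\<beta> * G / scale j)) powr (r - 1))) \<le>
    ennreal (S * g powr (n - 1) * G powr (r - n))"
    using sum_scale_min_le[OF n r, of \<alpha> \<beta>] by blast
  define m where "m = 2 * (c1 * 2 powr n * K powr n)"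
  have m: "0 \<le> m" using c1_pos by (simp add: m_def)
  define C where "C = m * S + 1"
  have C: "0 < C" using m S by (simp add: C_def add_nonneg_pos)
  have "(\<Sum>j. ennreal (scale j powr - n) * (\<integral>\<^sup>+x. (ennreal (scale j powr (1 - n)) *
      (\<integral>\<^sup>+y. (if dist x y < K * scale j then ennreal (g y) else 0) \<partial>M)) \<up> r \<partial>M)) \<le>
    ennreal C * (\<integral>\<^sup>+x. ennreal (g x powr n) \<partial>M) \<up> (r / n)"
    if [measurable]: "g \<in> borel_measurable M" and g: "\<And>x. 0 \<le> g x" for g :: "'a \<Rightarrow> real"
  proof -
    \<comment> \<open>The sum over the scales requires a norm G that is positive and finite; the two
      degenerate values are settled directly.\<close>
    consider "(\<integral>\<^sup>+x. ennreal (g x powr n) \<partial>M) = top" | "(\<integral>\<^sup>+x. ennreal (g x powr n) \<partial>M) = 0"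
      | e where "(\<integral>\<^sup>+x. ennreal (g x powr n) \<partial>M) = ennreal e" "0 < e"
      by (cases "\<integral>\<^sup>+x. ennreal (g x powr n) \<partial>M") (auto simp: order_le_less)
    then show ?thesis
    proof cases
      case 1
      then show ?thesis using C by (simp add: ennreal_mult_top)
    next
      case 2
      then have "AE x in M. ennreal (g x powr n) = 0"
        by (subst (asm) nn_integral_0_iff_AE) auto
      then have ae: "AE y in M. g y = 0"
        by (rule AE_mp) (use n g in \<open>auto intro!: AE_I2 simp: ennreal_eq_0_iff dest: spec\<close>)
      have "(\<integral>\<^sup>+y. (if dist x y < K * scale j then ennreal (g y) else 0) \<partial>M) = 0" for x j
      proof -
        have "AE y in M. (if dist x y < K * scale j then ennreal (g y) else 0) = 0"
          using ae by eventually_elim simp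
        then show ?thesis
          by (subst nn_integral_0_iff_AE) auto
      qed
      then show ?thesis by simp
    next
      case 3
      define G where "G = e powr (1 / n)"
      have G: "0 < G" "G powr n = e" using 3 n by (auto simp: G_def powr_powr)
      have Gn: "(\<integral>\<^sup>+x. ennreal (g x powr n) \<partial>M) = ennreal (G powr n)"
        using 3 G by simp
      define h where "h j y = g y * min (\<alpha> * g y) (\<beta> * G / scale j) powr (r - 1)" for j y
      have h0: "0 \<le> h j y" for j y using g by (simp add: h_def)
      have [measurable]: "h j \<in> borel_measurable M" for j unfolding h_def by measurable
      have step: "(\<integral>\<^sup>+x. (ennreal (scale j powr (1 - n)) * (\<integral>\<^sup>+y. (if dist x y < K * scale j then ennreal (g y) else 0) \<partial>M)) \<up> r \<partial>M) \<le>
        ennreal (scale j powr r * m) * (\<integral>\<^sup>+y. ennreal (h j y) \<partial>M)" for j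
      proof -
        define s where "s = scale j"
        have s: "0 < s" by (simp add: s_def)
        have "(\<integral>\<^sup>+x. (ennreal (s powr (1 - n)) * (\<integral>\<^sup>+y. (if dist x y < K * s then ennreal (g y) else 0) \<partial>M)) \<up> r \<partial>M) \<le>
          (\<integral>\<^sup>+x. ennreal (s powr r) * (2 * ennreal (s powr - n) * (\<integral>\<^sup>+y. (if dist x y < K * s then ennreal (h j y) else 0) \<partial>M)) \<partial>M)"
        proof (intro nn_integral_mono)
          fix x
          have "ennreal (s powr (1 - n)) = ennreal s * ennreal (s powr - n)"
            using s by (simp add: powr_diff powr_minus_divide flip: ennreal_mult)
          then have "(ennreal (s powr (1 - n)) * (\<integral>\<^sup>+y. (if dist x y < K * s then ennreal (g y) else 0) \<partial>M)) \<up> r =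
            ennreal (s powr r) * (ennreal (s powr - n) * (\<integral>\<^sup>+y. (if dist x y < K * s then ennreal (g y) else 0) \<partial>M)) \<up> r"
            using s by (simp add: mult.assoc epowr_mult epowr_ennreal)
          also have "\<dots> \<le> ennreal (s powr r) * (2 * ennreal (s powr - n) * (\<integral>\<^sup>+y. (if dist x y < K * s then ennreal (h j y) else 0) \<partial>M))"
            unfolding s_def h_def \<alpha>_def \<beta>_def
            by (intro mult_left_mono potential_scale_le n r K g G) (auto simp: Gn)
          finally show "(ennreal (s powr (1 - n)) * (\<integral>\<^sup>+y. (if dist x y < K * s then ennreal (g y) else 0) \<partial>M)) \<up> r \<le>
            ennreal (s powr r) * (2 * ennreal (s powr - n) * (\<integral>\<^sup>+y. (if dist x y < K * s then ennreal (h j y) else 0) \<partial>M))" .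
        qed
        also have "\<dots> = ennreal (s powr r) * (2 * ennreal (s powr - n)) * (\<integral>\<^sup>+x. \<integral>\<^sup>+y. (if dist x y < K * s then ennreal (h j y) else 0) \<partial>M \<partial>M)"
          unfolding mult.assoc[symmetric] by (intro nn_integral_cmult) measurable
        also have "(\<integral>\<^sup>+x. \<integral>\<^sup>+y. (if dist x y < K * s then ennreal (h j y) else 0) \<partial>M \<partial>M) =
          (\<integral>\<^sup>+y. \<integral>\<^sup>+x. (if dist x y < K * s then ennreal (h j y) else 0) \<partial>M \<partial>M)"
          by (rule MM.Fubini'[symmetric]) measurable
        also have "\<dots> \<le> (\<integral>\<^sup>+y. ennreal (h j y) * ennreal (c1 * 2 powr n * (K * s) powr n) \<partial>M)"
        proof (intro nn_integral_mono)
          fix y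
          have "(\<integral>\<^sup>+x. (if dist x y < K * s then ennreal (h j y) else 0) \<partial>M) \<le>
            (\<integral>\<^sup>+x. ennreal (h j y) * indicator {x \<in> space M. dist y x \<le> K * s} x \<partial>M)"
            by (intro nn_integral_mono) (auto simp: indicator_def dist_commute)
          also have "\<dots> = ennreal (h j y) * (\<integral>\<^sup>+x. indicator {x \<in> space M. dist y x \<le> K * s} x \<partial>M)"
            by (intro nn_integral_cmult) measurable
          also have "\<dots> \<le> ennreal (h j y) * ennreal (c1 * 2 powr n * (K * s) powr n)"
            using K s by (intro mult_left_mono ball_upper_le) auto
          finally show "(\<integral>\<^sup>+x. (if dist x y < K * s then ennreal (h j y) else 0) \<partial>M) \<le> ennreal (h j y) * ennreal (c1 * 2 powr n * (K * s) powr n)" .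
        qed
        also have "\<dots> = (\<integral>\<^sup>+y. ennreal (h j y) \<partial>M) * ennreal (c1 * 2 powr n * (K * s) powr n)"
          by (intro nn_integral_multc) measurable
        finally have "(\<integral>\<^sup>+x. (ennreal (s powr (1 - n)) * (\<integral>\<^sup>+y. (if dist x y < K * s then ennreal (g y) else 0) \<partial>M)) \<up> r \<partial>M) \<le>
          ennreal (s powr r) * (2 * ennreal (s powr - n)) * ((\<integral>\<^sup>+y. ennreal (h j y) \<partial>M) * ennreal (c1 * 2 powr n * (K * s) powr n))"
          by (simp add: mult_left_mono)
        also have "\<dots> = ennreal (s powr r) * (ennreal 2 * (ennreal (s powr - n) * ennreal (c1 * 2 powr n * (K * s) powr n))) * (\<integral>\<^sup>+y. ennreal (h j y) \<partial>M)"
          by (simp add: mult_ac)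
        also have "ennreal 2 * (ennreal (s powr - n) * ennreal (c1 * 2 powr n * (K * s) powr n)) = ennreal m"
        proof -
          have "s powr - n * (c1 * 2 powr n * (K * s) powr n) = c1 * 2 powr n * K powr n"
            using s by (simp add: powr_mult powr_minus_divide)
          then show ?thesis
            using c1_pos by (simp add: m_def del: ennreal_numeral flip: ennreal_mult)
        qed
        finally show ?thesis
          using m unfolding s_def by (simp add: ennreal_mult)
      qed
      have "(\<Sum>j. ennreal (scale j powr - n) * (\<integral>\<^sup>+x. (ennreal (scale j powr (1 - n)) *
          (\<integral>\<^sup>+y. (if dist x y < K * scale j then ennreal (g y) else 0) \<partial>M)) \<up> r \<partial>M)) \<le>
        (\<Sum>j. ennreal m * (\<integral>\<^sup>+y. ennreal (scale j powr (r - n) * h j y) \<partial>M))"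
      proof (intro suminf_le)
        fix j
        have "ennreal (scale j powr - n) * (\<integral>\<^sup>+x. (ennreal (scale j powr (1 - n)) *
          (\<integral>\<^sup>+y. (if dist x y < K * scale j then ennreal (g y) else 0) \<partial>M)) \<up> r \<partial>M) \<le>
          ennreal (scale j powr - n) * (ennreal (scale j powr r * m) * (\<integral>\<^sup>+y. ennreal (h j y) \<partial>M))"
          by (intro mult_left_mono step) auto
        also have "\<dots> = ennreal m * (ennreal (scale j powr (r - n)) * (\<integral>\<^sup>+y. ennreal (h j y) \<partial>M))"
          using m by (simp add: ennreal_mult powr_diff powr_minus_divide divide_inverse mult_ac)
        also have "ennreal (scale j powr (r - n)) * (\<integral>\<^sup>+y. ennreal (h j y) \<partial>M) = (\<integral>\<^sup>+y. ennreal (scale j powr (r - n) * h j y) \<partial>M)"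
          using h0 by (subst nn_integral_cmult[symmetric]) (auto simp: ennreal_mult)
        finally show "ennreal (scale j powr - n) * (\<integral>\<^sup>+x. (ennreal (scale j powr (1 - n)) *
          (\<integral>\<^sup>+y. (if dist x y < K * scale j then ennreal (g y) else 0) \<partial>M)) \<up> r \<partial>M) \<le>
          ennreal m * (\<integral>\<^sup>+y. ennreal (scale j powr (r - n) * h j y) \<partial>M)" .
      qed auto
      also have "\<dots> = ennreal m * (\<Sum>j. \<integral>\<^sup>+y. ennreal (scale j powr (r - n) * h j y) \<partial>M)"
        by (rule ennreal_suminf_cmult)
      also have "(\<Sum>j. \<integral>\<^sup>+y. ennreal (scale j powr (r - n) * h j y) \<partial>M) = (\<integral>\<^sup>+y. (\<Sum>j. ennreal (scale j powr (r - n) * h j y)) \<partial>M)"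
        by (rule nn_integral_suminf[symmetric]) measurable
      also have "\<dots> \<le> (\<integral>\<^sup>+y. ennreal (S * G powr (r - n)) * ennreal (g y powr n) \<partial>M)"
      proof (intro nn_integral_mono)
        fix y
        show "(\<Sum>j. ennreal (scale j powr (r - n) * h j y)) \<le> ennreal (S * G powr (r - n)) * ennreal (g y powr n)"
        proof (cases "g y = 0")
          case False
          then have gy: "0 < g y" using g[of y] by simp
          have "(\<Sum>j. ennreal (scale j powr (r - n) * h j y)) =
            (\<Sum>j. ennreal (g y) * ennreal (scale j powr (r - n) * (min (\<alpha> * g y) (\<beta> * G / scale j)) powr (r - 1)))"
            using gy by (intro suminf_cong) (simp add: h_def mult_ac flip: ennreal_mult)
          also have "\<dots> = ennreal (g y) * (\<Sum>j. ennreal (scale j powr (r - n) * (min (\<alpha> * g y) (\<beta> * G / scale j)) powr (r - 1)))"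
            by (rule ennreal_suminf_cmult)
          also have "\<dots> \<le> ennreal (g y) * ennreal (S * g y powr (n - 1) * G powr (r - n))"
            by (intro mult_left_mono S gy G) auto
          also have "\<dots> = ennreal (S * G powr (r - n)) * ennreal (g y powr n)"
            using gy S by (simp add: powr_diff flip: ennreal_mult)
          finally show ?thesis .
        qed (simp add: h_def)
      qed
      also have "\<dots> = ennreal (S * G powr (r - n)) * ennreal (G powr n)"
        by (subst nn_integral_cmult) (auto simp: Gn)
      also have "ennreal m * (ennreal (S * G powr (r - n)) * ennreal (G powr n)) = ennreal (m * S * G powr r)"
        using m S by (simp add: mult.assoc flip: ennreal_mult powr_add)
      also have "\<dots> \<le> ennreal (C * G powr r)"
        by (intro ennreal_leI mult_right_mono) (auto simp: C_def)
      also have "\<dots> = ennreal C * (\<integral>\<^sup>+x. ennreal (g x powr n) \<partial>M) \<up> (r / n)"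
        using n C by (simp add: Gn epowr_ennreal powr_powr ennreal_mult)
      finally show ?thesis
        by (simp add: mult_left_mono)
    qed
  qed
  with C show ?thesis by (intro exI[of _ C]) auto
qed

end

section \<open>Smooth averaging kernels and weak gradients\<close>

lemma C_k_SucI:
  assumes "\<And>x. (f has_derivative f' x) (at x)" "\<And>e. e \<in> Basis \<Longrightarrow> C_k k (\<lambda>x. f' x e)"
  shows "C_k (Suc k) f"
proof -
  have "frechet_derivative f (at x) = f' x" for x
    using frechet_derivative_at[OF assms(1)] by simp
  moreover have "f differentiable (at x)" for x
    using assms(1) unfolding differentiable_def by blast
  ultimately show ?thesis using assms(2) by simp
qed

lemma C_k_SucD:
  assumes "C_k (Suc k) f"
  shows "(f has_derivative frechet_derivative f (at x)) (at x)" "e \<in> Basis \<Longrightarrow> C_k k (\<lambda>x. frechet_derivative f (at x) e)"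
  using assms by (auto simp flip: frechet_derivative_works)

lemma C_k_lower: "C_k (Suc k) f \<Longrightarrow> C_k k f"
proof (induction k arbitrary: f)
  case 0
  then show ?case
    by (auto intro!: continuous_at_imp_continuous_on differentiable_imp_continuous_within)
next
  case (Suc k)
  show ?case
    using C_k_SucD[OF Suc.prems] Suc.IH by (intro C_k_SucI) auto
qed

lemma C_k_const: "C_k k (\<lambda>x. c)"
  by (induction k arbitrary: c) (auto intro!: C_k_SucI[where f'="\<lambda>x e. 0"] simp del: C_k.simps(2))

lemma C_k_add: "C_k k f \<Longrightarrow> C_k k g \<Longrightarrow> C_k k (\<lambda>x. f x + g x)"
proof (induction k arbitrary: f g)
  case 0 then show ?case by (auto intro: continuous_on_add)
next
  case (Suc k)
  show ?case
    using C_k_SucD[OF Suc.prems(1)] C_k_SucD[OF Suc.prems(2)] Suc.IH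
    by (intro C_k_SucI[where f'="\<lambda>x e. frechet_derivative f (at x) e + frechet_derivative g (at x) e"] has_derivative_add) auto
qed

lemma C_k_mult: "C_k k f \<Longrightarrow> C_k k g \<Longrightarrow> C_k k (\<lambda>x. f x * g x)"
proof (induction k arbitrary: f g)
  case 0 then show ?case by (auto intro: continuous_on_mult)
next
  case (Suc k)
  show ?case
    using C_k_SucD[OF Suc.prems(1)] C_k_SucD[OF Suc.prems(2)] Suc.IH Suc.prems[THEN C_k_lower]
    by (intro C_k_SucI[where f'="\<lambda>x e. f x * frechet_derivative g (at x) e + frechet_derivative f (at x) e * g x"] has_derivative_mult C_k_add) auto
qed

lemma C_k_inner: "C_k k (\<lambda>x. x \<bullet> a)"
proof (cases k)
  case (Suc m)
  have "C_k (Suc m) (\<lambda>x. x \<bullet> a)"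
    by (rule C_k_SucI[where f'="\<lambda>x e. e \<bullet> a"]) (auto intro!: derivative_eq_intros C_k_const)
  then show ?thesis using Suc by simp
qed (auto intro!: continuous_intros)

lemma C_k_inner_affine: "C_k k (\<lambda>x. a + b * ((x - c) \<bullet> d))"
proof -
  have "C_k k (\<lambda>x. (a - b * (c \<bullet> d)) + b * (x \<bullet> d))"
    by (intro C_k_add C_k_mult C_k_const C_k_inner)
  then show ?thesis by (simp add: algebra_simps inner_diff_left)
qed

lemma C_k_inner_self: "C_k k (\<lambda>x. a + b * ((x - c) \<bullet> (x - c)))"
proof (cases k)
  case (Suc m)
  have "C_k (Suc m) (\<lambda>x. a + b * ((x - c) \<bullet> (x - c)))"
  proof (rule C_k_SucI[where f'="\<lambda>x e. 2 * b * ((x - c) \<bullet> e)"])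
    fix e :: 'a
    show "C_k m (\<lambda>x. 2 * b * ((x - c) \<bullet> e))"
      using C_k_inner_affine[of m 0 "2 * b" c e] by simp
  qed (auto intro!: derivative_eq_intros simp: inner_commute algebra_simps)
  then show ?thesis using Suc by simp
qed (auto intro!: continuous_intros)

text \<open>The derivative of a function of this form is again of this form.\<close>

definition flat :: "real poly \<Rightarrow> real \<Rightarrow> real" where
  "flat P x = (if 0 < x then poly P (1 / x) * exp (- (1 / x)) else 0)"

lemma poly_exp_tendsto_0: "((\<lambda>x::real. poly P x * exp (- x)) \<longlongrightarrow> 0) at_top"
proof -
  have "((\<lambda>x::real. \<Sum>i\<le>degree P. coeff P i * (x ^ i / exp x)) \<longlongrightarrow> (\<Sum>i\<le>degree P. coeff P i * 0)) at_top"
    by (intro tendsto_sum tendsto_mult tendsto_const tendsto_power_div_exp_0)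
  then show ?thesis
    by (simp add: poly_altdef sum_distrib_right exp_minus divide_inverse mult.assoc)
qed

text \<open>For x > 0 the chain rule gives the values of P - P' at 1 / x times the square of 1 / x,
  whence the factor \<open>[:0, 0, 1:]\<close>. At 0 the right difference quotient is a polynomial
  in 1 / y times \<open>exp (- (1 / y))\<close>, which tends to 0.\<close>

lemma has_real_derivative_flat:
  "(flat P has_real_derivative flat ([:0, 0, 1:] * (P - pderiv P)) x) (at x)"
proof -
  consider "0 < x" | "x < 0" | "x = 0" by linarith
  then show ?thesis
  proof cases
    case 1
    have "((\<lambda>x. poly P (1 / x) * exp (- (1 / x))) has_real_derivative flat ([:0, 0, 1:] * (P - pderiv P)) x) (at x)"
      using 1 by (auto intro!: derivative_eq_intros simp: flat_def power2_eq_square divide_simps) (simp add: algebra_simps)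
    then show ?thesis
      by (rule has_field_derivative_transform_within_open[where S="{0<..}"]) (use 1 in \<open>auto simp: flat_def\<close>)
  next
    case 2
    have "((\<lambda>x. 0) has_real_derivative flat ([:0, 0, 1:] * (P - pderiv P)) x) (at x)"
      using 2 by (auto simp: flat_def)
    then show ?thesis
      by (rule has_field_derivative_transform_within_open[where S="{..<0}"]) (use 2 in \<open>auto simp: flat_def\<close>)
  next
    case 3
    have right: "((\<lambda>y. (flat P (0 + y) - flat P 0) / y) \<longlongrightarrow> 0) (at_right 0)"
    proof -
      have "((\<lambda>y. poly ([:0, 1:] * P) (inverse y) * exp (- inverse y)) \<longlongrightarrow> 0) (at_right (0::real))"
        by (rule filterlim_compose[OF poly_exp_tendsto_0 filterlim_inverse_at_top_right])
      then show ?thesis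
        by (rule Lim_transform_eventually)
          (auto simp: flat_def eventually_at_right_field divide_inverse intro!: exI[of _ 1])
    qed
    have left: "((\<lambda>y. (flat P (0 + y) - flat P 0) / y) \<longlongrightarrow> 0) (at_left 0)"
      by (rule Lim_transform_eventually[OF tendsto_const])
        (auto simp: flat_def eventually_at_left_field intro!: exI[of _ "-1"])
    show ?thesis
      using filterlim_split_at[OF left right] 3 by (simp add: DERIV_def flat_def)
  qed
qed

text \<open>The induction runs over all polynomials at once: a partial derivative is a partial
  derivative of \<open>q\<close> times \<open>flat\<close> of another polynomial.\<close>

lemma C_k_flat_compose:
  assumes "\<And>k. C_k k q"
  shows "C_k k (\<lambda>x. flat P (q x))"
proof (induction k arbitrary: P)
  case 0
  have "continuous_on UNIV (flat P)"
    using has_real_derivative_flat by (intro continuous_at_imp_continuous_on ballI DERIV_isCont) blast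
  moreover have "continuous_on UNIV q" using assms[of 0] by simp
  ultimately show ?case
    using continuous_on_compose2[of UNIV "flat P" UNIV q] by auto
next
  case (Suc k)
  show ?case
  proof (rule C_k_SucI)
    show "((\<lambda>x. flat P (q x)) has_derivative (\<lambda>e. frechet_derivative q (at x) e * flat ([:0, 0, 1:] * (P - pderiv P)) (q x))) (at x)" for x
      by (rule DERIV_compose_FDERIV[OF has_real_derivative_flat C_k_SucD(1)[OF assms]])
    show "C_k k (\<lambda>x. frechet_derivative q (at x) e * flat ([:0, 0, 1:] * (P - pderiv P)) (q x))" if "e \<in> Basis" for e
      using C_k_SucD(2)[OF assms that] Suc by (intro C_k_mult)
  qed
qed

lemma flat_bounded: "\<exists>B\<ge>0. \<forall>x\<le>1. \<bar>flat P x\<bar> \<le> B"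
proof -
  have "continuous_on {0..1} (flat P)"
    using has_real_derivative_flat by (intro continuous_at_imp_continuous_on ballI DERIV_isCont) blast
  then have "bounded (flat P ` {0..1})"
    by (intro compact_imp_bounded compact_continuous_image) auto
  then obtain B where "\<forall>y\<in>flat P ` {0..1}. norm y \<le> B"
    unfolding bounded_iff by blast
  then have B: "\<And>x. x \<in> {0..1} \<Longrightarrow> \<bar>flat P x\<bar> \<le> B"
    by auto
  have "\<bar>flat P x\<bar> \<le> B" if "x \<le> 1" for x
  proof (cases "0 \<le> x")
    case True then show ?thesis using B that by auto
  next
    case False
    then have "flat P x = 0" by (simp add: flat_def)
    then show ?thesis using B[of 0] by simp
  qed
  moreover have "0 \<le> B" using B[of 0] by simp
  ultimately show ?thesis by blast
qed

section \<open>The standard bump function\<close>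

text \<open>Inside the unit ball this is \<open>exp (- 1 / (1 - z \<bullet> z))\<close>. The squared
  norm keeps the inner function smooth at the origin.\<close>

definition bump :: "'a::euclidean_space \<Rightarrow> real" where
  "bump z = flat 1 (1 - z \<bullet> z)"

text \<open>The derivative of the profile \<open>flat 1\<close> at the same argument, so that the
  gradient of \<open>bump\<close> at z is \<open>- 2 * bump' z\<close> times z.\<close>

definition bump' :: "'a::euclidean_space \<Rightarrow> real" where
  "bump' z = flat [:0, 0, 1:] (1 - z \<bullet> z)"

lemma bump_nonneg: "0 \<le> bump z"
  by (simp add: bump_def flat_def)

lemma bump_eq_0_iff: "bump z = 0 \<longleftrightarrow> 1 \<le> norm z"
proof -
  have "bump z = 0 \<longleftrightarrow> 1 \<le> (norm z)\<^sup>2"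
    by (auto simp: bump_def flat_def power2_norm_eq_inner)
  also have "\<dots> \<longleftrightarrow> 1 \<le> norm z"
    using abs_le_square_iff[of 1 "norm z"] by simp
  finally show ?thesis .
qed

lemma bump'_eq_0: "1 \<le> norm z \<Longrightarrow> bump' z = 0"
  using bump_eq_0_iff[of z] by (auto simp: bump_def bump'_def flat_def split: if_splits)

lemma bump_le: "bump z \<le> 1"
  by (auto simp: bump_def flat_def)

lemma bump'_bounded: "\<exists>B\<ge>0. \<forall>z::'a::euclidean_space. \<bar>bump' z\<bar> \<le> B"
  using flat_bounded[of "[:0, 0, 1:]"] by (auto simp: bump'_def)

lemma has_derivative_bump:
  assumes "(z has_derivative z') (at x within S)"
  shows "((\<lambda>x. bump (z x)) has_derivative (\<lambda>e. - 2 * (z x \<bullet> z' e) * bump' (z x))) (at x within S)"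
proof -
  have "((\<lambda>x. flat 1 (1 - z x \<bullet> z x)) has_derivative (\<lambda>e. - (z x \<bullet> z' e + z' e \<bullet> z x) * flat ([:0, 0, 1:] * (1 - pderiv 1)) (1 - z x \<bullet> z x))) (at x within S)"
    by (rule DERIV_compose_FDERIV[OF has_real_derivative_flat]) (auto intro!: derivative_eq_intros assms)
  then show ?thesis
    by (simp add: bump_def bump'_def inner_commute)
qed

text \<open>The function \<open>u\<close> is merely integrable, so all differentiation falls on the
  kernel. The bound on \<open>k'\<close> over a convex set bounds the difference quotients by the
  mean value inequality, and \<open>B * \<bar>u y\<bar>\<close> dominates.\<close>

lemma has_real_derivative_integral_mult:
  fixes k :: "real \<Rightarrow> 'a \<Rightarrow> real"
  assumes u: "integrable M u" and S: "convex S" "\<sigma> \<in> S"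
    and [measurable]: "\<And>\<sigma>. \<sigma> \<in> S \<Longrightarrow> k \<sigma> \<in> borel_measurable M" "k' \<sigma> \<in> borel_measurable M"
    and der: "\<And>\<sigma> y. \<sigma> \<in> S \<Longrightarrow> y \<in> space M \<Longrightarrow> ((\<lambda>\<sigma>. k \<sigma> y) has_real_derivative k' \<sigma> y) (at \<sigma> within S)"
    and B: "\<And>\<sigma> y. \<sigma> \<in> S \<Longrightarrow> y \<in> space M \<Longrightarrow> \<bar>k' \<sigma> y\<bar> \<le> B"
    and int: "\<And>\<sigma>. \<sigma> \<in> S \<Longrightarrow> integrable M (\<lambda>y. u y * k \<sigma> y)"
  shows "((\<lambda>\<sigma>. LINT y|M. u y * k \<sigma> y) has_real_derivative (LINT y|M. u y * k' \<sigma> y)) (at \<sigma> within S)"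
  unfolding has_field_derivative_iff tendsto_at_iff_sequentially comp_def
proof (intro allI impI)
  fix X :: "nat \<Rightarrow> real" assume X: "\<forall>i. X i \<in> S - {\<sigma>}" "X \<longlonglongrightarrow> \<sigma>"
  have [measurable]: "u \<in> borel_measurable M" "\<And>i. k (X i) \<in> borel_measurable M" "k \<sigma> \<in> borel_measurable M"
    using u X S by auto
  have "(\<lambda>i. LINT y|M. u y * ((k (X i) y - k \<sigma> y) / (X i - \<sigma>))) \<longlonglongrightarrow> (LINT y|M. u y * k' \<sigma> y)"
  proof (rule integral_dominated_convergence[where w="\<lambda>y. B * \<bar>u y\<bar>"])
    show "integrable M (\<lambda>y. B * \<bar>u y\<bar>)" using u by simp
    show "AE y in M. (\<lambda>i. u y * ((k (X i) y - k \<sigma> y) / (X i - \<sigma>))) \<longlonglongrightarrow> u y * k' \<sigma> y"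
    proof (intro AE_I2 tendsto_mult tendsto_const)
      fix y assume y: "y \<in> space M"
      show "(\<lambda>i. (k (X i) y - k \<sigma> y) / (X i - \<sigma>)) \<longlonglongrightarrow> k' \<sigma> y"
        using der[OF S(2) y] X unfolding has_field_derivative_iff tendsto_at_iff_sequentially comp_def by auto
    qed
    show "AE y in M. norm (u y * ((k (X i) y - k \<sigma> y) / (X i - \<sigma>))) \<le> B * \<bar>u y\<bar>" for i
    proof (intro AE_I2)
      fix y assume y: "y \<in> space M"
      have "norm (k (X i) y - k \<sigma> y) \<le> B * norm (X i - \<sigma>)"
        using X S der B y by (intro field_differentiable_bound[of S "\<lambda>\<sigma>. k \<sigma> y" "\<lambda>\<sigma>. k' \<sigma> y"]) auto
      then have "\<bar>(k (X i) y - k \<sigma> y) / (X i - \<sigma>)\<bar> \<le> B"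
        using X(1) by (simp add: abs_divide divide_le_eq)
      then have "\<bar>u y\<bar> * \<bar>(k (X i) y - k \<sigma> y) / (X i - \<sigma>)\<bar> \<le> \<bar>u y\<bar> * B"
        by (rule mult_left_mono) simp
      then show "norm (u y * ((k (X i) y - k \<sigma> y) / (X i - \<sigma>))) \<le> B * \<bar>u y\<bar>"
        by (simp only: real_norm_def abs_mult mult.commute[of B])
    qed
  qed measurable
  also have "(\<lambda>i. LINT y|M. u y * ((k (X i) y - k \<sigma> y) / (X i - \<sigma>))) =
    (\<lambda>i. ((LINT y|M. u y * k (X i) y) - (LINT y|M. u y * k \<sigma> y)) / (X i - \<sigma>))"
  proof
    fix i
    have "(LINT y|M. u y * ((k (X i) y - k \<sigma> y) / (X i - \<sigma>))) = (LINT y|M. (u y * k (X i) y - u y * k \<sigma> y) / (X i - \<sigma>))"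
      by (simp add: algebra_simps)
    also have "\<dots> = ((LINT y|M. u y * k (X i) y) - (LINT y|M. u y * k \<sigma> y)) / (X i - \<sigma>)"
      using int X S by simp
    finally show "(LINT y|M. u y * ((k (X i) y - k \<sigma> y) / (X i - \<sigma>))) =
      ((LINT y|M. u y * k (X i) y) - (LINT y|M. u y * k \<sigma> y)) / (X i - \<sigma>)" .
  qed
  finally show "(\<lambda>i. ((LINT y|M. u y * k (X i) y) - (LINT y|M. u y * k \<sigma> y)) / (X i - \<sigma>)) \<longlonglongrightarrow> (LINT y|M. u y * k' \<sigma> y)" .
qed

section \<open>Averaging kernels moved along a path\<close>

text \<open>The kernel is not normalised: its integral is \<open>bump_mass\<close> for every centre
  and radius. That the mass is independent of them is what allows one kernel to be carried to
  another by a field supported in the moving ball.\<close>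

definition mollifier :: "'a::euclidean_space \<Rightarrow> real \<Rightarrow> 'a \<Rightarrow> real" where
  "mollifier c \<rho> y = bump ((1 / \<rho>) *\<^sub>R (y - c)) / \<rho> ^ DIM('a)"

text \<open>The rate of change of the kernel when its centre moves with velocity v and its radius
  with velocity w; the term with \<open>bump z\<close> stems from the factor
  \<open>1 / \<rho> ^ DIM('a)\<close>.\<close>

definition mollifier_dot :: "'a::euclidean_space \<Rightarrow> real \<Rightarrow> 'a \<Rightarrow> real \<Rightarrow> 'a \<Rightarrow> real" where
  "mollifier_dot c \<rho> v w y = (let z = (1 / \<rho>) *\<^sub>R (y - c) in
     (2 * bump' z * (z \<bullet> v + w * (z \<bullet> z)) - real DIM('a) * w * bump z) / \<rho> ^ (DIM('a) + 1))"

text \<open>The divergence of this field is minus the derivative of the kernel along the path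
  \<open>(c + \<sigma> v, \<rho> + \<sigma> w)\<close>.\<close>

definition transport_field :: "'a::euclidean_space \<Rightarrow> real \<Rightarrow> 'a \<Rightarrow> real \<Rightarrow> 'a \<Rightarrow> 'a" where
  "transport_field c \<rho> v w y = mollifier c \<rho> y *\<^sub>R (v + (w / \<rho>) *\<^sub>R (y - c))"

lemma mollifier_nonneg: "0 < \<rho> \<Longrightarrow> 0 \<le> mollifier c \<rho> y"
  by (simp add: mollifier_def bump_nonneg)

lemma mollifier_le:
  fixes c :: "'a::euclidean_space"
  shows "0 < \<rho> \<Longrightarrow> mollifier c \<rho> y \<le> 1 / \<rho> ^ DIM('a)"
  unfolding mollifier_def using bump_le by (intro divide_right_mono) auto

lemma mollifier_eq_0_iff: "0 < \<rho> \<Longrightarrow> mollifier c \<rho> y = 0 \<longleftrightarrow> \<rho> \<le> dist c y"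
  by (simp add: mollifier_def bump_eq_0_iff dist_norm norm_minus_commute)

lemma C_k_mollifier:
  fixes c :: "'a::euclidean_space"
  shows "C_k k (mollifier c \<rho>)"
proof -
  have "C_k k (\<lambda>y. (1 / \<rho> ^ DIM('a)) * flat 1 (1 + (- 1 / \<rho>\<^sup>2) * ((y - c) \<bullet> (y - c))))"
    by (intro C_k_mult C_k_const C_k_flat_compose C_k_inner_self)
  then show ?thesis
    by (simp add: mollifier_def[abs_def] bump_def power2_eq_square)
qed

lemma continuous_mollifier: "continuous_on S (mollifier c \<rho>)"
  using C_k_mollifier[of 0 c \<rho>] continuous_on_subset by auto

lemma continuous_mollifier_dot: "continuous_on S (mollifier_dot c \<rho> v w)"
proof -
  have "continuous_on UNIV (flat P)" for P
    using has_real_derivative_flat by (intro continuous_at_imp_continuous_on ballI DERIV_isCont) blast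
  note cont = this
  have flat: "continuous_on S (\<lambda>y. flat P (1 - ((1 / \<rho>) *\<^sub>R (y - c)) \<bullet> ((1 / \<rho>) *\<^sub>R (y - c))))"
    if "\<rho> \<noteq> 0" for P
    by (rule continuous_on_compose2[OF cont]) (use that in \<open>auto intro!: continuous_intros\<close>)
  show ?thesis
  proof (cases "\<rho> = 0")
    case False
    then show ?thesis
      unfolding mollifier_dot_def bump_def bump'_def Let_def by (intro continuous_intros flat) auto
  qed (simp add: mollifier_dot_def Let_def)
qed

text \<open>The continuity equation for a mass moved by the affine velocity
  \<open>v + (w / \<rho>) *\<^sub>R (y - c)\<close>, which takes balls to balls. The divergence
  \<open>DIM('a) * w / \<rho>\<close> of this velocity accounts for the term of
  \<open>mollifier_dot\<close> with \<open>bump z\<close>.\<close>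

lemma frechet_derivative_transport_field:
  fixes c :: "'a::euclidean_space"
  assumes \<rho>: "0 < \<rho>"
  shows "(\<Sum>i\<in>Basis. frechet_derivative (\<lambda>y. transport_field c \<rho> v w y \<bullet> i) (at y) i) = - mollifier_dot c \<rho> v w y"
proof -
  define z where "z = (1 / \<rho>) *\<^sub>R (y - c)"
  define N where "N = DIM('a)"
  have "frechet_derivative (\<lambda>y. transport_field c \<rho> v w y \<bullet> i) (at y) i =
    (- 2 * (z \<bullet> i) * bump' z * ((v + w *\<^sub>R z) \<bullet> i) + bump z * w) / \<rho> ^ (N + 1)" if i: "i \<in> Basis" for i
  proof -
    have "((\<lambda>y. transport_field c \<rho> v w y \<bullet> i) has_derivative
      (\<lambda>e. (bump z / \<rho> ^ N) * ((w / \<rho>) * (e \<bullet> i)) + ((- 2 * (z \<bullet> ((1 / \<rho>) *\<^sub>R e)) * bump' z) / \<rho> ^ N) * ((v + (w / \<rho>) *\<^sub>R (y - c)) \<bullet> i))) (at y)"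
    proof -
      have "((\<lambda>y. bump ((1 / \<rho>) *\<^sub>R (y - c))) has_derivative (\<lambda>e. - 2 * (z \<bullet> ((1 / \<rho>) *\<^sub>R e)) * bump' z)) (at y)"
        unfolding z_def by (rule has_derivative_bump) (auto intro!: derivative_eq_intros)
      then have "((\<lambda>y. bump ((1 / \<rho>) *\<^sub>R (y - c)) * (1 / \<rho> ^ N)) has_derivative (\<lambda>e. - 2 * (z \<bullet> ((1 / \<rho>) *\<^sub>R e)) * bump' z * (1 / \<rho> ^ N))) (at y)"
        by (rule has_derivative_mult_left)
      moreover have "((\<lambda>y. (v + (w / \<rho>) *\<^sub>R (y - c)) \<bullet> i) has_derivative (\<lambda>e. (w / \<rho>) * (e \<bullet> i))) (at y)"
        by (auto intro!: derivative_eq_intros)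
      ultimately have "((\<lambda>y. (bump ((1 / \<rho>) *\<^sub>R (y - c)) * (1 / \<rho> ^ N)) * ((v + (w / \<rho>) *\<^sub>R (y - c)) \<bullet> i)) has_derivative
        (\<lambda>e. (bump z * (1 / \<rho> ^ N)) * ((w / \<rho>) * (e \<bullet> i)) + (- 2 * (z \<bullet> ((1 / \<rho>) *\<^sub>R e)) * bump' z * (1 / \<rho> ^ N)) * ((v + (w / \<rho>) *\<^sub>R (y - c)) \<bullet> i))) (at y)"
        unfolding z_def by (rule has_derivative_mult)
      then show ?thesis
        by (simp add: transport_field_def mollifier_def N_def[symmetric])
    qed
    then have "frechet_derivative (\<lambda>y. transport_field c \<rho> v w y \<bullet> i) (at y) =
      (\<lambda>e. (bump z / \<rho> ^ N) * ((w / \<rho>) * (e \<bullet> i)) + ((- 2 * (z \<bullet> ((1 / \<rho>) *\<^sub>R e)) * bump' z) / \<rho> ^ N) * ((v + (w / \<rho>) *\<^sub>R (y - c)) \<bullet> i))"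
      by (rule frechet_derivative_at[symmetric])
    then show ?thesis
      using i \<rho> by (simp add: z_def inner_add_left field_simps)
  qed
  then have "(\<Sum>i\<in>Basis. frechet_derivative (\<lambda>y. transport_field c \<rho> v w y \<bullet> i) (at y) i) =
    (\<Sum>i\<in>Basis. (- 2 * bump' z * ((z \<bullet> i) * ((v + w *\<^sub>R z) \<bullet> i)) + bump z * w) / \<rho> ^ (N + 1))"
    by (intro sum.cong) (auto simp: mult_ac)
  also have "\<dots> = (- 2 * bump' z * (z \<bullet> (v + w *\<^sub>R z)) + real N * (bump z * w)) / \<rho> ^ (N + 1)"
    unfolding euclidean_inner[of z "v + w *\<^sub>R z"]
    by (simp add: sum_divide_distrib[symmetric] sum.distrib sum_subtractf sum_negf sum_distrib_left N_def)
  also have "\<dots> = - mollifier_dot c \<rho> v w y"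
    by (simp add: mollifier_dot_def z_def[symmetric] N_def inner_add_right minus_divide_left mult_ac)
  finally show ?thesis .
qed

lemma test_function_transport_field:
  assumes "0 < \<rho>" "cball c \<rho> \<subseteq> \<Omega>"
  shows "test_function \<Omega> (\<lambda>y. transport_field c \<rho> v w y \<bullet> i)"
proof -
  have "{y. transport_field c \<rho> v w y \<bullet> i \<noteq> 0} \<subseteq> cball c \<rho>"
    using assms mollifier_eq_0_iff[of \<rho> c] by (force simp: transport_field_def)
  then have sub: "closure {y. transport_field c \<rho> v w y \<bullet> i \<noteq> 0} \<subseteq> cball c \<rho>"
    by (rule closure_minimal) simp
  then have "compact (closure {y. transport_field c \<rho> v w y \<bullet> i \<noteq> 0})"
    by (meson bounded_cball bounded_subset closed_closure compact_eq_bounded_closed)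
  moreover have "C_k k (\<lambda>y. mollifier c \<rho> y * ((v \<bullet> i) + (w / \<rho>) * ((y - c) \<bullet> i)))" for k
    by (intro C_k_mult C_k_mollifier C_k_inner_affine)
  ultimately show ?thesis
    using sub assms(2) by (auto simp: test_function_def transport_field_def inner_add_left)
qed

text \<open>Uniformity in the centre and in all radii from \<open>\<rho>0\<close> on provides the
  domination while the kernel moves.\<close>

lemma mollifier_dot_bounded:
  fixes v :: "'a::euclidean_space"
  shows "\<exists>B\<ge>0. \<forall>c y \<rho>. \<rho>0 \<le> \<rho> \<longrightarrow> 0 < \<rho>0 \<longrightarrow> \<bar>mollifier_dot c \<rho> v w y\<bar> \<le> B"
proof -
  obtain B where B: "0 \<le> B" "\<And>z::'a. \<bar>bump' z\<bar> \<le> B" using bump'_bounded by blast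
  define C where "C = (2 * (B * (norm v + \<bar>w\<bar>)) + real DIM('a) * \<bar>w\<bar>) / \<rho>0 ^ (DIM('a) + 1)"
  have "\<bar>mollifier_dot c \<rho> v w y\<bar> \<le> C" if \<rho>: "\<rho>0 \<le> \<rho>" "0 < \<rho>0" for c y \<rho>
  proof -
    define z where "z = (1 / \<rho>) *\<^sub>R (y - c)"
    have "\<bar>bump' z * (z \<bullet> v + w * (z \<bullet> z))\<bar> \<le> B * (norm v + \<bar>w\<bar>)"
    proof (cases "1 \<le> norm z")
      case True
      then show ?thesis using bump'_eq_0[of z] B by simp
    next
      case False
      have "\<bar>z \<bullet> v + w * (z \<bullet> z)\<bar> \<le> norm z * norm v + \<bar>w\<bar> * (norm z * norm z)"
        using Cauchy_Schwarz_ineq2[of z v] by (simp add: abs_mult dot_square_norm power2_eq_square abs_triangle_ineq[THEN order_trans])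
      also have "\<dots> \<le> 1 * norm v + \<bar>w\<bar> * (1 * 1)"
        using False by (intro add_mono mult_mono) auto
      finally show ?thesis
        unfolding abs_mult using B by (intro mult_mono) auto
    qed
    moreover have "\<bar>real DIM('a) * w * bump z\<bar> \<le> real DIM('a) * \<bar>w\<bar>"
      using bump_le[of z] bump_nonneg[of z] by (simp add: abs_mult mult_left_le)
    ultimately have "\<bar>2 * bump' z * (z \<bullet> v + w * (z \<bullet> z)) - real DIM('a) * w * bump z\<bar> \<le> 2 * (B * (norm v + \<bar>w\<bar>)) + real DIM('a) * \<bar>w\<bar>"
      by (simp only: mult.assoc)
    then have "\<bar>mollifier_dot c \<rho> v w y\<bar> \<le> (2 * (B * (norm v + \<bar>w\<bar>)) + real DIM('a) * \<bar>w\<bar>) / \<rho> ^ (DIM('a) + 1)"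
      using \<rho> by (simp add: mollifier_dot_def z_def[symmetric] abs_divide divide_right_mono del: power_Suc)
    also have "\<dots> \<le> C"
      unfolding C_def using \<rho> B by (intro divide_left_mono power_mono mult_pos_pos) auto
    finally show ?thesis .
  qed
  moreover have "0 \<le> C \<or> \<not> 0 < \<rho>0" using B by (auto simp: C_def)
  ultimately show ?thesis
    by (intro exI[of _ "max C 0"]) auto
qed

lemma has_derivative_mollifier_path:
  assumes "0 < \<rho> + \<sigma> * w"
  shows "((\<lambda>\<sigma>. mollifier (c + \<sigma> *\<^sub>R v) (\<rho> + \<sigma> * w) y) has_real_derivative
    mollifier_dot (c + \<sigma> *\<^sub>R v) (\<rho> + \<sigma> * w) v w y) (at \<sigma> within S)"
proof -
  define r where "r = \<rho> + \<sigma> * w"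
  define z where "z = (1 / r) *\<^sub>R (y - (c + \<sigma> *\<^sub>R v))"
  have r: "0 < r" using assms by (simp add: r_def)
  define N where "N = DIM('a)"
  have N: "real N * r ^ (N - 1) * r = real N * r ^ N"
    by (cases N) auto
  have dz: "((\<lambda>\<sigma>. (1 / (\<rho> + \<sigma> * w)) *\<^sub>R (y - (c + \<sigma> *\<^sub>R v))) has_derivative (\<lambda>h. (- h / r) *\<^sub>R (v + w *\<^sub>R z))) (at \<sigma> within S)"
  proof -
    define d where "d = y - (c + \<sigma> *\<^sub>R v)"
    have "((\<lambda>\<sigma>. 1 / (\<rho> + \<sigma> * w)) has_derivative (\<lambda>h. - (h * w) / (r * r))) (at \<sigma> within S)"
      using r unfolding r_def by (auto intro!: derivative_eq_intros simp: divide_inverse mult_ac)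
    moreover have "((\<lambda>\<sigma>. y - (c + \<sigma> *\<^sub>R v)) has_derivative (\<lambda>h. - (h *\<^sub>R v))) (at \<sigma> within S)"
      by (auto intro!: derivative_eq_intros)
    ultimately have "((\<lambda>\<sigma>. (1 / (\<rho> + \<sigma> * w)) *\<^sub>R (y - (c + \<sigma> *\<^sub>R v))) has_derivative
        (\<lambda>h. (1 / r) *\<^sub>R (- (h *\<^sub>R v)) + (- (h * w) / (r * r)) *\<^sub>R d)) (at \<sigma> within S)"
      unfolding r_def d_def by (rule has_derivative_scaleR)
    then show ?thesis
      by (rule has_derivative_eq_rhs) (auto simp: z_def d_def[symmetric] scaleR_add_right)
  qed
  have "((\<lambda>\<sigma>. bump ((1 / (\<rho> + \<sigma> * w)) *\<^sub>R (y - (c + \<sigma> *\<^sub>R v)))) has_derivative (\<lambda>h. - 2 * (z \<bullet> ((- h / r) *\<^sub>R (v + w *\<^sub>R z))) * bump' z)) (at \<sigma> within S)"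
    unfolding z_def r_def by (rule has_derivative_bump) (use dz in \<open>simp add: z_def r_def\<close>)
  then have "((\<lambda>\<sigma>. bump ((1 / (\<rho> + \<sigma> * w)) *\<^sub>R (y - (c + \<sigma> *\<^sub>R v)))) has_real_derivative (2 * bump' z * (z \<bullet> (v + w *\<^sub>R z)) / r)) (at \<sigma> within S)"
    unfolding has_field_derivative_def by (rule has_derivative_eq_rhs) (auto simp: mult_ac)
  then have "((\<lambda>\<sigma>. bump ((1 / (\<rho> + \<sigma> * w)) *\<^sub>R (y - (c + \<sigma> *\<^sub>R v))) / (\<rho> + \<sigma> * w) ^ N) has_real_derivative
    ((2 * bump' z * (z \<bullet> (v + w *\<^sub>R z)) / r) * r ^ N - bump z * (real N * r ^ (N - 1) * w)) / (r ^ N * r ^ N)) (at \<sigma> within S)"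
    using r unfolding r_def z_def
    by (intro DERIV_divide[THEN DERIV_cong]) (auto intro!: derivative_eq_intros)
  then show ?thesis
    unfolding mollifier_def N_def[symmetric]
  proof (rule DERIV_cong)
    have "((2 * bump' z * (z \<bullet> (v + w *\<^sub>R z)) / r) * r ^ N - bump z * (real N * r ^ (N - 1) * w)) / (r ^ N * r ^ N) =
      ((2 * bump' z * (z \<bullet> (v + w *\<^sub>R z))) * r ^ N - bump z * w * (real N * r ^ (N - 1) * r)) / (r ^ N * r ^ N * r)"
      using r by (simp add: field_simps)
    also have "\<dots> = (2 * bump' z * (z \<bullet> (v + w *\<^sub>R z)) - bump z * w * real N) * r ^ N / (r ^ N * r ^ N * r)"
      unfolding N by (simp add: algebra_simps)
    also have "\<dots> = (2 * bump' z * (z \<bullet> (v + w *\<^sub>R z)) - bump z * w * real N) / r ^ (N + 1)"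
      using r by (simp add: field_simps)
    also have "\<dots> = mollifier_dot (c + \<sigma> *\<^sub>R v) (\<rho> + \<sigma> * w) v w y"
      by (simp add: mollifier_dot_def r_def[symmetric] z_def[symmetric] N_def inner_add_right mult_ac)
    finally show "((2 * bump' z * (z \<bullet> (v + w *\<^sub>R z)) / r) * r ^ N - bump z * (real N * r ^ (N - 1) * w)) / (r ^ N * r ^ N) =
      mollifier_dot (c + \<sigma> *\<^sub>R v) (\<rho> + \<sigma> * w) v w y" .
  qed
qed

lemma norm_transport_field_le:
  fixes c :: "'a::euclidean_space"
  assumes "0 < \<rho>0" "\<rho>0 \<le> \<rho>"
  shows "norm (transport_field c \<rho> v w y) \<le> (norm v + \<bar>w\<bar>) / \<rho>0 ^ DIM('a) * indicator (cball c \<rho>) y"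
proof (cases "\<rho> \<le> dist c y")
  case True
  then show ?thesis using assms mollifier_eq_0_iff[of \<rho> c y] by (simp add: transport_field_def)
next
  case False
  have "norm (v + (w / \<rho>) *\<^sub>R (y - c)) \<le> norm v + \<bar>w\<bar> * (norm (y - c) / \<rho>)"
    using norm_triangle_ineq[of v "(w / \<rho>) *\<^sub>R (y - c)"] assms by (simp add: abs_divide)
  also have "\<dots> \<le> norm v + \<bar>w\<bar> * 1"
    using False assms by (intro add_mono mult_left_mono) (auto simp: dist_norm norm_minus_commute)
  finally have 1: "norm (v + (w / \<rho>) *\<^sub>R (y - c)) \<le> norm v + \<bar>w\<bar>" by simp
  have "mollifier c \<rho> y \<le> 1 / \<rho> ^ DIM('a)" using assms by (intro mollifier_le) auto
  also have "\<dots> \<le> 1 / \<rho>0 ^ DIM('a)"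
    using assms by (intro divide_left_mono power_mono mult_pos_pos) auto
  finally have "mollifier c \<rho> y * norm (v + (w / \<rho>) *\<^sub>R (y - c)) \<le> 1 / \<rho>0 ^ DIM('a) * (norm v + \<bar>w\<bar>)"
    using 1 assms mollifier_nonneg[of \<rho> c y] by (intro mult_mono) auto
  then show ?thesis
    using False assms mollifier_nonneg[of \<rho> c y] by (simp add: transport_field_def dist_commute)
qed

lemma borel_measurable_lebesgue_on_continuous:
  fixes f :: "'a::euclidean_space \<Rightarrow> 'b::euclidean_space"
  shows "continuous_on UNIV f \<Longrightarrow> f \<in> borel_measurable (lebesgue_on \<Omega>)"
  by (intro measurable_restrict_space1 measurable_completion) (simp add: borel_measurable_continuous_onI)

definition mollify :: "'a::euclidean_space set \<Rightarrow> ('a \<Rightarrow> real) \<Rightarrow> 'a \<Rightarrow> real \<Rightarrow> real" where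
  "mollify \<Omega> u c \<rho> = (LINT y|lebesgue_on \<Omega>. u y * mollifier c \<rho> y)"

lemma integrable_mult_bounded:
  fixes u k :: "'a \<Rightarrow> real"
  assumes "integrable M u" "k \<in> borel_measurable M" "\<And>y. \<bar>k y\<bar> \<le> B"
  shows "integrable M (\<lambda>y. u y * k y)"
proof (rule Bochner_Integration.integrable_bound[of _ "\<lambda>y. B * u y"])
  show "AE y in M. norm (u y * k y) \<le> norm (B * u y)"
  proof (intro AE_I2)
    fix y
    have "\<bar>k y\<bar> \<le> \<bar>B\<bar>" using assms(3)[of y] by linarith
    then have "\<bar>k y\<bar> * \<bar>u y\<bar> \<le> \<bar>B\<bar> * \<bar>u y\<bar>"
      by (rule mult_right_mono) simp
    then show "norm (u y * k y) \<le> norm (B * u y)"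
      by (simp only: real_norm_def abs_mult mult.commute)
  qed
qed (use assms in auto)

text \<open>\<open>\<rho>0\<close> bounds the radii along the path from below, and S contains all
  balls swept. The transporting field is at most
  \<open>(norm v + \<bar>w\<bar>) / \<rho>0 ^ DIM('a)\<close> and lives in the current ball, which
  gives the two factors of the bound for the derivative; the mean value inequality on the unit
  interval does the rest.\<close>

lemma mollify_diff_le:
  fixes \<Omega> :: "'a::euclidean_space set"
  assumes wg: "is_weak_gradient \<Omega> u g" and \<Omega>: "open \<Omega>"
    and u: "integrable (lebesgue_on \<Omega>) u" and g: "integrable (lebesgue_on \<Omega>) g"
    and S: "S \<in> sets (lebesgue_on \<Omega>)" and \<rho>0: "0 < \<rho>0"
    and path: "\<And>\<sigma>. \<sigma> \<in> {0..1} \<Longrightarrow> \<rho>0 \<le> \<rho> + \<sigma> * w \<and> cball (c + \<sigma> *\<^sub>R v) (\<rho> + \<sigma> * w) \<subseteq> S"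
  shows "\<bar>mollify \<Omega> u (c + v) (\<rho> + w) - mollify \<Omega> u c \<rho>\<bar> \<le>
    (norm v + \<bar>w\<bar>) / \<rho>0 ^ DIM('a) * (LINT y|lebesgue_on \<Omega>. indicator S y * norm (g y))"
proof -
  define M where "M = lebesgue_on \<Omega>"
  define I where "I = (LINT y|M. indicator S y * norm (g y))"
  have S\<Omega>: "S \<subseteq> \<Omega>" using sets.sets_into_space[OF S] by simp
  obtain B where B: "0 \<le> B" "\<And>c y \<rho>. \<rho>0 \<le> \<rho> \<Longrightarrow> \<bar>mollifier_dot c \<rho> v w y\<bar> \<le> B"
    using mollifier_dot_bounded[of \<rho>0 v w] \<rho>0 by blast
  have int_dot: "integrable M (\<lambda>y. u y * mollifier_dot c \<rho> v w y)" if "\<rho>0 \<le> \<rho>" for c \<rho>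
    using u B(2)[OF that] unfolding M_def
    by (intro integrable_mult_bounded borel_measurable_lebesgue_on_continuous continuous_mollifier_dot)
  have int_mol: "integrable M (\<lambda>y. u y * mollifier c \<rho> y)" if "\<rho>0 \<le> \<rho>" for c \<rho>
    using u mollifier_nonneg[of \<rho> c] mollifier_le[of \<rho> c] \<rho>0 that unfolding M_def
    by (intro integrable_mult_bounded[where B="1 / \<rho> ^ DIM('a)"] borel_measurable_lebesgue_on_continuous continuous_mollifier) auto
  have bound: "\<bar>LINT y|M. u y * mollifier_dot c \<rho> v w y\<bar> \<le> (norm v + \<bar>w\<bar>) / \<rho>0 ^ DIM('a) * I"
    if \<rho>: "\<rho>0 \<le> \<rho>" "cball c \<rho> \<subseteq> S" for c \<rho>
  proof -
    have \<rho>_pos: "0 < \<rho>" using \<rho> \<rho>0 by simp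
    have test: "test_function \<Omega> (\<lambda>y. transport_field c \<rho> v w y \<bullet> i)" for i
      using \<rho> S\<Omega> \<rho>_pos by (intro test_function_transport_field) auto
    have cont: "continuous_on UNIV (\<lambda>y. transport_field c \<rho> v w y)"
      unfolding transport_field_def by (intro continuous_intros continuous_mollifier)
    have g_meas: "g \<in> borel_measurable M" using g by (auto simp: M_def)
    have int_g: "integrable M (\<lambda>y. (g y \<bullet> i) * (transport_field c \<rho> v w y \<bullet> i))" if "i \<in> Basis" for i
    proof (rule integrable_mult_bounded)
      show "integrable M (\<lambda>y. g y \<bullet> i)" using g unfolding M_def by (rule integrable_inner_left)
      show "(\<lambda>y. transport_field c \<rho> v w y \<bullet> i) \<in> borel_measurable M"
        unfolding M_def using cont by (intro borel_measurable_lebesgue_on_continuous continuous_intros)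
      show "\<bar>transport_field c \<rho> v w y \<bullet> i\<bar> \<le> (norm v + \<bar>w\<bar>) / \<rho>0 ^ DIM('a)" for y
        using norm_transport_field_le[OF \<rho>0 \<rho>(1), of c v w y] Basis_le_norm[OF that, of "transport_field c \<rho> v w y"] \<rho>0
        by (auto simp: indicator_def split: if_splits intro: order_trans)
    qed
    \<comment> \<open>Integration by parts, one coordinate at a time: the weak gradient is tested
      with scalar functions, so the divergence is split over the basis and reassembled as an inner
      product afterwards.\<close>
    have "(LINT y|M. u y * mollifier_dot c \<rho> v w y) =
      - (LINT y|M. (\<Sum>i\<in>Basis. u y * frechet_derivative (\<lambda>y. transport_field c \<rho> v w y \<bullet> i) (at y) i))"
      unfolding sum_distrib_left[symmetric] frechet_derivative_transport_field[OF \<rho>_pos] by simp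
    also have "(LINT y|M. (\<Sum>i\<in>Basis. u y * frechet_derivative (\<lambda>y. transport_field c \<rho> v w y \<bullet> i) (at y) i)) =
      (\<Sum>i\<in>Basis. LINT y|M. u y * frechet_derivative (\<lambda>y. transport_field c \<rho> v w y \<bullet> i) (at y) i)"
    proof (intro Bochner_Integration.integral_sum)
      fix i :: 'a assume i: "i \<in> Basis"
      have C1: "C_k 0 (\<lambda>y. frechet_derivative (\<lambda>y. transport_field c \<rho> v w y \<bullet> i) (at y) i)"
        using test[of i] i unfolding test_function_def by (metis C_k_SucD(2))
      \<comment> \<open>Off the closed ball the field vanishes on an open set, so its derivative
        does too; on the compact ball continuity bounds it.\<close>
      have supp: "frechet_derivative (\<lambda>y. transport_field c \<rho> v w y \<bullet> i) (at y) i = 0" if "y \<notin> cball c \<rho>" for y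
      proof -
        have "((\<lambda>y. 0::real) has_derivative (\<lambda>e. 0)) (at y)" by simp
        then have "((\<lambda>y. transport_field c \<rho> v w y \<bullet> i) has_derivative (\<lambda>e. 0)) (at y)"
          by (rule has_derivative_transform_within_open[where s="- cball c \<rho>"])
            (use that \<rho>_pos mollifier_eq_0_iff[of \<rho> c] in \<open>auto simp: transport_field_def\<close>)
        then show ?thesis using frechet_derivative_at by metis
      qed
      have "bounded ((\<lambda>y. frechet_derivative (\<lambda>y. transport_field c \<rho> v w y \<bullet> i) (at y) i) ` cball c \<rho>)"
        using C1 by (intro compact_imp_bounded compact_continuous_image) (auto intro: continuous_on_subset)
      then obtain B' where B': "\<forall>z\<in>(\<lambda>y. frechet_derivative (\<lambda>y. transport_field c \<rho> v w y \<bullet> i) (at y) i) ` cball c \<rho>. norm z \<le> B'"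
        unfolding bounded_iff by blast
      have "0 \<le> B'" using B' \<rho>_pos by (auto intro!: order_trans[OF abs_ge_zero] dest!: bspec[of _ _ c])
      show "integrable M (\<lambda>y. u y * frechet_derivative (\<lambda>y. transport_field c \<rho> v w y \<bullet> i) (at y) i)"
      proof (rule integrable_mult_bounded[where B=B'])
        show "(\<lambda>y. frechet_derivative (\<lambda>y. transport_field c \<rho> v w y \<bullet> i) (at y) i) \<in> borel_measurable M"
          using C1 unfolding M_def by (intro borel_measurable_lebesgue_on_continuous) simp
        show "\<bar>frechet_derivative (\<lambda>y. transport_field c \<rho> v w y \<bullet> i) (at y) i\<bar> \<le> B'" for y
          using B' supp[of y] \<open>0 \<le> B'\<close> by (cases "y \<in> cball c \<rho>") auto
      qed (use u in \<open>simp add: M_def\<close>)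
    qed
    also have "\<dots> = (\<Sum>i\<in>Basis. - (LINT y|M. (g y \<bullet> i) * (transport_field c \<rho> v w y \<bullet> i)))"
      using wg test unfolding is_weak_gradient_def M_def by (intro sum.cong) auto
    also have "\<dots> = - (LINT y|M. (\<Sum>i\<in>Basis. (g y \<bullet> i) * (transport_field c \<rho> v w y \<bullet> i)))"
      using int_g by (subst Bochner_Integration.integral_sum) (auto simp: sum_negf)
    also have "(LINT y|M. (\<Sum>i\<in>Basis. (g y \<bullet> i) * (transport_field c \<rho> v w y \<bullet> i))) = (LINT y|M. g y \<bullet> transport_field c \<rho> v w y)"
      by (intro Bochner_Integration.integral_cong refl euclidean_inner[symmetric])
    finally have "\<bar>LINT y|M. u y * mollifier_dot c \<rho> v w y\<bar> = \<bar>LINT y|M. g y \<bullet> transport_field c \<rho> v w y\<bar>"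
      by simp
    also have "\<dots> \<le> (LINT y|M. (norm v + \<bar>w\<bar>) / \<rho>0 ^ DIM('a) * (indicator S y * norm (g y)))"
    proof (rule integral_abs_bound_integral)
      show "integrable M (\<lambda>y. g y \<bullet> transport_field c \<rho> v w y)"
        by (subst euclidean_inner) (intro Bochner_Integration.integrable_sum int_g)
      show "integrable M (\<lambda>y. (norm v + \<bar>w\<bar>) / \<rho>0 ^ DIM('a) * (indicator S y * norm (g y)))"
        using integrable_mult_indicator[of S M "\<lambda>y. norm (g y)"] S g unfolding M_def by simp
      fix y
      have "\<bar>g y \<bullet> transport_field c \<rho> v w y\<bar> \<le> norm (g y) * norm (transport_field c \<rho> v w y)"
        by (rule Cauchy_Schwarz_ineq2)
      also have "\<dots> \<le> norm (g y) * ((norm v + \<bar>w\<bar>) / \<rho>0 ^ DIM('a) * indicator (cball c \<rho>) y)"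
        by (intro mult_left_mono norm_transport_field_le \<rho>0 \<rho>) auto
      also have "\<dots> \<le> norm (g y) * ((norm v + \<bar>w\<bar>) / \<rho>0 ^ DIM('a) * indicator S y)"
        using \<rho>(2) \<rho>0 by (intro mult_left_mono) (auto simp: indicator_def)
      finally show "\<bar>g y \<bullet> transport_field c \<rho> v w y\<bar> \<le> (norm v + \<bar>w\<bar>) / \<rho>0 ^ DIM('a) * (indicator S y * norm (g y))"
        by (simp add: mult_ac)
    qed
    finally show ?thesis by (simp add: I_def)
  qed
  define U where "U \<sigma> = (LINT y|M. u y * mollifier (c + \<sigma> *\<^sub>R v) (\<rho> + \<sigma> * w) y)" for \<sigma>
  have "norm (U 1 - U 0) \<le> ((norm v + \<bar>w\<bar>) / \<rho>0 ^ DIM('a) * I) * norm (1 - 0 :: real)"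
  proof (rule field_differentiable_bound[of "{0..1}" U
      "\<lambda>\<sigma>. LINT y|M. u y * mollifier_dot (c + \<sigma> *\<^sub>R v) (\<rho> + \<sigma> * w) v w y"])
    fix \<sigma> :: real assume \<sigma>: "\<sigma> \<in> {0..1}"
    show "(U has_real_derivative (LINT y|M. u y * mollifier_dot (c + \<sigma> *\<^sub>R v) (\<rho> + \<sigma> * w) v w y)) (at \<sigma> within {0..1})"
      unfolding U_def
    proof (rule has_real_derivative_integral_mult[where B=B])
      show "((\<lambda>\<sigma>. mollifier (c + \<sigma> *\<^sub>R v) (\<rho> + \<sigma> * w) y) has_real_derivative
        mollifier_dot (c + \<sigma> *\<^sub>R v) (\<rho> + \<sigma> * w) v w y) (at \<sigma> within {0..1})" if "\<sigma> \<in> {0..1}" for \<sigma> y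
        using path[OF that] \<rho>0 by (intro has_derivative_mollifier_path) auto
    qed (use u \<sigma> path B(2) int_mol in \<open>auto simp: M_def intro!: borel_measurable_lebesgue_on_continuous continuous_mollifier continuous_mollifier_dot\<close>)
    show "norm (LINT y|M. u y * mollifier_dot (c + \<sigma> *\<^sub>R v) (\<rho> + \<sigma> * w) v w y) \<le> (norm v + \<bar>w\<bar>) / \<rho>0 ^ DIM('a) * I"
      using bound path[OF \<sigma>] by simp
  qed auto
  then show ?thesis
    by (simp add: U_def mollify_def M_def I_def)
qed

section \<open>Cones in Lipschitz domains\<close>

lemma norm_remove_component_le:
  fixes e :: "'a::euclidean_space"
  assumes "norm e = 1"
  shows "norm (x - (x \<bullet> e) *\<^sub>R e) \<le> norm x"
proof -
  have "e \<bullet> e = 1" using assms by (simp add: dot_square_norm)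
  then have "(norm (x - (x \<bullet> e) *\<^sub>R e))\<^sup>2 = (norm x)\<^sup>2 - (x \<bullet> e)\<^sup>2"
    unfolding power2_norm_eq_inner by (simp add: inner_diff_left inner_diff_right power2_eq_square inner_commute)
  then have "(norm (x - (x \<bullet> e) *\<^sub>R e))\<^sup>2 \<le> (norm x)\<^sup>2" by simp
  then show ?thesis by (rule power2_le_imp_le) simp
qed

text \<open>Moving by t in the direction e gains the height t. An error of size
  \<open>\<kappa> * t\<close> costs at most \<open>\<kappa> * t\<close> in height and
  \<open>L * \<kappa> * t\<close> in the value of the graph, and
  \<open>\<kappa> = 1 / (L + 2)\<close> keeps the sum of both below t. Direction and aperture are
  the same for all points near z, so two neighbouring points can later be compared along one
  direction.\<close>

lemma lipschitz_boundary_cone: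
  fixes \<Omega> :: "'a::euclidean_space set"
  assumes "lipschitz_boundary \<Omega>" "z \<in> frontier \<Omega>"
  shows "\<exists>e \<kappa> \<rho>. norm e = 1 \<and> 0 < \<kappa> \<and> \<kappa> \<le> 1 / 2 \<and> 0 < \<rho> \<and>
    (\<forall>y\<in>\<Omega> \<inter> ball z \<rho>. \<forall>t. 0 < t \<and> t \<le> \<rho> \<longrightarrow> cball (y + t *\<^sub>R e) (\<kappa> * t) \<subseteq> \<Omega>)"
proof -
  obtain e r L \<phi> where e: "norm e = 1" and r: "0 < r" and lip: "L-lipschitz_on {y. y \<bullet> e = 0} \<phi>"
    and epi: "\<Omega> \<inter> ball z r = {x \<in> ball z r. \<phi> (x - (x \<bullet> e) *\<^sub>R e) < x \<bullet> e}"
    using assms unfolding lipschitz_boundary_def by blast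
  have L: "0 \<le> L" using lip by (rule lipschitz_on_nonneg)
  define \<kappa> where "\<kappa> = 1 / (L + 2)"
  have \<kappa>: "0 < \<kappa>" "\<kappa> \<le> 1 / 2" "(L + 1) * \<kappa> \<le> 1"
    using L by (auto simp: \<kappa>_def field_simps)
  have ee: "e \<bullet> e = 1" using e by (simp add: dot_square_norm)
  \<comment> \<open>With a quarter of the radius, y is closer to z than r / 4, the shift is at most
    r / 4 and the ball adds at most r / 8; so w stays where the graph describes the domain.\<close>
  have "w \<in> \<Omega>" if y: "y \<in> \<Omega>" "dist z y < r / 4" and t: "0 < t" "t \<le> r / 4" and w: "dist (y + t *\<^sub>R e) w \<le> \<kappa> * t" for y t w
  proof -
    have "\<kappa> * t \<le> (1 / 2) * t" using \<kappa> t by (intro mult_right_mono) auto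
    moreover have "dist y (y + t *\<^sub>R e) = t" using t e by (simp add: dist_norm)
    ultimately have "dist z w < r"
      using dist_triangle[of z w y] dist_triangle[of y w "y + t *\<^sub>R e"] y t w by linarith
    moreover have "\<phi> (w - (w \<bullet> e) *\<^sub>R e) < w \<bullet> e"
    proof -
      define d where "d = w - (y + t *\<^sub>R e)"
      have d: "norm d \<le> \<kappa> * t" using w by (simp add: d_def dist_norm norm_minus_commute)
      have "(w - (w \<bullet> e) *\<^sub>R e) - (y - (y \<bullet> e) *\<^sub>R e) = d - (d \<bullet> e) *\<^sub>R e"
        by (simp add: d_def inner_diff_left inner_add_left ee algebra_simps)
      then have "dist (w - (w \<bullet> e) *\<^sub>R e) (y - (y \<bullet> e) *\<^sub>R e) \<le> \<kappa> * t"
        using norm_remove_component_le[OF e, of d] d by (simp add: dist_norm)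
      moreover have "dist (\<phi> (w - (w \<bullet> e) *\<^sub>R e)) (\<phi> (y - (y \<bullet> e) *\<^sub>R e)) \<le> L * dist (w - (w \<bullet> e) *\<^sub>R e) (y - (y \<bullet> e) *\<^sub>R e)"
        by (rule lipschitz_onD[OF lip]) (simp_all add: inner_diff_left ee)
      ultimately have "dist (\<phi> (w - (w \<bullet> e) *\<^sub>R e)) (\<phi> (y - (y \<bullet> e) *\<^sub>R e)) \<le> L * (\<kappa> * t)"
        using L by (meson mult_left_mono order_trans)
      then have 1: "\<phi> (w - (w \<bullet> e) *\<^sub>R e) \<le> \<phi> (y - (y \<bullet> e) *\<^sub>R e) + L * (\<kappa> * t)"
        by (simp add: dist_real_def)
      have "y \<in> ball z r" using y r by simp
      then have 2: "\<phi> (y - (y \<bullet> e) *\<^sub>R e) < y \<bullet> e" using epi y by blast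
      have "w \<bullet> e = y \<bullet> e + t + d \<bullet> e" by (simp add: d_def inner_diff_left inner_add_left ee)
      moreover have "\<bar>d \<bullet> e\<bar> \<le> \<kappa> * t" using Cauchy_Schwarz_ineq2[of d e] d e by simp
      ultimately have 3: "y \<bullet> e + t - \<kappa> * t \<le> w \<bullet> e" by linarith
      have "(L + 1) * \<kappa> * t \<le> 1 * t" using \<kappa> t by (intro mult_right_mono) auto
      then have "L * (\<kappa> * t) \<le> t - \<kappa> * t" by (simp add: algebra_simps)
      with 1 2 3 show ?thesis by linarith
    qed
    ultimately have "w \<in> \<Omega> \<inter> ball z r" unfolding epi by simp
    then show ?thesis by simp
  qed
  then have "\<forall>y\<in>\<Omega> \<inter> ball z (r / 4). \<forall>t. 0 < t \<and> t \<le> r / 4 \<longrightarrow> cball (y + t *\<^sub>R e) (\<kappa> * t) \<subseteq> \<Omega>"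
    by (auto simp: subset_iff)
  then show ?thesis
    using e \<kappa> r by (intro exI[of _ e] exI[of _ \<kappa>] exI[of _ "r / 4"]) auto
qed

text \<open>Compactness of the closure leaves finitely many directions, so that an almost everywhere
  statement can be made for all of them simultaneously. Around a point of the open set itself any
  unit vector will do.\<close>

lemma lipschitz_domain_directions:
  fixes \<Omega> :: "'a::euclidean_space set"
  assumes "open \<Omega>" "bounded \<Omega>" "lipschitz_boundary \<Omega>"
  obtains E \<kappa> T \<delta> where "finite E" "\<And>e. e \<in> E \<Longrightarrow> norm e = 1" "0 < \<kappa>" "\<kappa> \<le> 1 / 2" "0 < T" "0 < \<delta>"
    "\<And>x. x \<in> \<Omega> \<Longrightarrow> \<exists>e\<in>E. \<forall>y\<in>\<Omega>. dist x y < \<delta> \<longrightarrow> (\<forall>t. 0 < t \<and> t \<le> T \<longrightarrow> cball (y + t *\<^sub>R e) (\<kappa> * t) \<subseteq> \<Omega>)"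
proof -
  have "\<exists>e \<kappa> \<rho>. norm e = 1 \<and> 0 < \<kappa> \<and> \<kappa> \<le> 1 / 2 \<and> 0 < \<rho> \<and>
    (\<forall>y\<in>\<Omega> \<inter> ball z \<rho>. \<forall>t. 0 < t \<and> t \<le> \<rho> \<longrightarrow> cball (y + t *\<^sub>R e) (\<kappa> * t) \<subseteq> \<Omega>)" if z: "z \<in> closure \<Omega>" for z
  proof (cases "z \<in> \<Omega>")
    case False
    then show ?thesis
      using assms z by (intro lipschitz_boundary_cone) (auto simp: frontier_def interior_open)
  next
    case True
    then obtain r where r: "0 < r" "ball z r \<subseteq> \<Omega>" using assms(1) openE by blast
    obtain e :: 'a where e: "norm e = 1" using norm_Basis nonempty_Basis by blast
    have "w \<in> ball z r" if "dist z y < r / 4" "0 < t" "t \<le> r / 4" "dist (y + t *\<^sub>R e) w \<le> 1 / 2 * t" for y t w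
      using dist_triangle[of z w y] dist_triangle[of y w "y + t *\<^sub>R e"] that e by (simp add: dist_norm)
    then have "\<forall>y\<in>\<Omega> \<inter> ball z (r / 4). \<forall>t. 0 < t \<and> t \<le> r / 4 \<longrightarrow> cball (y + t *\<^sub>R e) (1 / 2 * t) \<subseteq> \<Omega>"
      using r(2) by (auto simp: subset_iff)
    then show ?thesis
      using e r by (intro exI[of _ e] exI[of _ "1 / 2"] exI[of _ "r / 4"]) auto
  qed
  then obtain e \<kappa> \<rho> where ekr: "\<And>z. z \<in> closure \<Omega> \<Longrightarrow> norm (e z) = 1 \<and> 0 < \<kappa> z \<and> \<kappa> z \<le> 1 / 2 \<and> 0 < \<rho> z \<and>
    (\<forall>y\<in>\<Omega> \<inter> ball z (\<rho> z). \<forall>t. 0 < t \<and> t \<le> \<rho> z \<longrightarrow> cball (y + t *\<^sub>R e z) (\<kappa> z * t) \<subseteq> \<Omega>)"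
    by metis
  have "compact (closure \<Omega>)" using assms(2) by (simp add: compact_closure)
  moreover have "closure \<Omega> \<subseteq> (\<Union>z\<in>closure \<Omega>. ball z (\<rho> z / 2))" using ekr by force
  ultimately obtain Z where Z: "Z \<subseteq> closure \<Omega>" "finite Z" "closure \<Omega> \<subseteq> (\<Union>z\<in>Z. ball z (\<rho> z / 2))"
    using compactE_image[of "closure \<Omega>" "closure \<Omega>" "\<lambda>z. ball z (\<rho> z / 2)"] by auto
  \<comment> \<open>The inserted numbers keep the minima meaningful if \<open>Z\<close> is empty;
    here 1 / 2 is at the same time the required bound for the aperture.\<close>
  define K where "K = Min (insert (1 / 2) (\<kappa> ` Z))"
  define T where "T = Min (insert 1 (\<rho> ` Z))"
  have "K \<le> 1 / 2" unfolding K_def by (rule Min_le) (use Z(2) in auto)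
  moreover have "0 < K" "\<And>z. z \<in> Z \<Longrightarrow> K \<le> \<kappa> z"
    unfolding K_def using Z(1,2) ekr by (auto simp: Min_gr_iff intro!: Min_le)
  ultimately have K: "0 < K" "K \<le> 1 / 2" "\<And>z. z \<in> Z \<Longrightarrow> K \<le> \<kappa> z" by auto
  have T: "0 < T" "\<And>z. z \<in> Z \<Longrightarrow> T \<le> \<rho> z"
    unfolding T_def using Z(1,2) ekr by (auto simp: Min_gr_iff intro!: Min_le)
  show thesis
  proof (rule that[of "e ` Z" K T "T / 2"])
    fix x assume x: "x \<in> \<Omega>"
    then have "x \<in> closure \<Omega>" using closure_subset by blast
    then obtain z where z: "z \<in> Z" "dist z x < \<rho> z / 2" using Z(3) by auto
    show "\<exists>e\<in>e ` Z. \<forall>y\<in>\<Omega>. dist x y < T / 2 \<longrightarrow> (\<forall>t. 0 < t \<and> t \<le> T \<longrightarrow> cball (y + t *\<^sub>R e) (K * t) \<subseteq> \<Omega>)"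
    proof (intro bexI[of _ "e z"] ballI impI allI)
      fix y t assume y: "y \<in> \<Omega>" "dist x y < T / 2" and t: "0 < t \<and> t \<le> T"
      have "dist z y < \<rho> z" using dist_triangle[of z y x] z y T(2)[of z] by simp
      then have "cball (y + t *\<^sub>R e z) (\<kappa> z * t) \<subseteq> \<Omega>"
      proof -
        have "z \<in> closure \<Omega>" using z Z(1) by blast
        then have "\<forall>y\<in>\<Omega> \<inter> ball z (\<rho> z). \<forall>t. 0 < t \<and> t \<le> \<rho> z \<longrightarrow> cball (y + t *\<^sub>R e z) (\<kappa> z * t) \<subseteq> \<Omega>"
          using ekr by blast
        moreover have "y \<in> \<Omega> \<inter> ball z (\<rho> z)" using y \<open>dist z y < \<rho> z\<close> by simp
        moreover have "0 < t \<and> t \<le> \<rho> z" using t T(2)[OF z(1)] by simp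
        ultimately show ?thesis by blast
      qed
      moreover have "K * t \<le> \<kappa> z * t" using K(3)[OF z(1)] t by (intro mult_right_mono) auto
      ultimately show "cball (y + t *\<^sub>R e z) (K * t) \<subseteq> \<Omega>"
        by (meson cball_subset_cball_iff order_trans subset_cball)
    qed (use z in auto)
  qed (use Z K T ekr in auto)
qed

section \<open>Convergence of averages\<close>

lemma nn_integral_lborel_shift:
  fixes f :: "'a::euclidean_space \<Rightarrow> ennreal"
  assumes [measurable]: "f \<in> borel_measurable borel"
  shows "(\<integral>\<^sup>+x. f (x + z) \<partial>lborel) = (\<integral>\<^sup>+x. f x \<partial>lborel)"
proof -
  have "(\<integral>\<^sup>+x. f x \<partial>lborel) = (\<integral>\<^sup>+x. f x \<partial>distr lborel borel ((+) z))"
    by (simp add: lborel_distr_plus)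
  also have "\<dots> = (\<integral>\<^sup>+x. f (x + z) \<partial>lborel)"
    by (subst nn_integral_distr) (auto simp: add.commute)
  finally show ?thesis ..
qed

text \<open>Take K compact inside A and U open around A. A shift that moves K by less than its
  distance to the complement of U changes the indicator of A only at points which, shifted or
  unshifted, lie in \<open>U - K\<close>, a set of small measure.\<close>

lemma indicator_translation_continuous:
  fixes A :: "'a::euclidean_space set"
  assumes A: "A \<in> sets borel" "emeasure lborel A < \<infinity>" and \<epsilon>: "0 < \<epsilon>"
  shows "\<exists>\<delta>>0. \<forall>z. norm z < \<delta> \<longrightarrow> (\<integral>\<^sup>+x. ennreal \<bar>indicator A (x + z) - indicator A x\<bar> \<partial>lborel) \<le> ennreal \<epsilon>"
proof -
  have leb: "A \<in> sets lebesgue" using A by auto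
  obtain U where U: "open U" "A \<subseteq> U" "U - A \<in> lmeasurable" "emeasure lebesgue (U - A) < ennreal (\<epsilon> / 6)"
    using sets_lebesgue_outer_open[OF leb, of "\<epsilon> / 6"] \<epsilon> by auto
  obtain F where F: "closed F" "F \<subseteq> A" "A - F \<in> lmeasurable" "emeasure lebesgue (A - F) < ennreal (\<epsilon> / 6)"
    using sets_lebesgue_inner_closed[OF leb, of "\<epsilon> / 6"] \<epsilon> by auto
  have Fb: "F \<in> sets borel" "U \<in> sets borel" using F U by auto
  have "emeasure lborel F < \<infinity>" using emeasure_mono[OF F(2), of lborel] A by (auto intro: le_less_trans)
  text \<open>Cutting \<open>F\<close> off outside a large ball makes it compact.\<close>
  have "(\<lambda>n. emeasure lborel (F - cball 0 (real n))) \<longlonglongrightarrow> emeasure lborel (\<Inter>n. F - cball 0 (real n))"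
  proof (rule Lim_emeasure_decseq)
    show "emeasure lborel (F - cball 0 (real n)) \<noteq> \<infinity>" for n
      using emeasure_mono[of "F - cball 0 (real n)" F lborel] Fb \<open>emeasure lborel F < \<infinity>\<close> by auto
  qed (use Fb in \<open>auto simp: decseq_def\<close>)
  moreover have "(\<Inter>n. F - cball 0 (real n)) = {}"
    using real_arch_simple by (force simp: dist_norm)
  ultimately have "(\<lambda>n. emeasure lborel (F - cball 0 (real n))) \<longlonglongrightarrow> 0"
    by (simp only: emeasure_empty)
  then have "eventually (\<lambda>n. emeasure lborel (F - cball 0 (real n)) < ennreal (\<epsilon> / 6)) sequentially"
    using \<epsilon> by (intro order_tendstoD) auto
  then obtain n where n: "emeasure lborel (F - cball 0 (real n)) < ennreal (\<epsilon> / 6)"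
    by (auto simp: eventually_sequentially)
  define K where "K = F \<inter> cball 0 (real n)"
  have K: "compact K" "K \<subseteq> U" using F U by (auto simp: K_def closed_Int_compact)
  define R where "R = U - K"
  have R: "R \<in> sets borel" using Fb by (auto simp: R_def K_def)
  \<comment> \<open>Three sets of measure below \<open>\<epsilon> / 6\<close> make
    \<open>\<epsilon> / 2\<close>; the set R is counted twice below, once shifted.\<close>
  have "emeasure lborel R \<le> emeasure lborel ((U - A) \<union> (A - F) \<union> (F - cball 0 (real n)))"
    using Fb A by (intro emeasure_mono) (auto simp: R_def K_def)
  also have "\<dots> \<le> emeasure lborel (U - A) + emeasure lborel (A - F) + emeasure lborel (F - cball 0 (real n))"
    using Fb A by (intro order_trans[OF emeasure_subadditive] add_right_mono emeasure_subadditive) auto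
  also have "\<dots> \<le> ennreal (\<epsilon> / 6) + ennreal (\<epsilon> / 6) + ennreal (\<epsilon> / 6)"
    using U(4) F(4) n Fb A by (intro add_mono) auto
  also have "\<dots> = ennreal (\<epsilon> / 2)" using \<epsilon> by (simp flip: ennreal_plus)
  finally have mR: "emeasure lborel R \<le> ennreal (\<epsilon> / 2)" .
  obtain \<delta> where \<delta>: "0 < \<delta>" "(\<Union>x\<in>K. ball x \<delta>) \<subseteq> U"
    using compact_subset_open_imp_ball_epsilon_subset[OF K(1) U(1) K(2)] by blast
  have "(\<integral>\<^sup>+x. ennreal \<bar>indicator A (x + z) - indicator A x\<bar> \<partial>lborel) \<le> ennreal \<epsilon>" if z: "norm z < \<delta>" for z
  proof -
    have KU: "x \<in> K \<Longrightarrow> x + z \<in> U" "x + z \<in> K \<Longrightarrow> x \<in> U" for x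
      using \<delta>(2) z by (auto simp: subset_iff dist_norm) (metis add_diff_cancel_left' norm_minus_commute)+
    have "(\<integral>\<^sup>+x. ennreal \<bar>indicator A (x + z) - indicator A x\<bar> \<partial>lborel) \<le> (\<integral>\<^sup>+x. indicator R (x + z) + indicator R x \<partial>lborel)"
    proof (intro nn_integral_mono)
      fix x
      show "ennreal \<bar>indicator A (x + z) - indicator A x\<bar> \<le> indicator R (x + z) + indicator R x"
        using KU[of x] U(2) F(2) by (auto simp: indicator_def R_def K_def)
    qed
    also have "\<dots> = 2 * emeasure lborel R"
      using R nn_integral_lborel_shift[of "indicator R" z]
      by (subst nn_integral_add) (auto simp: mult_2)
    also have "\<dots> \<le> 2 * ennreal (\<epsilon> / 2)" by (intro mult_left_mono mR) auto
    also have "\<dots> = ennreal \<epsilon>" using \<epsilon> by (simp flip: ennreal_numeral ennreal_mult)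
    finally show ?thesis .
  qed
  with \<delta>(1) show ?thesis by blast
qed

text \<open>Induction over integrable functions. In the limit step the error of the approximation
  enters twice, once at the shifted point, and both integrals agree by translation invariance; this
  explains the thirds of \<epsilon>.\<close>

lemma L1_translation_continuous:
  fixes f :: "'a::euclidean_space \<Rightarrow> real"
  assumes "integrable lborel f"
  shows "\<forall>\<epsilon>>0. \<exists>\<delta>>0. \<forall>z. norm z < \<delta> \<longrightarrow> (\<integral>\<^sup>+x. ennreal \<bar>f (x + z) - f x\<bar> \<partial>lborel) \<le> ennreal \<epsilon>"
  using assms
proof (induction rule: integrable_induct)
  case (base A c)
  show ?case
  proof (intro allI impI)
    fix \<epsilon> :: real assume \<epsilon>: "0 < \<epsilon>"
    define \<epsilon>' where "\<epsilon>' = \<epsilon> / (\<bar>c\<bar> + 1)"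
    have \<epsilon>': "0 < \<epsilon>'" "\<bar>c\<bar> * \<epsilon>' \<le> \<epsilon>" using \<epsilon> by (auto simp: \<epsilon>'_def field_simps)
    obtain \<delta> where \<delta>: "0 < \<delta>" "\<And>z. norm z < \<delta> \<Longrightarrow> (\<integral>\<^sup>+x. ennreal \<bar>indicator A (x + z) - indicator A x\<bar> \<partial>lborel) \<le> ennreal \<epsilon>'"
      using indicator_translation_continuous[of A \<epsilon>'] base \<epsilon>' by auto
    have [measurable]: "A \<in> sets borel" using base by simp
    have "(\<integral>\<^sup>+x. ennreal \<bar>indicator A (x + z) *\<^sub>R c - indicator A x *\<^sub>R c\<bar> \<partial>lborel) \<le> ennreal \<epsilon>" if "norm z < \<delta>" for z
    proof -
      have "(\<integral>\<^sup>+x. ennreal \<bar>indicator A (x + z) *\<^sub>R c - indicator A x *\<^sub>R c\<bar> \<partial>lborel) =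
        (\<integral>\<^sup>+x. ennreal \<bar>c\<bar> * ennreal \<bar>indicator A (x + z) - indicator A x\<bar> \<partial>lborel)"
        by (intro nn_integral_cong) (auto simp: abs_mult indicator_def)
      also have "\<dots> = ennreal \<bar>c\<bar> * (\<integral>\<^sup>+x. ennreal \<bar>indicator A (x + z) - indicator A x\<bar> \<partial>lborel)"
        by (intro nn_integral_cmult) measurable
      also have "\<dots> \<le> ennreal \<bar>c\<bar> * ennreal \<epsilon>'" by (intro mult_left_mono \<delta> that) auto
      also have "\<dots> \<le> ennreal \<epsilon>" using \<epsilon>' by (simp add: ennreal_leI flip: ennreal_mult)
      finally show ?thesis .
    qed
    with \<delta>(1) show "\<exists>\<delta>>0. \<forall>z. norm z < \<delta> \<longrightarrow> (\<integral>\<^sup>+x. ennreal \<bar>indicator A (x + z) *\<^sub>R c - indicator A x *\<^sub>R c\<bar> \<partial>lborel) \<le> ennreal \<epsilon>"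
      by blast
  qed
next
  case (add f g)
  have [measurable]: "f \<in> borel_measurable borel" "g \<in> borel_measurable borel"
    using add by (auto simp: borel_measurable_integrable)
  show ?case
  proof (intro allI impI)
    fix \<epsilon> :: real assume \<epsilon>: "0 < \<epsilon>"
    then have h: "0 < \<epsilon> / 2" by simp
    obtain \<delta>1 where \<delta>1: "0 < \<delta>1" "\<And>z. norm z < \<delta>1 \<Longrightarrow> (\<integral>\<^sup>+x. ennreal \<bar>f (x + z) - f x\<bar> \<partial>lborel) \<le> ennreal (\<epsilon> / 2)"
      using add(3) h by blast
    obtain \<delta>2 where \<delta>2: "0 < \<delta>2" "\<And>z. norm z < \<delta>2 \<Longrightarrow> (\<integral>\<^sup>+x. ennreal \<bar>g (x + z) - g x\<bar> \<partial>lborel) \<le> ennreal (\<epsilon> / 2)"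
      using add(4) h by blast
    have "(\<integral>\<^sup>+x. ennreal \<bar>f (x + z) + g (x + z) - (f x + g x)\<bar> \<partial>lborel) \<le> ennreal \<epsilon>" if "norm z < min \<delta>1 \<delta>2" for z
    proof -
      have "(\<integral>\<^sup>+x. ennreal \<bar>f (x + z) + g (x + z) - (f x + g x)\<bar> \<partial>lborel) \<le>
        (\<integral>\<^sup>+x. ennreal \<bar>f (x + z) - f x\<bar> + ennreal \<bar>g (x + z) - g x\<bar> \<partial>lborel)"
        by (intro nn_integral_mono) (auto simp flip: ennreal_plus intro!: ennreal_leI)
      also have "\<dots> = (\<integral>\<^sup>+x. ennreal \<bar>f (x + z) - f x\<bar> \<partial>lborel) + (\<integral>\<^sup>+x. ennreal \<bar>g (x + z) - g x\<bar> \<partial>lborel)"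
        by (intro nn_integral_add) measurable
      also have "\<dots> \<le> ennreal (\<epsilon> / 2) + ennreal (\<epsilon> / 2)"
        using that by (intro add_mono \<delta>1 \<delta>2) auto
      also have "\<dots> = ennreal \<epsilon>" using \<epsilon> by (simp flip: ennreal_plus)
      finally show ?thesis .
    qed
    with \<delta>1(1) \<delta>2(1) show "\<exists>\<delta>>0. \<forall>z. norm z < \<delta> \<longrightarrow> (\<integral>\<^sup>+x. ennreal \<bar>f (x + z) + g (x + z) - (f x + g x)\<bar> \<partial>lborel) \<le> ennreal \<epsilon>"
      by (intro exI[of _ "min \<delta>1 \<delta>2"]) auto
  qed
next
  case (lim f s)
  have [measurable]: "f \<in> borel_measurable borel" "\<And>i. s i \<in> borel_measurable borel"
    using lim by (auto simp: borel_measurable_integrable)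
  have "(\<lambda>i. \<integral>\<^sup>+x. ennreal (norm (f x - s i x)) \<partial>lborel) \<longlonglongrightarrow> 0"
  proof (rule nn_integral_dominated_convergence_norm[where w="\<lambda>x. 2 * norm (f x)"])
    show "(\<integral>\<^sup>+x. ennreal (2 * norm (f x)) \<partial>lborel) < \<infinity>"
      using lim(4) by (simp add: ennreal_mult nn_integral_cmult integrable_iff_bounded ennreal_mult_less_top)
  qed (use lim in auto)
  then have L1: "(\<lambda>i. \<integral>\<^sup>+x. ennreal \<bar>s i x - f x\<bar> \<partial>lborel) \<longlonglongrightarrow> 0"
    by (simp add: abs_minus_commute)
  show ?case
  proof (intro allI impI)
    fix \<epsilon> :: real assume \<epsilon>: "0 < \<epsilon>"
    then have h: "0 < \<epsilon> / 3" by simp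
    then have "eventually (\<lambda>i. (\<integral>\<^sup>+x. ennreal \<bar>s i x - f x\<bar> \<partial>lborel) < ennreal (\<epsilon> / 3)) sequentially"
      using L1 by (intro order_tendstoD) auto
    then obtain i where "\<forall>n\<ge>i. (\<integral>\<^sup>+x. ennreal \<bar>s n x - f x\<bar> \<partial>lborel) < ennreal (\<epsilon> / 3)"
      unfolding eventually_sequentially by blast
    then have i: "(\<integral>\<^sup>+x. ennreal \<bar>s i x - f x\<bar> \<partial>lborel) \<le> ennreal (\<epsilon> / 3)"
      by (auto intro: less_imp_le)
    obtain \<delta> where \<delta>: "0 < \<delta>" "\<And>z. norm z < \<delta> \<Longrightarrow> (\<integral>\<^sup>+x. ennreal \<bar>s i (x + z) - s i x\<bar> \<partial>lborel) \<le> ennreal (\<epsilon> / 3)"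
      using lim(5) h by blast
    have "(\<integral>\<^sup>+x. ennreal \<bar>f (x + z) - f x\<bar> \<partial>lborel) \<le> ennreal \<epsilon>" if "norm z < \<delta>" for z
    proof -
      have "(\<integral>\<^sup>+x. ennreal \<bar>f (x + z) - f x\<bar> \<partial>lborel) \<le>
        (\<integral>\<^sup>+x. ennreal \<bar>s i (x + z) - f (x + z)\<bar> + (ennreal \<bar>s i (x + z) - s i x\<bar> + ennreal \<bar>s i x - f x\<bar>) \<partial>lborel)"
        by (intro nn_integral_mono) (auto simp flip: ennreal_plus intro!: ennreal_leI)
      also have "\<dots> = (\<integral>\<^sup>+x. ennreal \<bar>s i (x + z) - f (x + z)\<bar> \<partial>lborel) +
        ((\<integral>\<^sup>+x. ennreal \<bar>s i (x + z) - s i x\<bar> \<partial>lborel) + (\<integral>\<^sup>+x. ennreal \<bar>s i x - f x\<bar> \<partial>lborel))"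
        by (subst nn_integral_add, measurable, subst nn_integral_add, measurable)
      also have "(\<integral>\<^sup>+x. ennreal \<bar>s i (x + z) - f (x + z)\<bar> \<partial>lborel) = (\<integral>\<^sup>+x. ennreal \<bar>s i x - f x\<bar> \<partial>lborel)"
        by (rule nn_integral_lborel_shift) measurable
      also have "(\<integral>\<^sup>+x. ennreal \<bar>s i x - f x\<bar> \<partial>lborel) + ((\<integral>\<^sup>+x. ennreal \<bar>s i (x + z) - s i x\<bar> \<partial>lborel) + (\<integral>\<^sup>+x. ennreal \<bar>s i x - f x\<bar> \<partial>lborel)) \<le>
        ennreal (\<epsilon> / 3) + (ennreal (\<epsilon> / 3) + ennreal (\<epsilon> / 3))"
        by (intro add_mono i \<delta> that)
      also have "\<dots> = ennreal \<epsilon>" using \<epsilon> by (simp flip: ennreal_plus)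
      finally show ?thesis .
    qed
    with \<delta>(1) show "\<exists>\<delta>>0. \<forall>z. norm z < \<delta> \<longrightarrow> (\<integral>\<^sup>+x. ennreal \<bar>f (x + z) - f x\<bar> \<partial>lborel) \<le> ennreal \<epsilon>"
      by blast
  qed
qed


section \<open>Almost everywhere convergence of the off-centre averages\<close>

definition bump_mass :: "'a::euclidean_space itself \<Rightarrow> real" where
  "bump_mass _ = enn2real (\<integral>\<^sup>+z. ennreal (bump (z::'a)) \<partial>lborel)"

lemma borel_measurable_bump [measurable]: "bump \<in> borel_measurable borel"
  using continuous_mollifier[of UNIV 0 1] by (intro borel_measurable_continuous_onI) (simp add: mollifier_def[abs_def])

lemma bump_mass:
  shows "0 < bump_mass TYPE('a::euclidean_space)" and "(\<integral>\<^sup>+z. ennreal (bump (z::'a)) \<partial>lborel) = ennreal (bump_mass TYPE('a))"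
proof -
  have "(\<integral>\<^sup>+z. ennreal (bump (z::'a)) \<partial>lborel) \<le> (\<integral>\<^sup>+z. indicator (ball (0::'a) 1) z \<partial>lborel)"
  proof (intro nn_integral_mono)
    fix z :: 'a
    show "ennreal (bump z) \<le> indicator (ball 0 1) z"
      using bump_le[of z] bump_eq_0_iff[of z] by (cases "norm z < 1") (auto simp: not_less)
  qed
  also have "\<dots> < top"
    using emeasure_bounded_finite[of "ball (0::'a) 1"] by simp
  finally have fin: "(\<integral>\<^sup>+z. ennreal (bump (z::'a)) \<partial>lborel) < top" .
  have "(\<integral>\<^sup>+z. ennreal (bump (z::'a)) \<partial>lborel) \<noteq> 0"
  proof
    assume "(\<integral>\<^sup>+z. ennreal (bump (z::'a)) \<partial>lborel) = 0"
    then have "AE z::'a in lborel. ennreal (bump z) = 0"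
      by (subst (asm) nn_integral_0_iff_AE) auto
    then have "AE z::'a in lborel. z \<notin> ball 0 1"
    proof (rule AE_mp, intro AE_I2 impI)
      fix z :: 'a
      assume "ennreal (bump z) = 0"
      then have "bump z = 0" using bump_nonneg[of z] by (simp add: ennreal_eq_0_iff)
      then show "z \<notin> ball 0 1" by (simp add: bump_eq_0_iff)
    qed
    then have "emeasure lborel (ball (0::'a) 1) = 0"
      by (subst (asm) AE_iff_measurable[of "ball 0 1"]) auto
    then show False
      using content_ball_pos[of 1 "0::'a"] by (simp add: measure_def)
  qed
  with fin show "0 < bump_mass TYPE('a)" "(\<integral>\<^sup>+z. ennreal (bump (z::'a)) \<partial>lborel) = ennreal (bump_mass TYPE('a))"
    by (auto simp: bump_mass_def enn2real_positive_iff zero_less_iff_neq_zero)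
qed

lemma nn_integral_mollifier:
  fixes c :: "'a::euclidean_space"
  assumes "0 < \<rho>"
  shows "(\<integral>\<^sup>+y. ennreal (mollifier c \<rho> y) \<partial>lborel) = ennreal (bump_mass TYPE('a))"
proof -
  have [measurable]: "mollifier c \<rho> \<in> borel_measurable borel"
    by (intro borel_measurable_continuous_onI continuous_mollifier)
  have "(\<integral>\<^sup>+y. ennreal (mollifier c \<rho> y) \<partial>lborel) =
    (\<integral>\<^sup>+y. ennreal (mollifier c \<rho> y) \<partial>density (distr lborel borel (\<lambda>x. c + \<rho> *\<^sub>R x)) (\<lambda>_. ennreal (\<bar>\<rho>\<bar> ^ DIM('a))))"
    using lborel_affine[of \<rho> c] assms by simp
  also have "\<dots> = (\<integral>\<^sup>+x. ennreal (\<bar>\<rho>\<bar> ^ DIM('a)) * ennreal (mollifier c \<rho> (c + \<rho> *\<^sub>R x)) \<partial>lborel)"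
    by (simp add: nn_integral_density nn_integral_distr)
  also have "\<dots> = (\<integral>\<^sup>+x. ennreal (bump (x::'a)) \<partial>lborel)"
    using assms by (intro nn_integral_cong) (simp add: mollifier_def bump_nonneg flip: ennreal_mult)
  finally show ?thesis by (simp add: bump_mass)
qed

text \<open>The averages are taken off centre, but they are still means of translates of u by
  vectors that shrink to 0. Continuity of translations gives convergence in
  \<open>L\<^sup>1\<close>, and a subsequence converges almost everywhere. The factor
  \<open>bump_mass\<close> is the mass of the unnormalised kernel.\<close>

lemma mollify_tendsto_AE:
  fixes \<Omega> :: "'a::euclidean_space set"
  assumes \<Omega>: "open \<Omega>" and u: "integrable (lebesgue_on \<Omega>) u" and \<kappa>: "0 < \<kappa>" "\<kappa> \<le> 1"
    and \<tau>: "\<And>j. 0 < \<tau> j" "\<tau> \<longlonglongrightarrow> 0" and e: "norm e = 1"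
  shows "\<exists>r. strict_mono r \<and>
    (AE x in lebesgue_on \<Omega>. (\<lambda>i. mollify \<Omega> u (x + \<tau> (r i) *\<^sub>R e) (\<kappa> * \<tau> (r i))) \<longlonglongrightarrow> bump_mass TYPE('a) * u x)"
proof -
  define m where "m = bump_mass TYPE('a)"
  have m: "0 < m" by (simp add: m_def bump_mass)
  have sets\<Omega>: "\<Omega> \<in> sets lebesgue" "\<Omega> \<inter> space lebesgue \<in> sets lebesgue" using \<Omega> by auto
  have int_u: "integrable lebesgue (\<lambda>x. indicator \<Omega> x *\<^sub>R u x)"
    using u sets\<Omega> by (subst (asm) integrable_restrict_space) auto
  \<comment> \<open>A Borel version of u, extended by 0 to the whole space, since translations and
    Fubini are applied to \<open>lborel\<close>.\<close>
  then obtain v where v [measurable]: "v \<in> borel_measurable lborel" and uv: "AE x in lborel. indicator \<Omega> x *\<^sub>R u x = v x"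
    using completion_ex_borel_measurable_real[of "\<lambda>x. indicator \<Omega> x *\<^sub>R u x" lborel] by auto
  have uv': "AE x in lebesgue. indicator \<Omega> x *\<^sub>R u x = v x"
    using uv by (rule AE_completion)
  have v_leb: "v \<in> borel_measurable lebesgue" using v by (rule measurable_completion)
  have "integrable lebesgue v"
    using int_u integrable_cong_AE[OF _ v_leb uv'] by auto
  then have int_v: "integrable lborel v"
    using v by (simp add: integrable_completion)
  have [measurable]: "mollifier c \<rho> \<in> borel_measurable borel" for c :: 'a and \<rho>
    by (intro borel_measurable_continuous_onI continuous_mollifier)
  have mol_eq: "mollify \<Omega> u c \<rho> = (LINT y|lborel. v y * mollifier c \<rho> y)" for c \<rho>
  proof -
    have "mollify \<Omega> u c \<rho> = (LINT y|lebesgue. indicator \<Omega> y *\<^sub>R (u y * mollifier c \<rho> y))"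
      unfolding mollify_def using sets\<Omega> by (intro integral_restrict_space) auto
    also have "\<dots> = (LINT y|lebesgue. v y * mollifier c \<rho> y)"
    proof (rule integral_cong_AE)
      have 1: "mollifier c \<rho> \<in> borel_measurable lebesgue"
        by (intro measurable_completion) simp
      have 2: "(\<lambda>x. indicator \<Omega> x *\<^sub>R u x) \<in> borel_measurable lebesgue" using int_u by auto
      have "(\<lambda>y. (indicator \<Omega> y *\<^sub>R u y) * mollifier c \<rho> y) \<in> borel_measurable lebesgue"
        using 1 2 by measurable
      then show "(\<lambda>y. indicator \<Omega> y *\<^sub>R (u y * mollifier c \<rho> y)) \<in> borel_measurable lebesgue"
        by (simp add: mult.assoc)
      show "(\<lambda>y. v y * mollifier c \<rho> y) \<in> borel_measurable lebesgue"
        using 1 v_leb by measurable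
      show "AE y in lebesgue. indicator \<Omega> y *\<^sub>R (u y * mollifier c \<rho> y) = v y * mollifier c \<rho> y"
        using uv' by eventually_elim (metis mult.assoc real_scaleR_def)
    qed
    also have "\<dots> = (LINT y|lborel. v y * mollifier c \<rho> y)"
      by (intro integral_completion) measurable
    finally show ?thesis .
  qed
  define W where "W j x = mollify \<Omega> u (x + \<tau> j *\<^sub>R e) (\<kappa> * \<tau> j) - m * v x" for j x
  have \<rho>: "0 < \<kappa> * \<tau> j" for j using \<kappa> \<tau> by simp
  have W_meas [measurable]: "W j \<in> borel_measurable lborel" for j
    unfolding W_def mol_eq mollifier_def by measurable
  \<comment> \<open>The kernel has mass m, so \<open>m * v x\<close> can be brought under the
    integral. In the shifted variable z the kernel no longer depends on x, which prepares the
    exchange of the integrals.\<close>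
  have W_le: "ennreal \<bar>W j x\<bar> \<le> (\<integral>\<^sup>+z. ennreal \<bar>v (x + z) - v x\<bar> * ennreal (mollifier (\<tau> j *\<^sub>R e) (\<kappa> * \<tau> j) z) \<partial>lborel)" for j x
  proof -
    define c where "c = x + \<tau> j *\<^sub>R e"
    define \<rho> where "\<rho> = \<kappa> * \<tau> j"
    have \<rho>0: "0 < \<rho>" using \<rho> by (simp add: \<rho>_def)
    have b: "\<bar>mollifier c \<rho> y\<bar> \<le> 1 / \<rho> ^ DIM('a)" for y
      using mollifier_nonneg[OF \<rho>0, of c y] mollifier_le[OF \<rho>0, of c y] by simp
    have int1: "integrable lborel (\<lambda>y. v y * mollifier c \<rho> y)"
      using int_v b by (intro integrable_mult_bounded) auto
    have hm: "has_bochner_integral lborel (mollifier c \<rho>) m"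
      using nn_integral_mollifier[OF \<rho>0, of c] mollifier_nonneg[OF \<rho>0, of c] m unfolding m_def
      by (intro has_bochner_integral_nn_integral) auto
    have "W j x = (LINT y|lborel. v y * mollifier c \<rho> y - v x * mollifier c \<rho> y)"
      using int1 hm by (simp add: W_def mol_eq c_def \<rho>_def has_bochner_integral_iff)
    also have "\<dots> = (LINT y|lborel. (v y - v x) * mollifier c \<rho> y)"
      by (simp add: left_diff_distrib)
    finally have "ennreal \<bar>W j x\<bar> \<le> (\<integral>\<^sup>+y. ennreal (norm ((v y - v x) * mollifier c \<rho> y)) \<partial>lborel)"
      using integral_norm_bound_ennreal[of lborel "\<lambda>y. (v y - v x) * mollifier c \<rho> y"] int1 hm
      by (simp add: left_diff_distrib has_bochner_integral_iff)
    also have "\<dots> = (\<integral>\<^sup>+y. ennreal \<bar>v y - v x\<bar> * ennreal (mollifier c \<rho> y) \<partial>lborel)"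
      by (intro nn_integral_cong) (simp add: abs_mult ennreal_mult mollifier_nonneg[OF \<rho>0] abs_of_nonneg[OF mollifier_nonneg[OF \<rho>0]])
    also have "\<dots> = (\<integral>\<^sup>+z. ennreal \<bar>v (z + x) - v x\<bar> * ennreal (mollifier c \<rho> (z + x)) \<partial>lborel)"
      by (rule nn_integral_lborel_shift[symmetric]) measurable
    finally show ?thesis
      by (simp add: c_def \<rho>_def mollifier_def algebra_simps)
  qed
  \<comment> \<open>The kernel around \<open>\<tau> j *\<^sub>R e\<close> has radius
    \<open>\<kappa> * \<tau> j \<le> \<tau> j\<close>, so only shifts shorter than
    \<open>2 * \<tau> j\<close> occur.\<close>
  have W_int: "(\<integral>\<^sup>+x. ennreal \<bar>W j x\<bar> \<partial>lborel) \<le> ennreal (m * \<epsilon>)"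
    if \<delta>: "\<And>z. norm z < \<delta> \<Longrightarrow> (\<integral>\<^sup>+x. ennreal \<bar>v (x + z) - v x\<bar> \<partial>lborel) \<le> ennreal \<epsilon>" and \<tau>\<delta>: "2 * \<tau> j < \<delta>" for \<epsilon> \<delta> j
  proof -
    have "(\<integral>\<^sup>+x. ennreal \<bar>W j x\<bar> \<partial>lborel) \<le> (\<integral>\<^sup>+x. \<integral>\<^sup>+z. ennreal \<bar>v (x + z) - v x\<bar> * ennreal (mollifier (\<tau> j *\<^sub>R e) (\<kappa> * \<tau> j) z) \<partial>lborel \<partial>lborel)"
      by (intro nn_integral_mono W_le)
    also have "\<dots> = (\<integral>\<^sup>+z. \<integral>\<^sup>+x. ennreal \<bar>v (x + z) - v x\<bar> * ennreal (mollifier (\<tau> j *\<^sub>R e) (\<kappa> * \<tau> j) z) \<partial>lborel \<partial>lborel)"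
      by (rule lborel_pair.Fubini'[symmetric]) measurable
    also have "\<dots> \<le> (\<integral>\<^sup>+z. ennreal \<epsilon> * ennreal (mollifier (\<tau> j *\<^sub>R e) (\<kappa> * \<tau> j) z) \<partial>lborel)"
    proof (intro nn_integral_mono)
      fix z
      have "(\<integral>\<^sup>+x. ennreal \<bar>v (x + z) - v x\<bar> * ennreal (mollifier (\<tau> j *\<^sub>R e) (\<kappa> * \<tau> j) z) \<partial>lborel) =
        (\<integral>\<^sup>+x. ennreal \<bar>v (x + z) - v x\<bar> \<partial>lborel) * ennreal (mollifier (\<tau> j *\<^sub>R e) (\<kappa> * \<tau> j) z)"
        by (rule nn_integral_multc) measurable
      also have "\<dots> \<le> ennreal \<epsilon> * ennreal (mollifier (\<tau> j *\<^sub>R e) (\<kappa> * \<tau> j) z)"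
      proof (cases "mollifier (\<tau> j *\<^sub>R e) (\<kappa> * \<tau> j) z = 0")
        case False
        then have "dist (\<tau> j *\<^sub>R e) z < \<kappa> * \<tau> j" using mollifier_eq_0_iff[OF \<rho>, of "\<tau> j *\<^sub>R e" j z] by linarith
        moreover have "\<kappa> * \<tau> j \<le> 1 * \<tau> j" using \<kappa> \<tau>(1)[of j] by (intro mult_right_mono) auto
        moreover have "norm z \<le> norm (\<tau> j *\<^sub>R e) + dist (\<tau> j *\<^sub>R e) z"
          using norm_triangle_sub[of z "\<tau> j *\<^sub>R e"] by (simp add: dist_norm norm_minus_commute)
        moreover have "norm (\<tau> j *\<^sub>R e) = \<tau> j" using e \<tau>(1)[of j] by simp
        ultimately have "norm z < \<delta>" using \<tau>\<delta> by linarith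
        then show ?thesis by (intro mult_right_mono \<delta>) auto
      qed simp
      finally show "(\<integral>\<^sup>+x. ennreal \<bar>v (x + z) - v x\<bar> * ennreal (mollifier (\<tau> j *\<^sub>R e) (\<kappa> * \<tau> j) z) \<partial>lborel) \<le>
        ennreal \<epsilon> * ennreal (mollifier (\<tau> j *\<^sub>R e) (\<kappa> * \<tau> j) z)" .
    qed
    also have "\<dots> = ennreal \<epsilon> * ennreal m"
      by (subst nn_integral_cmult) (auto simp: nn_integral_mollifier[OF \<rho>] m_def)
    finally show ?thesis
      using m by (simp add: ennreal_mult'' mult.commute)
  qed
  have int_W: "integrable lborel (W j)" for j
  proof -
    have b: "integrable lborel (\<lambda>x. m * v x)" using int_v by simp
    have "(\<integral>\<^sup>+x. ennreal \<bar>W j x\<bar> \<partial>lborel) \<le> (\<integral>\<^sup>+z. \<integral>\<^sup>+x. ennreal \<bar>v (x + z) - v x\<bar> * ennreal (mollifier (\<tau> j *\<^sub>R e) (\<kappa> * \<tau> j) z) \<partial>lborel \<partial>lborel)"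
      by (subst lborel_pair.Fubini', measurable) (intro nn_integral_mono W_le)
    also have "\<dots> \<le> (\<integral>\<^sup>+z. (2 * (\<integral>\<^sup>+x. ennreal \<bar>v x\<bar> \<partial>lborel)) * ennreal (mollifier (\<tau> j *\<^sub>R e) (\<kappa> * \<tau> j) z) \<partial>lborel)"
    proof (intro nn_integral_mono)
      fix z
      have "(\<integral>\<^sup>+x. ennreal \<bar>v (x + z) - v x\<bar> \<partial>lborel) \<le> (\<integral>\<^sup>+x. ennreal \<bar>v (x + z)\<bar> + ennreal \<bar>v x\<bar> \<partial>lborel)"
        by (intro nn_integral_mono) (auto simp flip: ennreal_plus intro!: ennreal_leI)
      also have "\<dots> = 2 * (\<integral>\<^sup>+x. ennreal \<bar>v x\<bar> \<partial>lborel)"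
        using nn_integral_lborel_shift[of "\<lambda>x. ennreal \<bar>v x\<bar>" z] by (subst nn_integral_add) (auto simp: mult_2)
      finally show "(\<integral>\<^sup>+x. ennreal \<bar>v (x + z) - v x\<bar> * ennreal (mollifier (\<tau> j *\<^sub>R e) (\<kappa> * \<tau> j) z) \<partial>lborel) \<le>
        (2 * (\<integral>\<^sup>+x. ennreal \<bar>v x\<bar> \<partial>lborel)) * ennreal (mollifier (\<tau> j *\<^sub>R e) (\<kappa> * \<tau> j) z)"
        by (subst nn_integral_multc) (auto intro: mult_right_mono)
    qed
    also have "\<dots> = (2 * (\<integral>\<^sup>+x. ennreal \<bar>v x\<bar> \<partial>lborel)) * ennreal m"
      by (subst nn_integral_cmult) (auto simp: nn_integral_mollifier[OF \<rho>] m_def)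
    also have "\<dots> < \<infinity>"
      using int_v by (simp add: integrable_iff_bounded ennreal_mult_less_top)
    finally show ?thesis
      by (intro integrableI_bounded) auto
  qed
  have "(\<lambda>j. LINT x|lborel. norm (W j x)) \<longlonglongrightarrow> 0"
  proof (rule LIMSEQ_I)
    fix r :: real assume r: "0 < r"
    define \<epsilon> where "\<epsilon> = r / (2 * m)"
    have "0 < \<epsilon>" using r m by (simp add: \<epsilon>_def)
    then obtain \<delta> where \<delta>: "0 < \<delta>" "\<And>z. norm z < \<delta> \<Longrightarrow> (\<integral>\<^sup>+x. ennreal \<bar>v (x + z) - v x\<bar> \<partial>lborel) \<le> ennreal \<epsilon>"
      using L1_translation_continuous[OF int_v] by blast
    have "eventually (\<lambda>j. \<tau> j < \<delta> / 2) sequentially"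
      using \<tau>(2) \<delta>(1) by (intro order_tendstoD) auto
    then obtain n where "\<forall>j\<ge>n. \<tau> j < \<delta> / 2"
      unfolding eventually_sequentially by blast
    then have n: "2 * \<tau> j < \<delta>" if "n \<le> j" for j
      using that by auto
    have "norm ((LINT x|lborel. norm (W j x)) - 0) < r" if "n \<le> j" for j
    proof -
      have "ennreal (LINT x|lborel. norm (W j x)) = (\<integral>\<^sup>+x. ennreal (norm (W j x)) \<partial>lborel)"
        using int_W by (intro nn_integral_eq_integral[symmetric]) auto
      also have "\<dots> \<le> ennreal (m * \<epsilon>)" using W_int[OF \<delta>(2) n[OF that]] by simp
      finally have "(LINT x|lborel. norm (W j x)) \<le> m * \<epsilon>"
        using m \<open>0 < \<epsilon>\<close> by (subst (asm) ennreal_le_iff) auto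
      also have "m * \<epsilon> < r" using r m by (simp add: \<epsilon>_def)
      finally show ?thesis by simp
    qed
    then show "\<exists>no. \<forall>j\<ge>no. norm ((LINT x|lborel. norm (W j x)) - 0) < r" by blast
  qed
  then obtain r where r: "strict_mono r" "AE x in lborel. (\<lambda>i. W (r i) x) \<longlonglongrightarrow> 0"
    using tendsto_L1_AE_subseq[of lborel W] int_W by blast
  have "AE x in lborel. x \<in> \<Omega> \<longrightarrow> (\<lambda>i. mollify \<Omega> u (x + \<tau> (r i) *\<^sub>R e) (\<kappa> * \<tau> (r i))) \<longlonglongrightarrow> m * u x"
    using r(2) uv
  proof eventually_elim
    case (elim x)
    have "x \<in> \<Omega> \<Longrightarrow> v x = u x" using elim(2) by simp
    then show ?case
      using elim(1) unfolding W_def by (auto simp: LIM_zero_iff)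
  qed
  then have "AE x in lebesgue_on \<Omega>. (\<lambda>i. mollify \<Omega> u (x + \<tau> (r i) *\<^sub>R e) (\<kappa> * \<tau> (r i))) \<longlonglongrightarrow> m * u x"
    using sets\<Omega> by (subst AE_restrict_space_iff) (auto intro: AE_completion)
  with r(1) show ?thesis unfolding m_def by blast
qed

section \<open>Embeddings on Lipschitz domains\<close>

lemma sets_lebesgue_on_Int_borel: "A \<in> sets borel \<Longrightarrow> \<Omega> \<inter> A \<in> sets (lebesgue_on \<Omega>)"
  unfolding sets_restrict_space by (intro imageI) simp

text \<open>From the index \<open>k1\<close> on the scales are fine enough: the cones of length
  \<open>2 / \<kappa>\<close> times the scale fit into the domain, and points as close as the scale
  share a direction.\<close>

locale lipschitz_domain = regular_measure "lebesgue_on \<Omega>" "real DIM('a)" D c0 c1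
  for \<Omega> :: "'a::euclidean_space set" and D c0 c1 +
  fixes E :: "'a set" and \<kappa> T \<delta> :: real and k1 :: nat
  assumes open_dom: "open \<Omega>" and finite_dirs: "finite E" and norm_dirs: "e \<in> E \<Longrightarrow> norm e = 1"
    and \<kappa>: "0 < \<kappa>" "\<kappa> \<le> 1 / 2"
    and cone: "x \<in> \<Omega> \<Longrightarrow> \<exists>e\<in>E. \<forall>y\<in>\<Omega>. dist x y < \<delta> \<longrightarrow> (\<forall>t. 0 < t \<and> t \<le> T \<longrightarrow> cball (y + t *\<^sub>R e) (\<kappa> * t) \<subseteq> \<Omega>)"
    and \<delta>: "0 < \<delta>" and k1: "2 / \<kappa> * (D / 2 ^ k1) \<le> T" "D / 2 ^ k1 < \<delta>"
begin

text \<open>The factor makes \<open>scale j\<close> equal to half of the radius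
  \<open>\<kappa> * \<tau> j\<close> available in the cone. The means use one half as their radius;
  the other half is room for a shift between points at distance at most
  \<open>scale j\<close>.\<close>

definition \<tau> :: "nat \<Rightarrow> real" where
  "\<tau> j = 2 / \<kappa> * scale j"

definition mean :: "'a \<Rightarrow> nat \<Rightarrow> ('a \<Rightarrow> real) \<Rightarrow> 'a \<Rightarrow> real" where
  "mean e j u x = mollify \<Omega> u (x + \<tau> j *\<^sub>R e) (\<kappa> / 2 * \<tau> j) / bump_mass TYPE('a)"

definition admissible :: "'a \<Rightarrow> 'a \<Rightarrow> bool" where
  "admissible x e \<longleftrightarrow> norm e = 1 \<and> (\<forall>t. 0 < t \<and> t \<le> T \<longrightarrow> cball (x + t *\<^sub>R e) (\<kappa> * t) \<subseteq> \<Omega>)"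

text \<open>A dyadic piece of the Riesz potential of order one of \<open>norm (g y)\<close>. The
  lower cut is kept because it bounds the overlap of the annuli, on which the case of dimension one
  rests.\<close>

definition annulus_potential :: "('a \<Rightarrow> 'a) \<Rightarrow> nat \<Rightarrow> 'a \<Rightarrow> ennreal" where
  "annulus_potential g j x = ennreal (scale j powr (1 - real DIM('a))) *
    (\<integral>\<^sup>+y. (if \<tau> j / 4 \<le> dist x y \<and> dist x y < 2 * \<tau> j then ennreal (norm (g y)) else 0) \<partial>lebesgue_on \<Omega>)"

definition ball_potential :: "('a \<Rightarrow> 'a) \<Rightarrow> nat \<Rightarrow> 'a \<Rightarrow> ennreal" where
  "ball_potential g j x = ennreal (scale j powr (1 - real DIM('a))) *
    (\<integral>\<^sup>+y. (if dist x y < 4 / \<kappa> * scale j then ennreal (norm (g y)) else 0) \<partial>lebesgue_on \<Omega>)"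

text \<open>It comes from a path of length at most \<open>\<tau> j\<close>, divided by the smallest
  radius \<open>\<kappa> / 4 * \<tau> j\<close> to the power of the dimension and by the mass of the
  kernel, after \<open>\<tau> j\<close> is expressed through \<open>scale j\<close>.\<close>

definition potential_const :: real where
  "potential_const = (4 / \<kappa>) ^ DIM('a) * (2 / \<kappa>) powr (1 - real DIM('a)) / bump_mass TYPE('a)"

lemma sets_dom [simp]: "\<Omega> \<in> sets lebesgue"
  using open_dom by auto

lemma \<tau>_pos: "0 < \<tau> j"
  using \<kappa> by (simp add: \<tau>_def)

lemma \<tau>_Suc: "\<tau> j = 2 * \<tau> (Suc j)"
  by (simp add: \<tau>_def scale_Suc[of j])

lemma \<tau>_antimono: "k \<le> j \<Longrightarrow> \<tau> j \<le> \<tau> k"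
  unfolding \<tau>_def scale_def using \<kappa> D_pos by (intro mult_left_mono divide_left_mono) auto

lemma \<tau>_le_T: "k1 \<le> j \<Longrightarrow> \<tau> j \<le> T"
  using \<tau>_antimono[of k1 j] k1 by (simp add: \<tau>_def scale_def)

lemma scale_less_\<delta>: "k1 \<le> j \<Longrightarrow> scale j < \<delta>"
  using k1(2) D_pos unfolding scale_def
  by (smt (verit) divide_left_mono mult_pos_pos power_increasing zero_less_power one_le_numeral)

lemma potential_const_pos: "0 < potential_const"
  using \<kappa> bump_mass(1)[where 'a='a] by (simp add: potential_const_def)

lemma annulus_le_ball: "annulus_potential g j x \<le> ball_potential g j x"
  unfolding annulus_potential_def ball_potential_def \<tau>_def
  by (intro mult_left_mono nn_integral_mono) auto

lemma coefficient_eq: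
  "\<tau> j / (\<kappa> / 4 * \<tau> j) ^ DIM('a) / bump_mass TYPE('a) = potential_const * scale j powr (1 - real DIM('a))"
proof -
  have t: "0 < \<tau> j" by (rule \<tau>_pos)
  have "\<tau> j / (\<kappa> / 4 * \<tau> j) ^ DIM('a) = (4 / \<kappa>) ^ DIM('a) * (\<tau> j / \<tau> j ^ DIM('a))"
    by (simp add: power_mult_distrib power_divide)
  also have "\<tau> j / \<tau> j ^ DIM('a) = \<tau> j powr (1 - real DIM('a))"
    using t by (simp add: powr_diff powr_realpow)
  also have "\<dots> = (2 / \<kappa>) powr (1 - real DIM('a)) * scale j powr (1 - real DIM('a))"
    unfolding \<tau>_def by (rule powr_mult)
  finally show ?thesis by (simp add: potential_const_def)
qed

lemma mollify_path_le:
  assumes wg: "is_weak_gradient \<Omega> u g" "integrable (lebesgue_on \<Omega>) u" "integrable (lebesgue_on \<Omega>) g"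
    and S: "S \<in> sets (lebesgue_on \<Omega>)" and len: "norm v + \<bar>w\<bar> \<le> \<tau> j"
    and path: "\<And>\<sigma>. \<sigma> \<in> {0..1} \<Longrightarrow> \<kappa> / 4 * \<tau> j \<le> \<rho> + \<sigma> * w \<and> cball (c + \<sigma> *\<^sub>R v) (\<rho> + \<sigma> * w) \<subseteq> S"
  shows "ennreal \<bar>mollify \<Omega> u c \<rho> / bump_mass TYPE('a) - mollify \<Omega> u (c + v) (\<rho> + w) / bump_mass TYPE('a)\<bar> \<le>
    ennreal potential_const * (ennreal (scale j powr (1 - real DIM('a))) * (\<integral>\<^sup>+y. indicator S y * ennreal (norm (g y)) \<partial>lebesgue_on \<Omega>))"
proof -
  define I where "I = (LINT y|lebesgue_on \<Omega>. indicator S y * norm (g y))"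
  define m where "m = bump_mass TYPE('a)"
  have m: "0 < m" by (simp add: m_def bump_mass)
  have I: "0 \<le> I" by (simp add: I_def)
  have \<rho>0: "0 < \<kappa> / 4 * \<tau> j" using \<kappa> \<tau>_pos by simp
  have "integrable (lebesgue_on \<Omega>) (\<lambda>y. indicator S y * norm (g y))"
    using integrable_mult_indicator[of S "lebesgue_on \<Omega>" "\<lambda>y. norm (g y)"] S wg(3) by simp
  then have I_eq: "(\<integral>\<^sup>+y. indicator S y * ennreal (norm (g y)) \<partial>lebesgue_on \<Omega>) = ennreal I"
    unfolding I_def by (subst nn_integral_eq_integral[symmetric]) (auto intro!: nn_integral_cong simp: indicator_def)
  have "\<bar>mollify \<Omega> u c \<rho> / m - mollify \<Omega> u (c + v) (\<rho> + w) / m\<bar> = \<bar>mollify \<Omega> u (c + v) (\<rho> + w) - mollify \<Omega> u c \<rho>\<bar> / m"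
    using m by (simp add: abs_divide abs_minus_commute flip: diff_divide_distrib)
  also have "\<dots> \<le> ((norm v + \<bar>w\<bar>) / (\<kappa> / 4 * \<tau> j) ^ DIM('a) * I) / m"
    using m unfolding I_def by (intro divide_right_mono mollify_diff_le wg open_dom S \<rho>0 path) auto
  also have "\<dots> \<le> (\<tau> j / (\<kappa> / 4 * \<tau> j) ^ DIM('a) * I) / m"
    using m I len \<rho>0 by (intro divide_right_mono mult_right_mono) auto
  also have "\<dots> = (\<tau> j / (\<kappa> / 4 * \<tau> j) ^ DIM('a) / m) * I"
    by simp
  also have "\<dots> = potential_const * (scale j powr (1 - real DIM('a)) * I)"
    unfolding m_def coefficient_eq by simp
  finally show ?thesis
    using I potential_const_pos unfolding I_eq m_def by (simp add: ennreal_leI flip: ennreal_mult)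
qed

lemma mean_step:
  assumes wg: "is_weak_gradient \<Omega> u g" "integrable (lebesgue_on \<Omega>) u" "integrable (lebesgue_on \<Omega>) g"
    and e: "admissible x e" and j: "k1 \<le> j"
  shows "ennreal \<bar>mean e j u x - mean e (Suc j) u x\<bar> \<le> ennreal potential_const * annulus_potential g j x"
proof -
  define S where "S = {y \<in> \<Omega>. \<tau> j / 4 \<le> dist x y \<and> dist x y < 2 * \<tau> j}"
  define t where "t = \<tau> j"
  have t: "0 < t" "t \<le> T" using \<tau>_pos \<tau>_le_T j by (auto simp: t_def)
  have ne: "norm e = 1" using e by (simp add: admissible_def)
  have "S = \<Omega> \<inter> (- ball x (\<tau> j / 4) \<inter> ball x (2 * \<tau> j))" by (auto simp: S_def)
  moreover have "- ball x (\<tau> j / 4) \<inter> ball x (2 * \<tau> j) \<in> sets borel" by (intro sets.Int borel_open borel_closed) auto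
  ultimately have S: "S \<in> sets (lebesgue_on \<Omega>)"
    by (metis sets_lebesgue_on_Int_borel)
  have main: "ennreal \<bar>mollify \<Omega> u (x + t *\<^sub>R e) (\<kappa> / 2 * t) / bump_mass TYPE('a) -
    mollify \<Omega> u ((x + t *\<^sub>R e) + (- (t / 2)) *\<^sub>R e) (\<kappa> / 2 * t + (- (\<kappa> / 4 * t))) / bump_mass TYPE('a)\<bar> \<le>
    ennreal potential_const * (ennreal (scale j powr (1 - real DIM('a))) * (\<integral>\<^sup>+y. indicator S y * ennreal (norm (g y)) \<partial>lebesgue_on \<Omega>))"
  proof (rule mollify_path_le[OF wg S])
    have "norm ((- (t / 2)) *\<^sub>R e) + \<bar>- (\<kappa> / 4 * t)\<bar> = (1 / 2 + \<kappa> / 4) * t"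
      using t \<kappa> ne by (simp add: algebra_simps)
    also have "\<dots> \<le> 1 * t" using \<kappa> t by (intro mult_right_mono) auto
    finally show "norm ((- (t / 2)) *\<^sub>R e) + \<bar>- (\<kappa> / 4 * t)\<bar> \<le> \<tau> j" by (simp add: t_def)
    fix \<sigma> :: real assume \<sigma>: "\<sigma> \<in> {0..1}"
    \<comment> \<open>The path runs down the axis of the cone from height t to t / 2. Centre and
      radius stay proportional: at height q the ball has radius
      \<open>\<kappa> / 2 * q\<close>.\<close>
    define q where "q = t * (1 - \<sigma> / 2)"
    have "t * (1 / 2) \<le> q" "q \<le> t * 1"
      unfolding q_def using \<sigma> t by (intro mult_left_mono; simp)+
    then have q: "t / 2 \<le> q" "q \<le> t" "0 < q" using t by auto
    have eqs: "(x + t *\<^sub>R e) + \<sigma> *\<^sub>R ((- (t / 2)) *\<^sub>R e) = x + q *\<^sub>R e"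
      by (simp add: q_def algebra_simps)
    have eqs2: "\<kappa> / 2 * t + \<sigma> * (- (\<kappa> / 4 * t)) = \<kappa> / 2 * q"
      by (simp add: q_def algebra_simps)
    have "\<kappa> / 2 * (t / 2) \<le> \<kappa> / 2 * q" using q \<kappa> by (intro mult_left_mono) auto
    then have 1: "\<kappa> / 4 * \<tau> j \<le> \<kappa> / 2 * q" by (simp add: t_def)
    have "cball (x + q *\<^sub>R e) (\<kappa> * q) \<subseteq> \<Omega>" using e q t by (auto simp: admissible_def)
    moreover have kq: "\<kappa> * q \<le> (1 / 2) * q" using \<kappa> q by (intro mult_right_mono) auto
    \<comment> \<open>The ball has radius at most q / 4, so its distance to the vertex x is at least
      3 q / 4, which exceeds t / 4 because q is at least t / 2.\<close>
    moreover have "\<tau> j / 4 \<le> dist x y \<and> dist x y < 2 * \<tau> j" if "dist (x + q *\<^sub>R e) y \<le> \<kappa> / 2 * q" for y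
    proof -
      have "dist x (x + q *\<^sub>R e) = q" using ne q by (simp add: dist_norm)
      then show ?thesis
        using dist_triangle[of x y "x + q *\<^sub>R e"] dist_triangle2[of x "x + q *\<^sub>R e" y] that q kq t
        unfolding t_def[symmetric] by linarith
    qed
    moreover have "\<kappa> / 2 * q \<le> \<kappa> * q" using \<kappa> q by simp
    ultimately have "cball (x + q *\<^sub>R e) (\<kappa> / 2 * q) \<subseteq> S"
      by (force simp: S_def subset_iff)
    with 1 show "\<kappa> / 4 * \<tau> j \<le> \<kappa> / 2 * t + \<sigma> * (- (\<kappa> / 4 * t)) \<and>
      cball ((x + t *\<^sub>R e) + \<sigma> *\<^sub>R ((- (t / 2)) *\<^sub>R e)) (\<kappa> / 2 * t + \<sigma> * (- (\<kappa> / 4 * t))) \<subseteq> S"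
      unfolding eqs eqs2 by simp
  qed
  have eqs: "(x + t *\<^sub>R e) + (- (t / 2)) *\<^sub>R e = x + \<tau> (Suc j) *\<^sub>R e" "\<kappa> / 2 * t + (- (\<kappa> / 4 * t)) = \<kappa> / 2 * \<tau> (Suc j)"
    using \<tau>_Suc[of j] by (simp_all add: t_def algebra_simps flip: scaleR_add_left)
  have int: "(\<integral>\<^sup>+y. indicator S y * ennreal (norm (g y)) \<partial>lebesgue_on \<Omega>) =
    (\<integral>\<^sup>+y. (if \<tau> j / 4 \<le> dist x y \<and> dist x y < 2 * \<tau> j then ennreal (norm (g y)) else 0) \<partial>lebesgue_on \<Omega>)"
    by (intro nn_integral_cong) (auto simp: S_def indicator_def)
  show ?thesis
    using main unfolding eqs int unfolding mean_def annulus_potential_def t_def .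
qed

text \<open>While the mean moves from x to y its ball has radius
  \<open>\<kappa> / 2 * \<tau> j\<close>, and the centre moves by at most as much. So every ball on
  the way lies in the single ball of radius \<open>\<kappa> * \<tau> j\<close> that the cone at x
  provides.\<close>

lemma mean_cross:
  assumes wg: "is_weak_gradient \<Omega> u g" "integrable (lebesgue_on \<Omega>) u" "integrable (lebesgue_on \<Omega>) g"
    and e: "admissible x e" and j: "k1 \<le> j" and xy: "dist x y \<le> scale j"
  shows "ennreal \<bar>mean e j u x - mean e j u y\<bar> \<le> ennreal potential_const * ball_potential g j x"
proof -
  define S where "S = {y \<in> \<Omega>. dist x y < 2 * \<tau> j}"
  define t where "t = \<tau> j"
  have t: "0 < t" "t \<le> T" using \<tau>_pos \<tau>_le_T j by (auto simp: t_def)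
  have ne: "norm e = 1" using e by (simp add: admissible_def)
  have s: "scale j = \<kappa> / 2 * t" using \<kappa> by (simp add: t_def \<tau>_def)
  have kt: "\<kappa> * t \<le> (1 / 2) * t" using \<kappa> t by (intro mult_right_mono) auto
  have "S = \<Omega> \<inter> ball x (2 * \<tau> j)" by (auto simp: S_def)
  moreover have "ball x (2 * \<tau> j) \<in> sets borel" by (intro borel_open) auto
  ultimately have S: "S \<in> sets (lebesgue_on \<Omega>)"
    by (metis sets_lebesgue_on_Int_borel)
  have "ennreal \<bar>mollify \<Omega> u (x + t *\<^sub>R e) (\<kappa> / 2 * t) / bump_mass TYPE('a) -
    mollify \<Omega> u ((x + t *\<^sub>R e) + (y - x)) (\<kappa> / 2 * t + 0) / bump_mass TYPE('a)\<bar> \<le>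
    ennreal potential_const * (ennreal (scale j powr (1 - real DIM('a))) * (\<integral>\<^sup>+y. indicator S y * ennreal (norm (g y)) \<partial>lebesgue_on \<Omega>))"
  proof (rule mollify_path_le[OF wg S])
    show "norm (y - x) + \<bar>0\<bar> \<le> \<tau> j"
      using xy s kt t norm_minus_commute[of y x] unfolding t_def[symmetric] dist_norm by linarith
    fix \<sigma> :: real assume \<sigma>: "\<sigma> \<in> {0..1}"
    have "cball ((x + t *\<^sub>R e) + \<sigma> *\<^sub>R (y - x)) (\<kappa> / 2 * t) \<subseteq> S"
    proof
      fix z assume z: "z \<in> cball ((x + t *\<^sub>R e) + \<sigma> *\<^sub>R (y - x)) (\<kappa> / 2 * t)"
      have "dist (x + t *\<^sub>R e) ((x + t *\<^sub>R e) + \<sigma> *\<^sub>R (y - x)) = \<sigma> * dist x y"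
        using \<sigma> by (simp add: dist_norm norm_minus_commute)
      also have "\<dots> \<le> 1 * (\<kappa> / 2 * t)" using \<sigma> xy s by (intro mult_mono) auto
      finally have d: "dist (x + t *\<^sub>R e) z \<le> \<kappa> * t"
        using dist_triangle[of "x + t *\<^sub>R e" z "(x + t *\<^sub>R e) + \<sigma> *\<^sub>R (y - x)"] z by simp
      moreover have "cball (x + t *\<^sub>R e) (\<kappa> * t) \<subseteq> \<Omega>" using e t unfolding admissible_def by blast
      ultimately have "z \<in> \<Omega>" by auto
      moreover have "dist x (x + t *\<^sub>R e) = t" using ne t by (simp add: dist_norm)
      then have "dist x z < 2 * \<tau> j"
        using dist_triangle[of x z "x + t *\<^sub>R e"] d kt t unfolding t_def[symmetric] by linarith
      ultimately show "z \<in> S" by (simp add: S_def)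
    qed
    then show "\<kappa> / 4 * \<tau> j \<le> \<kappa> / 2 * t + \<sigma> * 0 \<and> cball ((x + t *\<^sub>R e) + \<sigma> *\<^sub>R (y - x)) (\<kappa> / 2 * t + \<sigma> * 0) \<subseteq> S"
      using t \<kappa> by (simp add: t_def)
  qed
  moreover have "(\<integral>\<^sup>+y. indicator S y * ennreal (norm (g y)) \<partial>lebesgue_on \<Omega>) =
    (\<integral>\<^sup>+y. (if dist x y < 4 / \<kappa> * scale j then ennreal (norm (g y)) else 0) \<partial>lebesgue_on \<Omega>)"
    by (intro nn_integral_cong) (auto simp: S_def indicator_def \<tau>_def)
  ultimately show ?thesis
    by (simp add: mean_def ball_potential_def t_def algebra_simps)
qed

lemma mean_le:
  "\<exists>H\<ge>0. \<forall>u e x. integrable (lebesgue_on \<Omega>) u \<longrightarrow> ennreal \<bar>mean e k1 u x\<bar> \<le> ennreal H * (\<integral>\<^sup>+y. ennreal \<bar>u y\<bar> \<partial>lebesgue_on \<Omega>)"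
proof -
  define \<rho> where "\<rho> = \<kappa> / 2 * \<tau> k1"
  have \<rho>: "0 < \<rho>" using \<kappa> \<tau>_pos by (simp add: \<rho>_def)
  define m where "m = bump_mass TYPE('a)"
  have m: "0 < m" by (simp add: m_def bump_mass)
  define H where "H = 1 / \<rho> ^ DIM('a) / m"
  have H: "0 \<le> H" using \<rho> m by (simp add: H_def)
  have "ennreal \<bar>mean e k1 u x\<bar> \<le> ennreal H * (\<integral>\<^sup>+y. ennreal \<bar>u y\<bar> \<partial>lebesgue_on \<Omega>)" if u: "integrable (lebesgue_on \<Omega>) u" for u e x
  proof -
    define c where "c = x + \<tau> k1 *\<^sub>R e"
    have b: "\<bar>mollifier c \<rho> y\<bar> \<le> 1 / \<rho> ^ DIM('a)" for y
      using mollifier_nonneg[OF \<rho>, of c y] mollifier_le[OF \<rho>, of c y] by simp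
    have int: "integrable (lebesgue_on \<Omega>) (\<lambda>y. u y * mollifier c \<rho> y)"
      using b by (intro integrable_mult_bounded u borel_measurable_lebesgue_on_continuous continuous_mollifier)
    have "\<bar>mollify \<Omega> u c \<rho>\<bar> \<le> (LINT y|lebesgue_on \<Omega>. 1 / \<rho> ^ DIM('a) * \<bar>u y\<bar>)"
      unfolding mollify_def
    proof (rule integral_abs_bound_integral[OF int])
      fix y
      have "\<bar>u y\<bar> * \<bar>mollifier c \<rho> y\<bar> \<le> \<bar>u y\<bar> * (1 / \<rho> ^ DIM('a))" by (intro mult_left_mono b) auto
      then show "\<bar>u y * mollifier c \<rho> y\<bar> \<le> 1 / \<rho> ^ DIM('a) * \<bar>u y\<bar>" by (simp add: abs_mult)
    qed (use u in auto)
    then have "\<bar>mollify \<Omega> u c \<rho>\<bar> / m \<le> (LINT y|lebesgue_on \<Omega>. 1 / \<rho> ^ DIM('a) * \<bar>u y\<bar>) / m"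
      using m by (intro divide_right_mono) auto
    moreover have "\<bar>mean e k1 u x\<bar> = \<bar>mollify \<Omega> u c \<rho>\<bar> / m"
      using m unfolding mean_def c_def \<rho>_def m_def by (simp add: abs_divide)
    ultimately have "\<bar>mean e k1 u x\<bar> \<le> H * (LINT y|lebesgue_on \<Omega>. \<bar>u y\<bar>)"
      by (simp add: H_def)
    then have "ennreal \<bar>mean e k1 u x\<bar> \<le> ennreal (H * (LINT y|lebesgue_on \<Omega>. \<bar>u y\<bar>))"
      by (rule ennreal_leI)
    also have "\<dots> = ennreal H * (\<integral>\<^sup>+y. ennreal \<bar>u y\<bar> \<partial>lebesgue_on \<Omega>)"
      using u H by (subst nn_integral_eq_integral) (auto simp: ennreal_mult)
    finally show ?thesis .
  qed
  with H show ?thesis by blast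
qed

text \<open>The subsequence may depend on the direction; each of the finitely many directions costs
  one null set.\<close>

definition good_point :: "('a \<Rightarrow> real) \<Rightarrow> 'a \<Rightarrow> bool" where
  "good_point u x \<longleftrightarrow> (\<forall>e\<in>E. \<exists>r. strict_mono r \<and> (\<lambda>i. mean e (r i) u x) \<longlonglongrightarrow> u x)"

lemma AE_good_point:
  assumes "integrable (lebesgue_on \<Omega>) u"
  shows "AE x in lebesgue_on \<Omega>. good_point u x"
  unfolding good_point_def
proof (rule AE_finite_allI[OF finite_dirs])
  fix e assume e: "e \<in> E"
  have "\<tau> \<longlonglongrightarrow> 0"
    unfolding \<tau>_def scale_def by real_asymp
  then obtain r where r: "strict_mono r" "AE x in lebesgue_on \<Omega>.
      (\<lambda>i. mollify \<Omega> u (x + \<tau> (r i) *\<^sub>R e) (\<kappa> / 2 * \<tau> (r i))) \<longlonglongrightarrow> bump_mass TYPE('a) * u x"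
    using mollify_tendsto_AE[OF open_dom assms, of "\<kappa> / 2" \<tau> e] \<kappa> \<tau>_pos norm_dirs[OF e] by auto
  show "AE x in lebesgue_on \<Omega>. \<exists>r. strict_mono r \<and> (\<lambda>i. mean e (r i) u x) \<longlonglongrightarrow> u x"
    using r(2)
  proof eventually_elim
    case (elim x)
    have "(\<lambda>i. mean e (r i) u x) \<longlonglongrightarrow> (bump_mass TYPE('a) * u x) / bump_mass TYPE('a)"
      unfolding mean_def using bump_mass(1)[where 'a='a] by (intro tendsto_divide elim tendsto_const) auto
    then show ?case
      using r(1) bump_mass(1)[where 'a='a] by auto
  qed
qed

lemma mean_tail:
  assumes wg: "is_weak_gradient \<Omega> u g" "integrable (lebesgue_on \<Omega>) u" "integrable (lebesgue_on \<Omega>) g"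
    and e: "admissible x e" "e \<in> E" and k: "k1 \<le> k" and x: "good_point u x"
  shows "ennreal \<bar>u x - mean e k u x\<bar> \<le> (\<Sum>j. ennreal potential_const * annulus_potential g (k + j) x)"
proof -
  obtain r where "strict_mono r" "(\<lambda>i. mean e (r i) u x) \<longlonglongrightarrow> u x"
    using x e unfolding good_point_def by blast
  then have "ennreal \<bar>u x - mean e k u x\<bar> \<le> (\<Sum>j. ennreal \<bar>mean e (k + j) u x - mean e (Suc (k + j)) u x\<bar>)"
    by (rule suminf_tendsto_dist_le)
  also have "\<dots> \<le> (\<Sum>j. ennreal potential_const * annulus_potential g (k + j) x)"
    using k by (intro suminf_le mean_step wg e) auto
  finally show ?thesis .
qed

lemma admissible_near:
  assumes "x \<in> \<Omega>"
  obtains e where "e \<in> E" "\<And>y. y \<in> \<Omega> \<Longrightarrow> dist x y < \<delta> \<Longrightarrow> admissible y e"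
  using cone[OF assms] norm_dirs unfolding admissible_def by blast

lemma weak_gradient_pointwise_le:
  "\<exists>H\<ge>0. \<forall>u g x. is_weak_gradient \<Omega> u g \<longrightarrow> integrable (lebesgue_on \<Omega>) u \<longrightarrow> integrable (lebesgue_on \<Omega>) g \<longrightarrow>
    x \<in> \<Omega> \<longrightarrow> good_point u x \<longrightarrow>
    ennreal \<bar>u x\<bar> \<le> (\<Sum>j. ennreal potential_const * annulus_potential g (k1 + j) x) +
      ennreal H * (\<integral>\<^sup>+y. ennreal \<bar>u y\<bar> \<partial>lebesgue_on \<Omega>)"
proof -
  obtain H where H: "0 \<le> H" "\<And>u e x. integrable (lebesgue_on \<Omega>) u \<Longrightarrow>
    ennreal \<bar>mean e k1 u x\<bar> \<le> ennreal H * (\<integral>\<^sup>+y. ennreal \<bar>u y\<bar> \<partial>lebesgue_on \<Omega>)"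
    using mean_le by blast
  have "ennreal \<bar>u x\<bar> \<le> (\<Sum>j. ennreal potential_const * annulus_potential g (k1 + j) x) +
      ennreal H * (\<integral>\<^sup>+y. ennreal \<bar>u y\<bar> \<partial>lebesgue_on \<Omega>)"
    if wg: "is_weak_gradient \<Omega> u g" "integrable (lebesgue_on \<Omega>) u" "integrable (lebesgue_on \<Omega>) g"
      and x: "x \<in> \<Omega>" "good_point u x" for u g x
  proof -
    obtain e where e: "e \<in> E" "admissible x e"
      using admissible_near[OF x(1)] \<delta> x(1) by (metis dist_self)
    have "ennreal \<bar>u x\<bar> \<le> ennreal \<bar>u x - mean e k1 u x\<bar> + ennreal \<bar>mean e k1 u x\<bar>"
      by (auto simp flip: ennreal_plus intro!: ennreal_leI)
    also have "\<dots> \<le> (\<Sum>j. ennreal potential_const * annulus_potential g (k1 + j) x) +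
      ennreal H * (\<integral>\<^sup>+y. ennreal \<bar>u y\<bar> \<partial>lebesgue_on \<Omega>)"
      by (intro add_mono mean_tail wg e x H) auto
    finally show ?thesis .
  qed
  with H(1) show ?thesis by blast
qed

text \<open>Points whose distance exceeds the fine scales need not share a direction, so their
  values are bounded separately by \<open>weak_gradient_pointwise_le\<close>. The constant terms for
  \<open>j \<le> k1\<close> leave room for that bound: a series that starts before \<open>k1\<close>
  passes the index \<open>k1\<close> and finds one there.\<close>

lemma weak_gradient_telescopes:
  "\<exists>H\<ge>0. \<forall>u g. is_weak_gradient \<Omega> u g \<longrightarrow> integrable (lebesgue_on \<Omega>) u \<longrightarrow> integrable (lebesgue_on \<Omega>) g \<longrightarrow>
    telescopes u (\<lambda>j x. ennreal (2 * potential_const) * ball_potential g j x +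
      (if j \<le> k1 then ennreal H * (\<integral>\<^sup>+y. ennreal \<bar>u y\<bar> \<partial>lebesgue_on \<Omega>) else 0))"
proof -
  obtain H where H: "0 \<le> H" "\<And>u g x. is_weak_gradient \<Omega> u g \<Longrightarrow> integrable (lebesgue_on \<Omega>) u \<Longrightarrow> integrable (lebesgue_on \<Omega>) g \<Longrightarrow>
    x \<in> \<Omega> \<Longrightarrow> good_point u x \<Longrightarrow>
    ennreal \<bar>u x\<bar> \<le> (\<Sum>j. ennreal potential_const * annulus_potential g (k1 + j) x) +
      ennreal H * (\<integral>\<^sup>+y. ennreal \<bar>u y\<bar> \<partial>lebesgue_on \<Omega>)"
    using weak_gradient_pointwise_le by blast
  have "telescopes u (\<lambda>j x. ennreal (2 * potential_const) * ball_potential g j x +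
      (if j \<le> k1 then ennreal H * (\<integral>\<^sup>+y. ennreal \<bar>u y\<bar> \<partial>lebesgue_on \<Omega>) else 0))"
    if wg: "is_weak_gradient \<Omega> u g" "integrable (lebesgue_on \<Omega>) u" "integrable (lebesgue_on \<Omega>) g" for u g
    unfolding telescopes_def
  proof (intro exI[of _ "good_point u"] conjI AE_good_point wg allI ballI impI)
    define I where "I = ennreal H * (\<integral>\<^sup>+y. ennreal \<bar>u y\<bar> \<partial>lebesgue_on \<Omega>)"
    define A where "A j x = ennreal (2 * potential_const) * ball_potential g j x + (if j \<le> k1 then I else 0)" for j x
    fix k x y assume "x \<in> space (lebesgue_on \<Omega>)" "y \<in> space (lebesgue_on \<Omega>)"
      and good: "good_point u x" "good_point u y" and xy: "dist x y \<le> scale k"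
    then have x: "x \<in> \<Omega>" and y: "y \<in> \<Omega>" by auto
    have two: "ennreal (2 * potential_const) = 2 * ennreal potential_const"
      using ennreal_mult[of 2 potential_const] potential_const_pos by simp
    have tail_le: "(\<Sum>j. ennreal potential_const * annulus_potential g (l + j) z) \<le> (\<Sum>j. ennreal potential_const * ball_potential g (l + j) z)" for l z
      by (intro suminf_le mult_left_mono annulus_le_ball) auto
    have "ennreal \<bar>u x - u y\<bar> \<le> (\<Sum>j. A (k + j) x) + (\<Sum>j. A (k + j) y)"
    proof (cases "k1 \<le> k")
      case True
      obtain e where e: "e \<in> E" "\<And>y. y \<in> \<Omega> \<Longrightarrow> dist x y < \<delta> \<Longrightarrow> admissible y e"
        using admissible_near[OF x] by blast
      have ex: "admissible x e" using e(2)[OF x] \<delta> by simp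
      have ey: "admissible y e" using e(2)[OF y] xy scale_less_\<delta>[OF True] by simp
      have "ennreal \<bar>u x - u y\<bar> \<le> ennreal \<bar>u x - mean e k u x\<bar> + ennreal \<bar>mean e k u x - mean e k u y\<bar> + ennreal \<bar>u y - mean e k u y\<bar>"
        by (auto simp flip: ennreal_plus intro!: ennreal_leI)
      also have "\<dots> \<le> (\<Sum>j. ennreal potential_const * ball_potential g (k + j) x) +
        (\<Sum>j. ennreal potential_const * ball_potential g (k + j) x) + (\<Sum>j. ennreal potential_const * ball_potential g (k + j) y)"
      proof (intro add_mono)
        have "ennreal potential_const * ball_potential g k x \<le> (\<Sum>j. ennreal potential_const * ball_potential g (k + j) x)"
          using term_le_suminf_ennreal[of "\<lambda>j. ennreal potential_const * ball_potential g (k + j) x" 0] by simp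
        then show "ennreal \<bar>mean e k u x - mean e k u y\<bar> \<le> (\<Sum>j. ennreal potential_const * ball_potential g (k + j) x)"
          using mean_cross[OF wg ex True xy] by (rule order_trans[rotated])
      qed (intro order_trans[OF mean_tail tail_le] wg ex ey e True good)+
      also have "\<dots> \<le> 2 * (\<Sum>j. ennreal potential_const * ball_potential g (k + j) x) + 2 * (\<Sum>j. ennreal potential_const * ball_potential g (k + j) y)"
        by (intro add_mono) (auto simp: mult_2)
      also have "\<dots> = (\<Sum>j. ennreal (2 * potential_const) * ball_potential g (k + j) x) + (\<Sum>j. ennreal (2 * potential_const) * ball_potential g (k + j) y)"
        by (simp add: two mult.assoc)
      also have "\<dots> \<le> (\<Sum>j. A (k + j) x) + (\<Sum>j. A (k + j) y)"
        by (intro add_mono suminf_le) (auto simp: A_def)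
      finally show ?thesis .
    next
      case False
      have one: "ennreal \<bar>u z\<bar> \<le> (\<Sum>j. A (k + j) z)" if z: "z \<in> \<Omega>" "good_point u z" for z
      proof -
        have "ennreal \<bar>u z\<bar> \<le> (\<Sum>j. ennreal potential_const * annulus_potential g (k1 + j) z) + I"
          unfolding I_def by (intro H wg z)
        also have "\<dots> \<le> (\<Sum>j. ennreal (2 * potential_const) * ball_potential g (k1 + j) z) + I"
        proof (intro add_right_mono suminf_le mult_mono ennreal_leI annulus_le_ball)
          show "potential_const \<le> 2 * potential_const" using potential_const_pos by simp
        qed auto
        also have "I \<le> (\<Sum>j. if j = 0 then I else 0)"
          using term_le_suminf_ennreal[of "\<lambda>j. if j = 0 then I else 0" 0] by simp
        also have "(\<Sum>j. ennreal (2 * potential_const) * ball_potential g (k1 + j) z) + (\<Sum>j. if j = 0 then I else 0) = (\<Sum>j. ennreal (2 * potential_const) * ball_potential g (k1 + j) z + (if j = 0 then I else 0))"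
          by (intro suminf_add) auto
        also have "\<dots> \<le> (\<Sum>j. A (k + (j + (k1 - k))) z)"
          using False by (intro suminf_le) (auto simp: A_def add.commute)
        also have "\<dots> \<le> (\<Sum>j. A (k + j) z)"
          by (rule suminf_shift_le_ennreal[of "\<lambda>j. A (k + j) z"])
        finally show ?thesis by (simp add: add_left_mono)
      qed
      have "ennreal \<bar>u x - u y\<bar> \<le> ennreal \<bar>u x\<bar> + ennreal \<bar>u y\<bar>"
        by (auto simp flip: ennreal_plus intro!: ennreal_leI)
      also have "\<dots> \<le> (\<Sum>j. A (k + j) x) + (\<Sum>j. A (k + j) y)"
        by (intro add_mono one x y good)
      finally show ?thesis .
    qed
    then show "ennreal \<bar>u x - u y\<bar> \<le>
      (\<Sum>j. ennreal (2 * potential_const) * ball_potential g (k + j) x + (if k + j \<le> k1 then ennreal H * (\<integral>\<^sup>+y. ennreal \<bar>u y\<bar> \<partial>lebesgue_on \<Omega>) else 0)) +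
      (\<Sum>j. ennreal (2 * potential_const) * ball_potential g (k + j) y + (if k + j \<le> k1 then ennreal H * (\<integral>\<^sup>+y. ennreal \<bar>u y\<bar> \<partial>lebesgue_on \<Omega>) else 0))"
      unfolding A_def I_def .
  qed
  with H(1) show ?thesis by blast
qed

end

section \<open>Regularity of bounded Lipschitz domains\<close>

lemma lipschitz_domain_exists:
  fixes \<Omega> :: "'a::euclidean_space set"
  assumes "open \<Omega>" "bounded \<Omega>" "lipschitz_boundary \<Omega>"
  shows "\<exists>D c0 c1 E \<kappa> T \<delta> k1. lipschitz_domain \<Omega> D c0 c1 E \<kappa> T \<delta> k1"
proof -
  obtain E \<kappa> T \<delta> where E: "finite E" "\<And>e. e \<in> E \<Longrightarrow> norm e = 1" and \<kappa>: "0 < \<kappa>" "\<kappa> \<le> 1 / 2" and T: "0 < T" and \<delta>: "0 < \<delta>"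
    and cone: "\<And>x. x \<in> \<Omega> \<Longrightarrow> \<exists>e\<in>E. \<forall>y\<in>\<Omega>. dist x y < \<delta> \<longrightarrow> (\<forall>t. 0 < t \<and> t \<le> T \<longrightarrow> cball (y + t *\<^sub>R e) (\<kappa> * t) \<subseteq> \<Omega>)"
    using lipschitz_domain_directions[OF assms] by metis
  have lm: "\<Omega> \<in> lmeasurable" using assms by (intro lmeasurable_open)
  define V where "V = measure lebesgue (ball (0::'a) 1)"
  have ball_measure: "measure lebesgue (ball (c::'a) t) = V * t powr real DIM('a)" if "0 < t" for c t
    using that content_ball_conv_unit_ball[of t c] by (simp add: V_def powr_realpow mult.commute)
  have V: "0 < V" using content_ball_pos[of 1 "0::'a"] by (simp add: V_def)
  obtain R where R: "\<And>x. x \<in> \<Omega> \<Longrightarrow> norm x \<le> R" using assms(2) by (auto simp: bounded_iff)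
  define D where "D = 2 * max R 1"
  have D: "0 < D" by (simp add: D_def)
  have diam: "dist x y \<le> D" if "x \<in> \<Omega>" "y \<in> \<Omega>" for x y
    using R[OF that(1)] R[OF that(2)] norm_triangle_ineq4[of x y] by (simp add: D_def dist_norm)
  \<comment> \<open>For \<open>t \<le> D\<close> the height \<open>q = \<eta> * t\<close> is at most
    T and at most t / 2. The ball of radius \<open>\<kappa> * q\<close> in the cone at x then lies
    in both the domain and the ball of radius t, and its measure is the lower bound with
    \<open>c0\<close>.\<close>
  define \<eta> where "\<eta> = min 1 (T / D) / 2"
  have \<eta>: "0 < \<eta>" "\<eta> \<le> 1 / 2" using T D by (auto simp: \<eta>_def)
  define c0 where "c0 = V * (\<kappa> * \<eta>) powr real DIM('a)"
  have meas_eq: "measure (lebesgue_on \<Omega>) {y \<in> space (lebesgue_on \<Omega>). dist x y < t} = measure lebesgue (\<Omega> \<inter> ball x t)" for x t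
  proof -
    have "{y \<in> space (lebesgue_on \<Omega>). dist x y < t} = \<Omega> \<inter> ball x t" by auto
    then show ?thesis using lm by (simp add: measure_restrict_space)
  qed
  have lm_ball: "\<Omega> \<inter> ball x t \<in> lmeasurable" for x t using lm by (intro fmeasurable.Int) auto
  have "\<exists>k. D / 2 ^ k < min (\<kappa> / 2 * T) \<delta>"
  proof -
    have "(\<lambda>j. D / 2 ^ j) \<longlonglongrightarrow> 0" by real_asymp
    then have "eventually (\<lambda>j. D / 2 ^ j < min (\<kappa> / 2 * T) \<delta>) sequentially"
      using \<kappa> T \<delta> by (intro order_tendstoD) auto
    then show ?thesis by (auto simp: eventually_sequentially)
  qed
  then obtain k1 where k1: "D / 2 ^ k1 < \<kappa> / 2 * T" "D / 2 ^ k1 < \<delta>" by auto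
  interpret finite_measure "lebesgue_on \<Omega>" using lm by (rule finite_measure_lebesgue_on)
  have reg: "regular_measure (lebesgue_on \<Omega>) (real DIM('a)) D c0 V"
  proof unfold_locales
    show "(\<lambda>x. x) \<in> borel_measurable (lebesgue_on \<Omega>)"
      by (intro borel_measurable_lebesgue_on_continuous continuous_on_id)
    show "0 < c0" using V \<kappa> \<eta> by (simp add: c0_def)
    fix x :: 'a and t :: real assume t: "0 < t"
    show "measure (lebesgue_on \<Omega>) {y \<in> space (lebesgue_on \<Omega>). dist x y < t} \<le> V * t powr real DIM('a)"
      using measure_mono_fmeasurable[of "\<Omega> \<inter> ball x t" "ball x t" lebesgue] lm_ball[of x t]
      unfolding meas_eq ball_measure[OF t, of x, symmetric] by auto
    assume "x \<in> space (lebesgue_on \<Omega>)" "t \<le> D"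
    then have x: "x \<in> \<Omega>" by simp
    obtain e where e: "e \<in> E" "\<forall>t. 0 < t \<and> t \<le> T \<longrightarrow> cball (x + t *\<^sub>R e) (\<kappa> * t) \<subseteq> \<Omega>"
      using cone[OF x] x \<delta> by (metis dist_self)
    define q where "q = \<eta> * t"
    have "\<eta> * t \<le> (T / D / 2) * D"
      unfolding \<eta>_def using t \<open>t \<le> D\<close> T D by (intro mult_mono) auto
    then have q: "0 < q" "q \<le> T" "q \<le> t / 2"
      using \<eta> t D T by (auto simp: q_def)
    have "ball (x + q *\<^sub>R e) (\<kappa> * q) \<subseteq> \<Omega>" using e q ball_subset_cball by blast
    moreover have kq: "\<kappa> * q \<le> (1 / 2) * q" using \<kappa> q by (intro mult_right_mono) auto
    have "dist x (x + q *\<^sub>R e) = q" using E(2)[OF e(1)] q by (simp add: dist_norm)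
    then have "ball (x + q *\<^sub>R e) (\<kappa> * q) \<subseteq> ball x t"
    proof (intro subsetI)
      fix z assume "dist x (x + q *\<^sub>R e) = q" "z \<in> ball (x + q *\<^sub>R e) (\<kappa> * q)"
      then show "z \<in> ball x t"
        using dist_triangle[of x z "x + q *\<^sub>R e"] q kq unfolding mem_ball by linarith
    qed
    ultimately have "ball (x + q *\<^sub>R e) (\<kappa> * q) \<subseteq> \<Omega> \<inter> ball x t" by blast
    then have "measure lebesgue (ball (x + q *\<^sub>R e) (\<kappa> * q)) \<le> measure lebesgue (\<Omega> \<inter> ball x t)"
      using lm_ball by (intro measure_mono_fmeasurable) auto
    also have "measure lebesgue (ball (x + q *\<^sub>R e) (\<kappa> * q)) = c0 * t powr real DIM('a)"
      using \<kappa> q by (subst ball_measure) (simp_all add: c0_def q_def powr_mult)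
    finally show "c0 * t powr real DIM('a) \<le> measure (lebesgue_on \<Omega>) {y \<in> space (lebesgue_on \<Omega>). dist x y < t}"
      unfolding meas_eq .
  qed (use V D diam in auto)
  have "lipschitz_domain \<Omega> D c0 V E \<kappa> T \<delta> k1"
  proof (intro lipschitz_domain.intro lipschitz_domain_axioms.intro reg)
    show "2 / \<kappa> * (D / 2 ^ k1) \<le> T"
      using k1(1) \<kappa> by (simp add: field_simps)
  qed (use assms E \<kappa> cone \<delta> k1 in auto)
  then show ?thesis by blast
qed

section \<open>Embeddings as inequalities between powers of norms\<close>

text \<open>The p-th power of \<open>W_norm\<close>. For s = 0 the seminorm already is the Lebesgue
  norm and must not be counted twice.\<close>

definition W_power :: "'a::euclidean_space set \<Rightarrow> real \<Rightarrow> real \<Rightarrow> ('a \<Rightarrow> real) \<Rightarrow> ennreal" where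
  "W_power \<Omega> s p u = (if s = 0 then 0 else W_seminorm \<Omega> s p u \<up> p) + (\<integral>\<^sup>+x. ennreal (\<bar>u x\<bar> powr p) \<partial>lebesgue_on \<Omega>)"

lemma Lp_norm_epowr: "0 < p \<Longrightarrow> Lp_norm \<Omega> p u \<up> p = (\<integral>\<^sup>+x. ennreal (norm (u x) powr p) \<partial>lebesgue_on \<Omega>)"
  by (simp add: Lp_norm_def)

lemma W_norm_eq: "0 < p \<Longrightarrow> W_norm \<Omega> s p u = W_power \<Omega> s p u \<up> (1 / p)"
  by (simp add: W_norm_def W_power_def Lp_norm_epowr) (simp add: Lp_norm_def)

lemma W_space_iff: "0 < p \<Longrightarrow> u \<in> W_space \<Omega> s p \<longleftrightarrow> u \<in> borel_measurable (lebesgue_on \<Omega>) \<and> W_power \<Omega> s p u < top"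
  by (auto simp: W_space_def Lp_space_def W_power_def W_seminorm_def Lp_norm_def)

text \<open>Both sides are homogeneous of degree p', so roots are taken once, here, and not in the
  estimates. Finiteness of the right side also gives the inclusion of the spaces.\<close>

lemma W_embeddedI:
  assumes p: "0 < p" "0 < p'" and C: "C < top"
    and le: "\<And>u. u \<in> borel_measurable (lebesgue_on \<Omega>) \<Longrightarrow> W_power \<Omega> s p u < top \<Longrightarrow> W_power \<Omega> s' p' u \<le> C * W_power \<Omega> s p u \<up> (p' / p)"
  shows "W_embedded \<Omega> (s, p) (s', p')"
  unfolding W_embedded_def continuously_embedded_def prod.case
proof
  show "W_space \<Omega> s p \<subseteq> W_space \<Omega> s' p'"
  proof
    fix u assume u: "u \<in> W_space \<Omega> s p"
    then have "W_power \<Omega> s' p' u \<le> C * W_power \<Omega> s p u \<up> (p' / p)" using le p by (simp add: W_space_iff)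
    also have "\<dots> < top" using u p C by (simp add: W_space_iff ennreal_mult_less_top)
    finally show "u \<in> W_space \<Omega> s' p'" using u p by (simp add: W_space_iff)
  qed
  define K where "K = enn2real (C \<up> (1 / p')) + 1"
  have K: "0 < K" by (simp add: K_def add_nonneg_pos)
  have "C \<up> (1 / p') \<le> ennreal K"
    using C unfolding K_def by (cases C) (auto simp: epowr_ennreal intro!: ennreal_leI)
  then have "W_norm \<Omega> s' p' u \<le> ennreal K * W_norm \<Omega> s p u" if "u \<in> W_space \<Omega> s p" for u
  proof -
    have "W_norm \<Omega> s' p' u \<le> (C * W_power \<Omega> s p u \<up> (p' / p)) \<up> (1 / p')"
      using that p le by (auto simp: W_space_iff W_norm_eq intro!: epowr_mono)
    also have "\<dots> = C \<up> (1 / p') * W_norm \<Omega> s p u"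
      using p by (simp add: W_norm_eq epowr_mult epowr_epowr)
    also have "\<dots> \<le> ennreal K * W_norm \<Omega> s p u"
      by (intro mult_right_mono \<open>C \<up> (1 / p') \<le> ennreal K\<close>) auto
    finally show ?thesis .
  qed
  with K show "\<exists>C>0. \<forall>u\<in>W_space \<Omega> s p. W_norm \<Omega> s' p' u \<le> ennreal C * W_norm \<Omega> s p u" by blast
qed

lemma W_embedded_refl: "W_embedded \<Omega> (s, p) (s, p)"
  unfolding W_embedded_def continuously_embedded_def by (auto intro!: exI[of _ 1])

lemma W_embedded_trans:
  assumes "W_embedded \<Omega> (s1, p1) (s2, p2)" "W_embedded \<Omega> (s2, p2) (s3, p3)"
  shows "W_embedded \<Omega> (s1, p1) (s3, p3)"
proof -
  obtain C1 where C1: "0 < C1" "\<And>u. u \<in> W_space \<Omega> s1 p1 \<Longrightarrow> W_norm \<Omega> s2 p2 u \<le> ennreal C1 * W_norm \<Omega> s1 p1 u"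
    using assms(1) unfolding W_embedded_def continuously_embedded_def by auto
  obtain C2 where C2: "0 < C2" "\<And>u. u \<in> W_space \<Omega> s2 p2 \<Longrightarrow> W_norm \<Omega> s3 p3 u \<le> ennreal C2 * W_norm \<Omega> s2 p2 u"
    using assms(2) unfolding W_embedded_def continuously_embedded_def by auto
  have sub: "W_space \<Omega> s1 p1 \<subseteq> W_space \<Omega> s2 p2" "W_space \<Omega> s2 p2 \<subseteq> W_space \<Omega> s3 p3"
    using assms unfolding W_embedded_def continuously_embedded_def by auto
  have "W_norm \<Omega> s3 p3 u \<le> ennreal (C2 * C1) * W_norm \<Omega> s1 p1 u" if "u \<in> W_space \<Omega> s1 p1" for u
  proof -
    have "W_norm \<Omega> s3 p3 u \<le> ennreal C2 * W_norm \<Omega> s2 p2 u" using C2(2) sub that by blast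
    also have "\<dots> \<le> ennreal C2 * (ennreal C1 * W_norm \<Omega> s1 p1 u)" by (intro mult_left_mono C1 that) auto
    finally show ?thesis using C1(1) C2(1) by (simp add: ennreal_mult mult.assoc)
  qed
  moreover have "0 < C2 * C1" using C1(1) C2(1) by simp
  ultimately show ?thesis
    using sub unfolding W_embedded_def continuously_embedded_def prod.case by blast
qed

lemma W_embedded_Lp:
  assumes "0 < p"
  shows "W_embedded \<Omega> (s, p) (0, p)"
  by (rule W_embeddedI[where C=1]) (use assms in \<open>auto simp: W_power_def\<close>)

lemma gagliardo_const_pos:
  assumes "0 < s" "s < 1" "1 \<le> p" "1 \<le> N"
  shows "0 < gagliardo_const N s p"
proof -
  have "0 < p * s" using assms by simp
  then have "0 < p * s + p + N - 2" using assms by linarith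
  then have "0 < (p * s + p + N - 2) / 2" by simp
  then show ?thesis
    using assms unfolding gagliardo_const_def by (intro divide_pos_pos mult_pos_pos Gamma_real_pos) auto
qed

section \<open>The embeddings on a Lipschitz domain\<close>

context lipschitz_domain
begin

lemma dim_ge_1: "1 \<le> real DIM('a)"
  using DIM_positive[where 'a='a] by linarith

lemma W_power_fractional:
  assumes "0 < s" "s < 1" "0 < p"
  shows "W_power \<Omega> s p u = ennreal (gagliardo_const (real DIM('a)) s p) * energy s p u + (\<integral>\<^sup>+x. ennreal (\<bar>u x\<bar> powr p) \<partial>lebesgue_on \<Omega>)"
  using assms by (simp add: W_power_def W_seminorm_def gagliardo_seminorm_def energy_def)

lemma integrable_of_nn_integral_powr:
  fixes f :: "'a \<Rightarrow> 'b::euclidean_space"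
  assumes [measurable]: "f \<in> borel_measurable (lebesgue_on \<Omega>)" and p: "1 \<le> p"
    and fin: "(\<integral>\<^sup>+x. ennreal (norm (f x) powr p) \<partial>lebesgue_on \<Omega>) < top"
  shows "integrable (lebesgue_on \<Omega>) f"
proof (rule integrableI_bounded)
  have "(\<integral>\<^sup>+x. ennreal (norm (f x)) \<partial>lebesgue_on \<Omega>) \<up> p \<le>
    ennreal (2 powr p * measure (lebesgue_on \<Omega>) (space (lebesgue_on \<Omega>)) powr (p - 1)) * (\<integral>\<^sup>+x. ennreal (norm (f x)) \<up> p \<partial>lebesgue_on \<Omega>)"
    using p by (intro nn_integral_epowr_le) (auto simp: emeasure_eq_measure)
  also have "\<dots> < top"
    using fin by (simp add: epowr_ennreal ennreal_mult_less_top)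
  finally show "(\<integral>\<^sup>+x. ennreal (norm (f x)) \<partial>lebesgue_on \<Omega>) < \<infinity>"
    by simp
qed measurable

theorem fractional_embedding:
  assumes ab: "0 < b" "b < a" "a < 1" and q: "1 \<le> q" and r: "1 \<le> r"
    and idx: "r < q \<or> b - real DIM('a) / r \<le> a - real DIM('a) / q"
  shows "W_embedded \<Omega> (a, q) (b, r)"
proof -
  define c where "c = gagliardo_const (real DIM('a)) a q"
  define c' where "c' = gagliardo_const (real DIM('a)) b r"
  have c: "0 < c" unfolding c_def using ab q dim_ge_1 by (intro gagliardo_const_pos) auto
  \<comment> \<open>If the integrability decreases, the strict loss of order is enough; otherwise
    the index condition has to hold.\<close>
  obtain C1 where C1: "\<And>u. integrable (lebesgue_on \<Omega>) u \<Longrightarrow> energy b r u \<le> ennreal C1 * energy a q u \<up> (r / q)"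
  proof (cases "r < q")
    case True
    then show ?thesis
      using energy_embedding_smaller_exponent[of b a r q] ab r that by (meson borel_measurable_integrable)
  next
    case False
    then show ?thesis
      using energy_embedding[of b a q r] ab q idx that by (meson linorder_not_less order_less_trans)
  qed
  obtain C2 where C2: "\<And>u. u \<in> borel_measurable (lebesgue_on \<Omega>) \<Longrightarrow> (\<integral>\<^sup>+x. ennreal (\<bar>u x\<bar> powr r) \<partial>lebesgue_on \<Omega>) \<le>
    ennreal C2 * (energy b r u + (\<integral>\<^sup>+x. ennreal (\<bar>u x\<bar> powr q) \<partial>lebesgue_on \<Omega>) \<up> (r / q))"
    using nn_integral_powr_le_energy[of b q r] ab q r by (meson less_imp_le)
  define K where "K = ennreal C1 * ennreal ((1 / c) powr (r / q))"
  show ?thesis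
  proof (rule W_embeddedI[where C="ennreal c' * K + ennreal C2 * (K + 1)"])
    fix u assume u: "u \<in> borel_measurable (lebesgue_on \<Omega>)" and fin: "W_power \<Omega> a q u < top"
    define X where "X = W_power \<Omega> a q u"
    define I where "I = (\<integral>\<^sup>+x. ennreal (\<bar>u x\<bar> powr q) \<partial>lebesgue_on \<Omega>)"
    have X: "X = ennreal c * energy a q u + I"
      unfolding X_def c_def I_def using ab q by (intro W_power_fractional) auto
    have "I \<le> X" by (simp add: X)
    then have "I < top" using fin by (simp add: X_def)
    then have int: "integrable (lebesgue_on \<Omega>) u"
      using u q by (intro integrable_of_nn_integral_powr[of u q]) (auto simp: I_def)
    have "energy a q u = ennreal (1 / c) * (ennreal c * energy a q u)"
      using c by (simp add: mult.assoc[symmetric] flip: ennreal_mult)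
    also have "\<dots> \<le> ennreal (1 / c) * X"
      by (intro mult_left_mono) (auto simp: X)
    finally have "energy a q u \<up> (r / q) \<le> (ennreal (1 / c) * X) \<up> (r / q)"
      using q r by (intro epowr_mono) auto
    also have "\<dots> = ennreal ((1 / c) powr (r / q)) * X \<up> (r / q)"
      using c by (simp add: epowr_mult epowr_ennreal)
    finally have Eb: "energy b r u \<le> K * X \<up> (r / q)"
      using C1[OF int] unfolding K_def mult.assoc by (meson mult_left_mono order_trans zero_le)
    have Ib: "I \<up> (r / q) \<le> 1 * X \<up> (r / q)"
      using q r \<open>I \<le> X\<close> by (simp add: epowr_mono)
    have "W_power \<Omega> b r u = ennreal c' * energy b r u + (\<integral>\<^sup>+x. ennreal (\<bar>u x\<bar> powr r) \<partial>lebesgue_on \<Omega>)"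
      unfolding c'_def using ab r by (intro W_power_fractional) auto
    also have "\<dots> \<le> ennreal c' * energy b r u + ennreal C2 * (energy b r u + I \<up> (r / q))"
      unfolding I_def by (intro add_left_mono C2 u)
    also have "\<dots> \<le> ennreal c' * (K * X \<up> (r / q)) + ennreal C2 * (K * X \<up> (r / q) + 1 * X \<up> (r / q))"
      by (intro add_mono mult_left_mono Eb Ib) auto
    also have "\<dots> = (ennreal c' * K + ennreal C2 * (K + 1)) * X \<up> (r / q)"
      by (simp add: distrib_left distrib_right mult.assoc)
    finally show "W_power \<Omega> b r u \<le> (ennreal c' * K + ennreal C2 * (K + 1)) * W_power \<Omega> a q u \<up> (r / q)"
      unfolding X_def .
  qed (use q r in \<open>auto simp: K_def ennreal_mult_less_top\<close>)
qed

text \<open>The detour leads through a positive order b, so small that the index condition survives;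
  the strict inequality leaves room for it.\<close>

theorem fractional_embedding_Lp:
  assumes a: "0 < a" "a < 1" and q: "1 \<le> q" and r: "1 \<le> r"
    and idx: "r < q \<or> - real DIM('a) / r < a - real DIM('a) / q"
  shows "W_embedded \<Omega> (a, q) (0, r)"
proof -
  define b where "b = (if r < q then a / 2 else min (a / 2) (a - real DIM('a) / q + real DIM('a) / r))"
  have "0 < b" "b < a" using a idx by (auto simp: b_def)
  moreover have "r < q \<or> b - real DIM('a) / r \<le> a - real DIM('a) / q" by (auto simp: b_def)
  ultimately have "W_embedded \<Omega> (a, q) (b, r)" using a q r by (intro fractional_embedding) auto
  then show ?thesis using W_embedded_Lp W_embedded_trans r by (metis less_le_trans zero_less_one)
qed

lemma weak_gradient_of_finite:
  assumes "W_power \<Omega> 1 p u < top" "0 < p"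
  shows "is_weak_gradient \<Omega> u (weak_gradient \<Omega> u)"
    and "W_power \<Omega> 1 p u = (\<integral>\<^sup>+x. ennreal (norm (weak_gradient \<Omega> u x) powr p) \<partial>lebesgue_on \<Omega>) + (\<integral>\<^sup>+x. ennreal (\<bar>u x\<bar> powr p) \<partial>lebesgue_on \<Omega>)"
proof -
  have ex: "\<exists>g. is_weak_gradient \<Omega> u g"
    using assms by (auto simp: W_power_def W_seminorm_def split: if_splits)
  then show "is_weak_gradient \<Omega> u (weak_gradient \<Omega> u)"
    unfolding weak_gradient_def by (rule someI_ex)
  show "W_power \<Omega> 1 p u = (\<integral>\<^sup>+x. ennreal (norm (weak_gradient \<Omega> u x) powr p) \<partial>lebesgue_on \<Omega>) + (\<integral>\<^sup>+x. ennreal (\<bar>u x\<bar> powr p) \<partial>lebesgue_on \<Omega>)"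
    using ex assms by (simp add: W_power_def W_seminorm_def Lp_norm_epowr)
qed

text \<open>The target has index 0, like the source: \<open>c * r = n\<close> for r = n / c.
  Therefore the weights of the telescoping estimate are precisely those of
  \<open>potential_embedding\<close>, with no power of the scale to spare.\<close>

theorem gradient_embedding:
  assumes n: "1 < DIM('a)" and c: "0 < c" "c < 1"
  shows "W_embedded \<Omega> (1, real DIM('a)) (c, real DIM('a) / c)"
proof -
  define n where "n = real DIM('a)"
  define r where "r = n / c"
  have n1: "1 < n" using n by (simp add: n_def)
  have r: "n < r" using c n1 by (simp add: r_def field_simps)
  have r0: "0 < r" "1 \<le> r" using n1 r by auto
  have cr: "c * r = n" using c by (simp add: r_def)
  have \<kappa>4: "0 < 4 / \<kappa>" using \<kappa> by simp
  obtain C1 where C1: "0 \<le> C1" "\<And>u A. u \<in> borel_measurable (lebesgue_on \<Omega>) \<Longrightarrow> (\<And>j. A j \<in> borel_measurable (lebesgue_on \<Omega>)) \<Longrightarrow> telescopes u A \<Longrightarrow>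
    energy c r u \<le> ennreal C1 * (\<Sum>j. ennreal (scale j powr - (c * r)) * (\<integral>\<^sup>+x. A j x \<up> r \<partial>lebesgue_on \<Omega>))"
    using energy_le_of_telescope[OF c(1) r0(1)] by blast
  obtain C2 where C2: "0 \<le> C2" "\<And>g :: 'a \<Rightarrow> real. g \<in> borel_measurable (lebesgue_on \<Omega>) \<Longrightarrow> (\<And>x. 0 \<le> g x) \<Longrightarrow>
    (\<Sum>j. ennreal (scale j powr - n) * (\<integral>\<^sup>+x. (ennreal (scale j powr (1 - n)) *
      (\<integral>\<^sup>+y. (if dist x y < 4 / \<kappa> * scale j then ennreal (g y) else 0) \<partial>lebesgue_on \<Omega>)) \<up> r \<partial>lebesgue_on \<Omega>)) \<le>
    ennreal C2 * (\<integral>\<^sup>+x. ennreal (g x powr n) \<partial>lebesgue_on \<Omega>) \<up> (r / n)"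
    using potential_embedding[OF n1[unfolded n_def] r[unfolded n_def] \<kappa>4] unfolding n_def by blast
  obtain H where H: "0 \<le> H" "\<And>u g. is_weak_gradient \<Omega> u g \<Longrightarrow> integrable (lebesgue_on \<Omega>) u \<Longrightarrow> integrable (lebesgue_on \<Omega>) g \<Longrightarrow>
    telescopes u (\<lambda>j x. ennreal (2 * potential_const) * ball_potential g j x +
      (if j \<le> k1 then ennreal H * (\<integral>\<^sup>+y. ennreal \<bar>u y\<bar> \<partial>lebesgue_on \<Omega>) else 0))"
    using weak_gradient_telescopes by blast
  obtain C3 where C3: "\<And>u. u \<in> borel_measurable (lebesgue_on \<Omega>) \<Longrightarrow> (\<integral>\<^sup>+x. ennreal (\<bar>u x\<bar> powr r) \<partial>lebesgue_on \<Omega>) \<le>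
    ennreal C3 * (energy c r u + (\<integral>\<^sup>+x. ennreal (\<bar>u x\<bar> powr n) \<partial>lebesgue_on \<Omega>) \<up> (r / n))"
    using nn_integral_powr_le_energy[OF less_imp_le[OF c(1)] less_imp_le[OF n1] r0(2)] by blast
  define m where "m = measure (lebesgue_on \<Omega>) (space (lebesgue_on \<Omega>))"
  have m: "emeasure (lebesgue_on \<Omega>) (space (lebesgue_on \<Omega>)) = ennreal m" "0 \<le> m"
    by (auto simp: m_def emeasure_eq_measure)
  define L where "L = ennreal (2 * potential_const)"
  define B where "B = ennreal (2 powr n * m powr (n - 1)) \<up> (r / n)"
  \<comment> \<open>Only the finitely many scales up to \<open>k1\<close> carry the constant term,
    so its weighted sum is finite although the weights grow.\<close>
  define S where "S = (\<Sum>j\<le>k1. ennreal (scale j powr - n))"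
  define K where "K = ennreal C1 * (ennreal (2 powr r) * (L \<up> r * ennreal C2 + S * (ennreal H \<up> r * B * ennreal m)))"
  define c' where "c' = gagliardo_const (real DIM('a)) c r"
  have "W_embedded \<Omega> (1, n) (c, r)"
  proof (rule W_embeddedI[where C="ennreal c' * K + ennreal C3 * (K + 1)"])
    have "S < top" by (simp add: S_def)
    then show "ennreal c' * K + ennreal C3 * (K + 1) < top"
      by (simp add: K_def L_def B_def ennreal_mult_less_top)
    fix u assume u: "u \<in> borel_measurable (lebesgue_on \<Omega>)" and fin: "W_power \<Omega> 1 n u < top"
    define g where "g = weak_gradient \<Omega> u"
    define X where "X = W_power \<Omega> 1 n u"
    define G where "G = (\<integral>\<^sup>+x. ennreal (norm (g x) powr n) \<partial>lebesgue_on \<Omega>)"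
    define I where "I = (\<integral>\<^sup>+x. ennreal (\<bar>u x\<bar> powr n) \<partial>lebesgue_on \<Omega>)"
    define I1 where "I1 = (\<integral>\<^sup>+x. ennreal \<bar>u x\<bar> \<partial>lebesgue_on \<Omega>)"
    have wg: "is_weak_gradient \<Omega> u g" and X: "X = G + I"
      using weak_gradient_of_finite[OF fin] n1 by (auto simp: X_def G_def I_def g_def)
    have GX: "G \<le> X" "I \<le> X" by (auto simp: X)
    have fins: "I < top" "G < top"
      using le_less_trans[OF GX(1)] le_less_trans[OF GX(2)] fin unfolding X_def by blast+
    have g: "g \<in> borel_measurable (lebesgue_on \<Omega>)" using wg unfolding is_weak_gradient_def by (elim conjE)
    have int_u: "integrable (lebesgue_on \<Omega>) u"
      by (rule integrable_of_nn_integral_powr[OF u less_imp_le[OF n1]]) (use fins(1) in \<open>unfold I_def real_norm_def\<close>)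
    have int_g: "integrable (lebesgue_on \<Omega>) g"
      by (rule integrable_of_nn_integral_powr[OF g less_imp_le[OF n1]]) (use fins(2) in \<open>unfold G_def\<close>)
    have [measurable]: "ball_potential g j \<in> borel_measurable (lebesgue_on \<Omega>)" for j
      unfolding ball_potential_def using g by measurable
    have I1: "I1 \<up> r \<le> B * X \<up> (r / n)"
    proof -
      have "I1 \<up> n \<le> ennreal (2 powr n * m powr (n - 1)) * (\<integral>\<^sup>+x. ennreal \<bar>u x\<bar> \<up> n \<partial>lebesgue_on \<Omega>)"
        unfolding I1_def using u m n1 by (intro nn_integral_epowr_le) auto
      also have "(\<integral>\<^sup>+x. ennreal \<bar>u x\<bar> \<up> n \<partial>lebesgue_on \<Omega>) = I"
        by (simp add: I_def epowr_ennreal)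
      also have "ennreal (2 powr n * m powr (n - 1)) * I \<le> ennreal (2 powr n * m powr (n - 1)) * X"
        by (intro mult_left_mono GX) auto
      finally have "(I1 \<up> n) \<up> (r / n) \<le> (ennreal (2 powr n * m powr (n - 1)) * X) \<up> (r / n)"
        using n1 r by (intro epowr_mono) auto
      then show ?thesis using n1 by (simp add: epowr_epowr epowr_mult B_def)
    qed
    have e1: "energy c r u \<le> ennreal C1 * (\<Sum>j. ennreal (scale j powr - (c * r)) *
      (\<integral>\<^sup>+x. (L * ball_potential g j x + (if j \<le> k1 then ennreal H * I1 else 0)) \<up> r \<partial>lebesgue_on \<Omega>))"
      unfolding L_def I1_def by (intro C1 u H wg int_u int_g) measurable
    have "(\<Sum>j. ennreal (scale j powr - (c * r)) *
      (\<integral>\<^sup>+x. (L * ball_potential g j x + (if j \<le> k1 then ennreal H * I1 else 0)) \<up> r \<partial>lebesgue_on \<Omega>)) \<le>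
      (\<Sum>j. ennreal (2 powr r) * (L \<up> r * (ennreal (scale j powr - n) * (\<integral>\<^sup>+x. ball_potential g j x \<up> r \<partial>lebesgue_on \<Omega>)) +
        (if j \<le> k1 then ennreal (scale j powr - n) else 0) * (ennreal H \<up> r * I1 \<up> r * ennreal m)))"
    proof (intro suminf_le)
      fix j
      define a where "a = (if j \<le> k1 then ennreal H * I1 else 0)"
      have "(\<integral>\<^sup>+x. (L * ball_potential g j x + a) \<up> r \<partial>lebesgue_on \<Omega>) \<le>
        (\<integral>\<^sup>+x. ennreal (2 powr r) * (L \<up> r * ball_potential g j x \<up> r + a \<up> r) \<partial>lebesgue_on \<Omega>)"
        using r n1 unfolding epowr_mult[symmetric] by (intro nn_integral_mono epowr_add_le) auto
      also have "\<dots> = ennreal (2 powr r) * (L \<up> r * (\<integral>\<^sup>+x. ball_potential g j x \<up> r \<partial>lebesgue_on \<Omega>) + a \<up> r * ennreal m)"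
        by (subst nn_integral_cmult, measurable, subst nn_integral_add, measurable, subst nn_integral_cmult, measurable)
          (simp only: nn_integral_const m(1))
      finally have "ennreal (scale j powr - n) * (\<integral>\<^sup>+x. (L * ball_potential g j x + a) \<up> r \<partial>lebesgue_on \<Omega>) \<le>
        ennreal (scale j powr - n) * (ennreal (2 powr r) * (L \<up> r * (\<integral>\<^sup>+x. ball_potential g j x \<up> r \<partial>lebesgue_on \<Omega>) + a \<up> r * ennreal m))"
        by (rule mult_left_mono) simp
      also have "\<dots> = ennreal (2 powr r) * (L \<up> r * (ennreal (scale j powr - n) * (\<integral>\<^sup>+x. ball_potential g j x \<up> r \<partial>lebesgue_on \<Omega>)) +
        (if j \<le> k1 then ennreal (scale j powr - n) else 0) * (ennreal H \<up> r * I1 \<up> r * ennreal m))"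
        by (cases "j \<le> k1") (simp_all add: a_def epowr_mult distrib_left mult_ac)
      finally show "ennreal (scale j powr - (c * r)) *
        (\<integral>\<^sup>+x. (L * ball_potential g j x + (if j \<le> k1 then ennreal H * I1 else 0)) \<up> r \<partial>lebesgue_on \<Omega>) \<le>
        ennreal (2 powr r) * (L \<up> r * (ennreal (scale j powr - n) * (\<integral>\<^sup>+x. ball_potential g j x \<up> r \<partial>lebesgue_on \<Omega>)) +
        (if j \<le> k1 then ennreal (scale j powr - n) else 0) * (ennreal H \<up> r * I1 \<up> r * ennreal m))"
        unfolding a_def cr .
    qed auto
    also have "\<dots> = ennreal (2 powr r) * (L \<up> r * (\<Sum>j. ennreal (scale j powr - n) * (\<integral>\<^sup>+x. ball_potential g j x \<up> r \<partial>lebesgue_on \<Omega>)) +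
        (\<Sum>j. if j \<le> k1 then ennreal (scale j powr - n) else 0) * (ennreal H \<up> r * I1 \<up> r * ennreal m))"
      by (simp only: ennreal_suminf_cmult suminf_add[symmetric] summableI ennreal_suminf_multc)
    finally have e2: "(\<Sum>j. ennreal (scale j powr - (c * r)) *
      (\<integral>\<^sup>+x. (L * ball_potential g j x + (if j \<le> k1 then ennreal H * I1 else 0)) \<up> r \<partial>lebesgue_on \<Omega>)) \<le>
      ennreal (2 powr r) * (L \<up> r * (\<Sum>j. ennreal (scale j powr - n) * (\<integral>\<^sup>+x. ball_potential g j x \<up> r \<partial>lebesgue_on \<Omega>)) +
        (\<Sum>j. if j \<le> k1 then ennreal (scale j powr - n) else 0) * (ennreal H \<up> r * I1 \<up> r * ennreal m))" .
    have e3: "(\<Sum>j. if j \<le> k1 then ennreal (scale j powr - n) else 0) = S"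
      unfolding S_def by (subst suminf_finite[of "{..k1}"]) auto
    have e4: "(\<Sum>j. ennreal (scale j powr - n) * (\<integral>\<^sup>+x. ball_potential g j x \<up> r \<partial>lebesgue_on \<Omega>)) \<le> ennreal C2 * X \<up> (r / n)"
    proof -
      have "(\<lambda>x. norm (g x)) \<in> borel_measurable (lebesgue_on \<Omega>)" using g by measurable
      then have "(\<Sum>j. ennreal (scale j powr - n) * (\<integral>\<^sup>+x. ball_potential g j x \<up> r \<partial>lebesgue_on \<Omega>)) \<le> ennreal C2 * G \<up> (r / n)"
        unfolding G_def ball_potential_def n_def[symmetric] by (rule C2(2)) (rule norm_ge_zero)
      also have "\<dots> \<le> ennreal C2 * X \<up> (r / n)"
        using GX(1) n1 r by (intro mult_left_mono epowr_mono) auto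
      finally show ?thesis .
    qed
    have "energy c r u \<le> ennreal C1 * (ennreal (2 powr r) * (L \<up> r * (ennreal C2 * X \<up> (r / n)) +
      S * (ennreal H \<up> r * (B * X \<up> (r / n)) * ennreal m)))"
    proof (rule order_trans[OF e1], rule mult_left_mono, rule order_trans[OF e2])
      show "ennreal (2 powr r) * (L \<up> r * (\<Sum>j. ennreal (scale j powr - n) * (\<integral>\<^sup>+x. ball_potential g j x \<up> r \<partial>lebesgue_on \<Omega>)) +
        (\<Sum>j. if j \<le> k1 then ennreal (scale j powr - n) else 0) * (ennreal H \<up> r * I1 \<up> r * ennreal m)) \<le>
        ennreal (2 powr r) * (L \<up> r * (ennreal C2 * X \<up> (r / n)) + S * (ennreal H \<up> r * (B * X \<up> (r / n)) * ennreal m))"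
        unfolding e3 by (intro mult_left_mono add_mono mult_right_mono e4 I1) auto
    qed simp
    also have "\<dots> = K * X \<up> (r / n)"
      unfolding K_def by (simp only: distrib_left distrib_right mult_ac)
    finally have Ec: "energy c r u \<le> K * X \<up> (r / n)" .
    have Ib: "I \<up> (r / n) \<le> 1 * X \<up> (r / n)"
      using n1 r GX by (simp add: epowr_mono)
    have "W_power \<Omega> c r u = ennreal c' * energy c r u + (\<integral>\<^sup>+x. ennreal (\<bar>u x\<bar> powr r) \<partial>lebesgue_on \<Omega>)"
      unfolding c'_def using c r n1 by (intro W_power_fractional) auto
    also have "\<dots> \<le> ennreal c' * energy c r u + ennreal C3 * (energy c r u + I \<up> (r / n))"
      unfolding I_def by (intro add_left_mono C3 u)
    also have "\<dots> \<le> ennreal c' * (K * X \<up> (r / n)) + ennreal C3 * (K * X \<up> (r / n) + 1 * X \<up> (r / n))"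
      by (intro add_mono mult_left_mono Ec Ib) auto
    also have "\<dots> = (ennreal c' * K + ennreal C3 * (K + 1)) * X \<up> (r / n)"
      by (simp add: distrib_left distrib_right mult.assoc)
    finally show "W_power \<Omega> c r u \<le> (ennreal c' * K + ennreal C3 * (K + 1)) * W_power \<Omega> 1 n u \<up> (r / n)"
      unfolding X_def .
  qed (use n1 r in auto)
  then show ?thesis by (simp add: n_def r_def)
qed

text \<open>In dimension one the annuli have bounded overlap, so the potentials sum up to the \<open>L\<^sup>1\<close> norm.\<close>

lemma suminf_annulus_potential_le:
  assumes dim: "DIM('a) = 1" and g: "g \<in> borel_measurable (lebesgue_on \<Omega>)"
  shows "(\<Sum>j. annulus_potential g j x) \<le> 16 * (\<integral>\<^sup>+y. ennreal (norm (g y)) \<partial>lebesgue_on \<Omega>)"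
proof -
  have "(\<Sum>j. annulus_potential g j x) =
    (\<Sum>j. \<integral>\<^sup>+y. (if \<tau> j / 4 \<le> dist x y \<and> dist x y < 2 * \<tau> j then ennreal (norm (g y)) else 0) \<partial>lebesgue_on \<Omega>)"
    unfolding annulus_potential_def dim by simp
  also have "\<dots> = (\<integral>\<^sup>+y. (\<Sum>j. if \<tau> j / 4 \<le> dist x y \<and> dist x y < 2 * \<tau> j then ennreal (norm (g y)) else 0) \<partial>lebesgue_on \<Omega>)"
    by (rule nn_integral_suminf[symmetric]) (use g in measurable)
  also have "\<dots> \<le> (\<integral>\<^sup>+y. 16 * ennreal (norm (g y)) \<partial>lebesgue_on \<Omega>)"
  proof (intro nn_integral_mono)
    fix y
    show "(\<Sum>j. if \<tau> j / 4 \<le> dist x y \<and> dist x y < 2 * \<tau> j then ennreal (norm (g y)) else 0) \<le> 16 * ennreal (norm (g y))"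
    proof (cases "dist x y = 0")
      case True
      moreover have "\<not> \<tau> j \<le> 0" for j using \<tau>_pos[of j] by simp
      ultimately show ?thesis by simp
    next
      case False
      define d where "d = dist x y"
      have d: "0 < d" using False by (simp add: d_def)
      have \<tau>: "\<tau> j = (2 / \<kappa> * D) / 2 ^ j" for j by (simp add: \<tau>_def scale_def)
      \<comment> \<open>A scale that occurs satisfies \<open>\<tau> j \<le> 4 * d\<close>, so 1 is
        at most \<open>4 * d / \<tau> j\<close>. This turns counting the annuli through y into a
        geometric sum over \<open>\<tau> j > d / 2\<close>, with value at most 4 d times 2 times 2 /
        d, that is 16.\<close>
      have "(\<Sum>j. if \<tau> j / 4 \<le> dist x y \<and> dist x y < 2 * \<tau> j then ennreal (norm (g y)) else 0) \<le>
        (\<Sum>j. ennreal (4 * d) * ennreal (if d / 2 < \<tau> j then \<tau> j powr - 1 else 0) * ennreal (norm (g y)))"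
      proof (intro suminf_le)
        fix j
        show "(if \<tau> j / 4 \<le> dist x y \<and> dist x y < 2 * \<tau> j then ennreal (norm (g y)) else 0) \<le>
          ennreal (4 * d) * ennreal (if d / 2 < \<tau> j then \<tau> j powr - 1 else 0) * ennreal (norm (g y))"
        proof (cases "\<tau> j / 4 \<le> d \<and> d < 2 * \<tau> j")
          case True
          have "1 \<le> 4 * d * \<tau> j powr - 1"
            using True \<tau>_pos[of j] by (simp add: powr_minus_divide)
          then have "1 * norm (g y) \<le> 4 * d * \<tau> j powr - 1 * norm (g y)"
            by (rule mult_right_mono) simp
          then show ?thesis
            using True d by (simp add: d_def ennreal_leI flip: ennreal_mult)
        next
          case False then show ?thesis by (auto simp: d_def)
        qed
      qed auto
      also have "\<dots> = ennreal (4 * d) * (\<Sum>j. ennreal (if d / 2 < \<tau> j then \<tau> j powr - 1 else 0)) * ennreal (norm (g y))"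
        by (simp only: ennreal_suminf_cmult ennreal_suminf_multc)
      also have "\<dots> \<le> ennreal (4 * d) * ennreal (1 / (1 - 2 powr - 1) * (d / 2) powr - 1) * ennreal (norm (g y))"
        unfolding \<tau> using \<kappa> D_pos d by (intro mult_right_mono mult_left_mono sum_dyadic_ge) auto
      also have "ennreal (4 * d) * ennreal (1 / (1 - 2 powr - 1) * (d / 2) powr - 1) = 16"
        using d by (simp add: powr_minus_divide flip: ennreal_mult)
      finally show ?thesis .
    qed
  qed
  also have "\<dots> = 16 * (\<integral>\<^sup>+y. ennreal (norm (g y)) \<partial>lebesgue_on \<Omega>)"
    by (rule nn_integral_cmult) (use g in measurable)
  finally show ?thesis .
qed

theorem embedding_Linfinity:
  assumes dim: "DIM('a) = 1"
  shows "continuously_embedded (W_space \<Omega> 1 1) (W_norm \<Omega> 1 1) (Linfinity_space \<Omega>) (Linfinity_norm \<Omega>)"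
proof -
  obtain H where H: "0 \<le> H" "\<And>u g x. is_weak_gradient \<Omega> u g \<Longrightarrow> integrable (lebesgue_on \<Omega>) u \<Longrightarrow> integrable (lebesgue_on \<Omega>) g \<Longrightarrow>
    x \<in> \<Omega> \<Longrightarrow> good_point u x \<Longrightarrow>
    ennreal \<bar>u x\<bar> \<le> (\<Sum>j. ennreal potential_const * annulus_potential g (k1 + j) x) +
      ennreal H * (\<integral>\<^sup>+y. ennreal \<bar>u y\<bar> \<partial>lebesgue_on \<Omega>)"
    using weak_gradient_pointwise_le by blast
  define C where "C = potential_const * 16 + H"
  have C: "0 < C" using potential_const_pos H by (simp add: C_def add_pos_nonneg)
  have le: "Linfinity_norm \<Omega> u \<le> ennreal C * W_norm \<Omega> 1 1 u" if "u \<in> W_space \<Omega> 1 1" for u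
  proof -
    have u: "u \<in> borel_measurable (lebesgue_on \<Omega>)" and fin: "W_power \<Omega> 1 1 u < top"
      using that by (auto simp: W_space_iff)
    define g where "g = weak_gradient \<Omega> u"
    define G where "G = (\<integral>\<^sup>+x. ennreal (norm (g x)) \<partial>lebesgue_on \<Omega>)"
    define I where "I = (\<integral>\<^sup>+x. ennreal \<bar>u x\<bar> \<partial>lebesgue_on \<Omega>)"
    have wg: "is_weak_gradient \<Omega> u g"
      unfolding g_def by (rule weak_gradient_of_finite(1)[OF fin]) simp
    have X: "W_power \<Omega> 1 1 u = G + I"
      using weak_gradient_of_finite(2)[OF fin] by (simp add: G_def I_def g_def)
    have g: "g \<in> borel_measurable (lebesgue_on \<Omega>)" using wg unfolding is_weak_gradient_def by (elim conjE)
    have "G < top" "I < top" using fin unfolding X by auto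
    then have int_u: "integrable (lebesgue_on \<Omega>) u" and int_g: "integrable (lebesgue_on \<Omega>) g"
      unfolding integrable_iff_bounded G_def I_def infinity_ennreal_def real_norm_def using u g by blast+
    have "AE x in lebesgue_on \<Omega>. ennreal \<bar>u x\<bar> \<le> ennreal C * (G + I)"
    proof (rule AE_mp[OF AE_good_point[OF int_u]], intro AE_I2 impI)
      fix x assume "x \<in> space (lebesgue_on \<Omega>)" "good_point u x"
      then have "ennreal \<bar>u x\<bar> \<le> (\<Sum>j. ennreal potential_const * annulus_potential g (k1 + j) x) + ennreal H * I"
        unfolding I_def by (intro H wg int_u int_g) auto
      also have "\<dots> = ennreal potential_const * (\<Sum>j. annulus_potential g (j + k1) x) + ennreal H * I"
        by (simp only: ennreal_suminf_cmult add.commute)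
      also have "\<dots> \<le> ennreal potential_const * (16 * G) + ennreal H * I"
        unfolding G_def using suminf_annulus_potential_le[OF dim g, of x] suminf_shift_le_ennreal[of "\<lambda>j. annulus_potential g j x" k1]
        by (intro add_right_mono mult_left_mono) auto
      also have "\<dots> = ennreal (potential_const * 16) * G + ennreal H * I"
        using potential_const_pos by (simp add: ennreal_mult mult.assoc)
      also have "\<dots> \<le> ennreal C * G + ennreal C * I"
        using potential_const_pos H by (intro add_mono mult_right_mono ennreal_leI) (auto simp: C_def)
      finally show "ennreal \<bar>u x\<bar> \<le> ennreal C * (G + I)" by (simp add: distrib_left)
    qed
    then have "Linfinity_norm \<Omega> u \<le> ennreal C * (G + I)"
      unfolding Linfinity_norm_def using u by (intro esssup_I) auto
    then show ?thesis by (simp add: W_norm_eq X)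
  qed
  have "W_space \<Omega> 1 1 \<subseteq> Linfinity_space \<Omega>"
  proof
    fix u assume u: "u \<in> W_space \<Omega> 1 1"
    have "Linfinity_norm \<Omega> u \<le> ennreal C * W_norm \<Omega> 1 1 u" by (rule le[OF u])
    also have "\<dots> < top" using u by (simp add: W_space_iff W_norm_eq ennreal_mult_less_top)
    finally show "u \<in> Linfinity_space \<Omega>" using u by (simp add: W_space_iff Linfinity_space_def)
  qed
  with le C show ?thesis unfolding continuously_embedded_def by blast
qed

section \<open>The exponent curve\<close>

text \<open>Order and reciprocal exponent are affine along the curve, hence so is the index, which
  is \<theta> times its value at the far end. The borderline orders 1 and 0 occur only at the two
  ends of the curve and are treated apart.\<close>

theorem exponent_curve_embedding:
  assumes s: "0 < s" "s \<le> 1" and p: "1 \<le> p" and sp: "s * p = real DIM('a)" and ne: "s \<noteq> p"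
    and s': "0 < s' \<and> s' < s \<and> 1 \<le> p' \<and> p' \<le> real DIM('a) / s' \<or> s' = 0 \<and> 1 \<le> p'"
    and \<theta>: "0 \<le> \<theta>1" "\<theta>1 \<le> \<theta>2" "\<theta>2 \<le> 1"
  shows "W_embedded \<Omega> (exponent_curve s p s' p' \<theta>1) (exponent_curve s p s' p' \<theta>2)"
proof -
  define N where "N = real DIM('a)"
  have N: "1 \<le> N" using dim_ge_1 by (simp add: N_def)
  define k where "k \<theta> = (1 - \<theta>) / p + \<theta> / p'" for \<theta>
  have p': "1 \<le> p'" and s'0: "0 \<le> s'" "s' < s" using s' s by auto
  \<comment> \<open>If p were 1, then s = N would be at least 1, hence s = 1 = p, against the
    assumption.\<close>
  have p1: "1 < p"
  proof (rule ccontr)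
    assume "\<not> 1 < p"
    then have "p = 1" using p by simp
    then have "s = N" using sp by (simp add: N_def)
    then have "s = 1" using s N by simp
    then show False using ne \<open>p = 1\<close> by simp
  qed
  have sN: "N / p = s" using sp p1 by (simp add: N_def field_simps)
  have s'N: "s' \<le> N / p'" using s' p' N by (auto simp: N_def field_simps)
  have curve: "exponent_curve s p s' p' \<theta> = (s - \<theta> * (s - s'), 1 / k \<theta>)" if "0 \<le> \<theta>" "\<theta> \<le> 1" for \<theta>
  proof -
    have "k \<theta> = (p' + \<theta> * (p - p')) / (p * p')"
      using p1 p' by (simp add: k_def field_simps)
    then show ?thesis by (simp add: exponent_curve_def algebra_simps)
  qed
  have k: "0 < k \<theta>" "k \<theta> \<le> 1" if "0 \<le> \<theta>" "\<theta> \<le> 1" for \<theta>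
  proof -
    have "(1 - \<theta>) / p \<le> 1 - \<theta>" "\<theta> / p' \<le> \<theta>"
      using that p p' by (auto simp: divide_le_eq mult_le_cancel_left1)
    then show "k \<theta> \<le> 1" by (simp add: k_def)
    show "0 < k \<theta>"
    proof (cases "\<theta> = 0")
      case False
      then have "0 < \<theta> / p'" using that p' by simp
      moreover have "0 \<le> (1 - \<theta>) / p" using that p by simp
      ultimately show ?thesis by (simp add: k_def)
    qed (use p in \<open>simp add: k_def\<close>)
  qed
  have index: "s - \<theta> * (s - s') - N / (1 / k \<theta>) = \<theta> * (s' - N / p')" for \<theta>
  proof -
    have "N / (1 / k \<theta>) = (1 - \<theta>) * (N / p) + \<theta> * (N / p')"
      by (simp add: k_def algebra_simps)
    then show ?thesis unfolding sN by (simp add: algebra_simps)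
  qed
  show ?thesis
  proof (cases "\<theta>1 = \<theta>2")
    case True
    then show ?thesis by (cases "exponent_curve s p s' p' \<theta>1") (simp add: W_embedded_refl)
  next
    case False
    then have \<theta>12: "\<theta>1 < \<theta>2" "\<theta>1 < 1" "\<theta>2 \<le> 1" "0 \<le> \<theta>2" using \<theta> by auto
    define a where "a = s - \<theta>1 * (s - s')"
    define b where "b = s - \<theta>2 * (s - s')"
    define q where "q = 1 / k \<theta>1"
    define r where "r = 1 / k \<theta>2"
    have curves: "exponent_curve s p s' p' \<theta>1 = (a, q)" "exponent_curve s p s' p' \<theta>2 = (b, r)"
      using curve \<theta> \<theta>12 by (auto simp: a_def b_def q_def r_def)
    have qr: "1 \<le> q" "1 \<le> r" using k \<theta> \<theta>12 by (auto simp: q_def r_def)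
    have ba: "b < a" unfolding a_def b_def using \<theta>12 s'0 by simp
    have le: "\<theta>2 * (s - s') \<le> s - s'" using \<theta>12 s'0 by (intro mult_left_le_one_le) auto
    also have "\<dots> \<le> s" using s'0 by simp
    finally have b0: "0 \<le> b" by (simp add: b_def)
    have ia: "a - N / q = \<theta>1 * (s' - N / p')" and ib: "b - N / r = \<theta>2 * (s' - N / p')"
      using index unfolding a_def b_def q_def r_def by auto
    have idx: "b - N / r \<le> a - N / q"
      unfolding ia ib using s'N \<theta>12 by (intro mult_right_mono_neg) auto
    \<comment> \<open>Order 0 is reached only at \<open>\<theta>2 = 1\<close> with s' = 0. As
      \<open>\<theta>1 < 1\<close>, the index has then dropped strictly, as the embedding into a
      Lebesgue space requires.\<close>
    have strict: "- N / r < \<theta>1 * (s' - N / p')" if "b = 0"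
    proof -
      have \<theta>2: "\<theta>2 * (s - s') = s" using that by (simp add: b_def)
      then have "s' = 0" using le s'0 by simp
      then have r: "- N / r = \<theta>2 * (- N / p')" using ib that by simp
      have "\<theta>2 = 1" using \<theta>2 \<open>s' = 0\<close> s by simp
      moreover have "\<theta>1 * (N / p') < 1 * (N / p')" using \<theta>12 N p' by (intro mult_strict_right_mono) auto
      ultimately show ?thesis unfolding r \<open>s' = 0\<close> by simp
    qed
    have "W_embedded \<Omega> (a, q) (b, r)"
    proof (cases "a < 1")
      case True
      show ?thesis
      proof (cases "b = 0")
        case True
        then show ?thesis
          using fractional_embedding_Lp[of a q r] strict ia ba \<open>a < 1\<close> qr by (simp add: N_def)
      next
        case False
        then show ?thesis
          using fractional_embedding[of b a q r] idx b0 ba True qr by (simp add: N_def)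
      qed
    next
      case False
      \<comment> \<open>Order 1 occurs only at the start of the curve and for s = 1, where the
        exponent is N; and p > 1 makes the dimension at least two.\<close>
      define d where "d = \<theta>1 * (s - s')"
      have "0 \<le> d" using \<theta> s'0 by (simp add: d_def)
      moreover have "a = s - d" by (simp add: a_def d_def)
      ultimately have "s = 1" "d = 0" using False s by auto
      then have "\<theta>1 = 0" using s'0 by (simp add: d_def)
      then have aq: "a = 1" "q = N" using \<open>s = 1\<close> sp by (auto simp: a_def q_def k_def N_def)
      have "1 < DIM('a)" using p1 sp \<open>s = 1\<close> by simp
      \<comment> \<open>An order strictly between b and 1: the gradient gives
        \<open>(c, N / c)\<close>, still of index 0, and the remaining gap between c and b is what
        the fractional embedding consumes.\<close>
      define c where "c = (b + 1) / 2"
      have c: "b < c" "0 < c" "c < 1" using b0 ba aq by (auto simp: c_def)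
      have Nc: "1 \<le> N / c" "c - N / (N / c) = 0" using c N by (auto simp: field_simps)
      have "W_embedded \<Omega> (1, N) (c, N / c)"
        unfolding N_def using c \<open>1 < DIM('a)\<close> by (intro gradient_embedding) auto
      moreover have "W_embedded \<Omega> (c, N / c) (b, r)"
      proof (cases "b = 0")
        case True
        then show ?thesis
          using fractional_embedding_Lp[of c "N / c" r] strict \<open>\<theta>1 = 0\<close> c Nc qr by (simp add: N_def)
      next
        case False
        then show ?thesis
          using fractional_embedding[of b c "N / c" r] idx ia \<open>\<theta>1 = 0\<close> b0 c Nc qr by (simp add: N_def)
      qed
      ultimately show ?thesis unfolding aq by (rule W_embedded_trans)
    qed
    then show ?thesis unfolding curves .
  qed
qed

end

theorem theorem1p7:
  fixes \<Omega> :: "(real ^ 'n) set"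
  assumes "open \<Omega>" and "bounded \<Omega>" and "lipschitz_boundary \<Omega>"
  shows
    "(\<forall>s p s' p' :: real.
        0 < s \<and> s \<le> 1 \<and> 1 \<le> p \<and> s * p = real CARD('n) \<and> s \<noteq> p \<and>
        (0 < s' \<and> s' < s \<and> 1 \<le> p' \<and> p' \<le> real CARD('n) / s' \<or> s' = 0 \<and> 1 \<le> p')
        \<longrightarrow>
        W_embedded \<Omega> (s, p) (s', p') \<and>
        (\<forall>\<theta>1 \<theta>2. 0 \<le> \<theta>1 \<and> \<theta>1 \<le> \<theta>2 \<and> \<theta>2 \<le> 1 \<longrightarrow>
           W_embedded \<Omega> (exponent_curve s p s' p' \<theta>1) (exponent_curve s p s' p' \<theta>2)))
     \<and>
     (CARD('n) = 1 \<longrightarrow>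
        continuously_embedded (W_space \<Omega> 1 1) (W_norm \<Omega> 1 1) (Linfinity_space \<Omega>) (Linfinity_norm \<Omega>))"
proof -
  obtain D c0 c1 E \<kappa> T \<delta> k1 where "lipschitz_domain \<Omega> D c0 c1 E \<kappa> T \<delta> k1"
    using lipschitz_domain_exists[OF assms] by blast
  then interpret lipschitz_domain \<Omega> D c0 c1 E \<kappa> T \<delta> k1 .
  have dim: "DIM(real ^ 'n) = CARD('n)" by simp
  have "W_embedded \<Omega> (s, p) (s', p') \<and>
        (\<forall>\<theta>1 \<theta>2. 0 \<le> \<theta>1 \<and> \<theta>1 \<le> \<theta>2 \<and> \<theta>2 \<le> 1 \<longrightarrow>
           W_embedded \<Omega> (exponent_curve s p s' p' \<theta>1) (exponent_curve s p s' p' \<theta>2))"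
    if "0 < s" "s \<le> 1" "1 \<le> p" "s * p = real CARD('n)" "s \<noteq> p"
      "0 < s' \<and> s' < s \<and> 1 \<le> p' \<and> p' \<le> real CARD('n) / s' \<or> s' = 0 \<and> 1 \<le> p'" for s p s' p'
  proof
    note curve = exponent_curve_embedding[OF that(1-3) that(4)[folded dim] that(5) that(6)[folded dim]]
    then show "\<forall>\<theta>1 \<theta>2. 0 \<le> \<theta>1 \<and> \<theta>1 \<le> \<theta>2 \<and> \<theta>2 \<le> 1 \<longrightarrow>
      W_embedded \<Omega> (exponent_curve s p s' p' \<theta>1) (exponent_curve s p s' p' \<theta>2)"
      by blast
    \<comment> \<open>The first embedding claimed joins the two end points of the curve.\<close>
    have "p \<noteq> 0" "p' \<noteq> 0" using that by auto
    then have "exponent_curve s p s' p' 0 = (s, p)" "exponent_curve s p s' p' 1 = (s', p')"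
      by (simp_all add: exponent_curve_def)
    then show "W_embedded \<Omega> (s, p) (s', p')"
      using curve[of 0 1] by simp
  qed
  moreover have "CARD('n) = 1 \<Longrightarrow>
    continuously_embedded (W_space \<Omega> 1 1) (W_norm \<Omega> 1 1) (Linfinity_space \<Omega>) (Linfinity_norm \<Omega>)"
    by (rule embedding_Linfinity) (simp only: dim)
  ultimately show ?thesis by blast
qed

end
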